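(* Let $(\mathcal{M},\otimes,\mathbf{1})$ be a cocomplete and complete coabelian monoidal category satisfying AB5, and assume that the tensor product commutes with direct sums. Let $(C=\bigoplus_{n\in\mathbb{N}}C_n,\Delta_C,\varepsilon_C)$ be a graded coalgebra in $\mathcal{M}$ and let $T^c:=T^c_{C_0}(C_1)$ be the cotensor coalgebra of the $C_0$-bicomodule $C_1$. Then there is a unique coalgebra homomorphism $$\psi:C\to T^c_{C_0}(C_1)$$ such that $p_0^{T^c}\circ\psi=p_0^C$ and $p_1^{T^c}\circ\psi=p_1^C$. Moreover $\psi$ is a graded coalgebra homomorphism with $$\psi_m=(p_1^C)^{\square_{C_0} m}\circ\overline{\Delta}_C^{\,m-1}\circ i_m^C\quad\text{for every }m\in\mathbb{N},$$ and the following assertions are equivalent: (a) $C$ is a strongly $\mathbb{N}$-graded coalgebra. (a$'$) $\Delta^C_{a,1}:C_{a+1}\to C_a\otimes C_1$ is a monomorphism for every $a\in\mathbb{N}$. (b) $\psi_n$ is a monomorphism for every $n\in\mathbb{N}$. (c) $\psi$ is a monomorphism. (d) $(C(n),\sigma_n^C)=C_0^{\wedge_C^n}$ (as subobjects of $C$) for every $n\in\mathbb{N}$. (e) $(C(2),\sigma_2^C)=C_0^{\wedge_C^2}$ (as subobjects of $C$).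
   Context: Monoidal categories: associativity constraints are suppressed. A monoidal category $\mathcal{M}$ is abelian monoidal if $\mathcal{M}$ is abelian and all functors $X\otimes(-)$ and $(-)\otimes X$ are additive and right exact; it is coabelian monoidal if its opposite is abelian monoidal, i.e. $\mathcal{M}$ is abelian and all these functors are additive and left exact. Algebras, coalgebras, (bi)modules and (bi)comodules in $\mathcal{M}$ are defined as usual. Graded objects: a graded object is $X=\bigoplus_{n\in\mathbb{N}}X_n$ with canonical injections $i_n=i_n^X:X_n\to X$ and projections $p_n=p_n^X:X\to X_n$. A morphism $f:X\to Y$ of graded objects is graded if there are $f_n:X_n\to Y_n$ with $f i_n^X=i_n^Y f_n$ for all $n$. Put $X(0)=0$, $X(n)=\bigoplus_{0\le i\le n-1}X_i$, with canonical injection $\sigma_n:X(n)\to X$. The tensor product is graded by $(X\otimes Y)_n=\bigoplus_{a+b=n}X_a\otimes Y_b$. Graded coalgebra: a coalgebra $(C,\Delta,\varepsilon)$ with $C=\bigoplus_n C_n$ a graded object and $\Delta$ a graded morphism. $\Delta_{a,b}:C_{a+b}\to C_a\otimes C_b$ denotes the $(a,b)$-component of $\Delta|_{C_{a+b}}$, so $\Delta i_n=\sum_{a+b=n}(i_a\otimes i_b)\Delta_{a,b}$. Then $(C_0,\Delta_{0,0},\varepsilon i_0)$ is a coalgebra, $i_0$ and $p_0$ are coalgebra homomorphisms, and each $C_n$ is a $C_0$-bicomodule via $\Delta_{0,n},\Delta_{n,0}$. A graded coalgebra homomorphism is a coalgebra homomorphism which is graded. $C$ is strongly $\mathbb{N}$-graded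 if $\Delta_{i,j}:C_{i+j}\to C_i\otimes C_j$ is a monomorphism for all $i,j\in\mathbb{N}$. Wedge: for a coalgebra $C$ and a monomorphism $\delta:D\to C$ of coalgebras with cokernel $p:C\to L$, $D^{\wedge_C^n}:=\ker(p^{\otimes n}\circ\Delta_C^{n-1})$ for $n\ge1$ (a subobject of $C$), where $\Delta_C^{n-1}:C\to C^{\otimes n}$ is the iterated comultiplication ($\Delta_C^0=\mathrm{Id}$); $D^{\wedge_C^0}:=0$. Here $C_0$ is a subobject of $C$ via $i_0$. Cotensor coalgebra: for a coalgebra $D$, the cotensor product $V\square_D W$ of a right and a left $D$-comodule is the equalizer of $\rho_V\otimes W,\ V\otimes\rho_W:V\otimes W\to V\otimes D\otimes W$; $({}^D\mathcal{M}^D,\square_D,D)$ is a monoidal category. For a $D$-bicomodule $M$, $T^c_D(M)=\bigoplus_{n\in\mathbb{N}}M^{\square_D n}$ with $M^{\square_D 0}=D$; it is a graded coalgebra in $\mathcal{M}$ with $\Delta_{m,n}:M^{\square_D(m+n)}\cong M^{\square_D m}\square_D M^{\square_D n}\hookrightarrow M^{\square_D m}\otimes M^{\square_D n}$ the canonical morphism and counit $\varepsilon_D\circ p_0$. Iterated comultiplication over $C_0$: $C$ is regarded as a coalgebra in $({}^{C_0}\mathcal{M}^{C_0},\square_{C_0},C_0)$ via the coalgebra homomorphism $p_0^C$; $\overline{\Delta}_C^{\,m-1}:C\to C^{\square_{C_0}m}$ is its iterated comultiplication, with $\overline\Delta_C^{\,0}=\mathrm{Id}_C$ and $\overline\Delta_C^{\,-1}=p_0^C:C\to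 C_0$ (the counit), and $(p_1^C)^{\square 0}=\mathrm{Id}_{C_0}$. *)

theory Defs
  imports Main
begin

section \<open>Categories, limits and colimits\<close>

text \<open>Composition is written in the usual order: \<open>g \<cdot> f\<close> is \<open>f\<close> followed by \<open>g\<close>.
  Its value is only constrained when \<open>Dom g = Cod f\<close>.\<close>

record ('o, 'm) category =
  Obj :: "'o set"
  Arr :: "'m set"
  Dom :: "'m \<Rightarrow> 'o"
  Cod :: "'m \<Rightarrow> 'o"
  Ide :: "'o \<Rightarrow> 'm"
  Comp :: "'m \<Rightarrow> 'm \<Rightarrow> 'm"  (infixr "\<cdot>\<index>" 65)

definition hom :: "('o, 'm, 'z) category_scheme \<Rightarrow> 'o \<Rightarrow> 'o \<Rightarrow> 'm set" where
  "hom M A B = {f \<in> Arr M. Dom M f = A \<and> Cod M f = B}"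

locale category =
  fixes M :: "('o, 'm, 'z) category_scheme" (structure)
  assumes Dom_in: "f \<in> Arr M \<Longrightarrow> Dom M f \<in> Obj M"
    and Cod_in: "f \<in> Arr M \<Longrightarrow> Cod M f \<in> Obj M"
    and Ide_in: "A \<in> Obj M \<Longrightarrow> Ide M A \<in> hom M A A"
    and Comp_in: "f \<in> hom M A B \<Longrightarrow> g \<in> hom M B C \<Longrightarrow> g \<cdot> f \<in> hom M A C"
    and Comp_Ide: "f \<in> hom M A B \<Longrightarrow> f \<cdot> Ide M A = f"
    and Ide_Comp: "f \<in> hom M A B \<Longrightarrow> Ide M B \<cdot> f = f"
    and Comp_assoc: "f \<in> hom M A B \<Longrightarrow> g \<in> hom M B C \<Longrightarrow> h \<in> hom M C D \<Longrightarrow>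
      h \<cdot> (g \<cdot> f) = (h \<cdot> g) \<cdot> f"

definition monomorphism :: "('o, 'm, 'z) category_scheme \<Rightarrow> 'm \<Rightarrow> bool" where
  "monomorphism M f \<longleftrightarrow> f \<in> Arr M \<and>
     (\<forall>X. \<forall>g \<in> hom M X (Dom M f). \<forall>h \<in> hom M X (Dom M f). f \<cdot> g = f \<cdot> h \<longrightarrow> g = h)"
  for M (structure)

definition epimorphism :: "('o, 'm, 'z) category_scheme \<Rightarrow> 'm \<Rightarrow> bool" where
  "epimorphism M f \<longleftrightarrow> f \<in> Arr M \<and>
     (\<forall>X. \<forall>g \<in> hom M (Cod M f) X. \<forall>h \<in> hom M (Cod M f) X. g \<cdot> f = h \<cdot> f \<longrightarrow> g = h)"
  for M (structure)

definition isomorphism :: "('o, 'm, 'z) category_scheme \<Rightarrow> 'm \<Rightarrow> bool" where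
  "isomorphism M f \<longleftrightarrow> f \<in> Arr M \<and>
     (\<exists>g \<in> hom M (Cod M f) (Dom M f). g \<cdot> f = Ide M (Dom M f) \<and> f \<cdot> g = Ide M (Cod M f))"
  for M (structure)

definition same_subobject :: "('o, 'm, 'z) category_scheme \<Rightarrow> 'm \<Rightarrow> 'm \<Rightarrow> bool" where
  "same_subobject M k l \<longleftrightarrow> monomorphism M k \<and> monomorphism M l \<and> Cod M k = Cod M l \<and>
     (\<exists>u \<in> hom M (Dom M k) (Dom M l). isomorphism M u \<and> l \<cdot> u = k)"
  for M (structure)

definition is_equalizer ::
  "('o, 'm, 'z) category_scheme \<Rightarrow> 'm \<Rightarrow> 'm \<Rightarrow> 'm \<Rightarrow> bool" where
  "is_equalizer M e f g \<longleftrightarrow>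
     e \<in> Arr M \<and> f \<in> hom M (Cod M e) (Cod M g) \<and> g \<in> hom M (Cod M e) (Cod M g) \<and>
     f \<cdot> e = g \<cdot> e \<and>
     (\<forall>X. \<forall>h \<in> hom M X (Cod M e). f \<cdot> h = g \<cdot> h \<longrightarrow> (\<exists>!u. u \<in> hom M X (Dom M e) \<and> e \<cdot> u = h))"
  for M (structure)

definition is_coproduct ::
  "('o, 'm, 'z) category_scheme \<Rightarrow> 'i set \<Rightarrow> ('i \<Rightarrow> 'o) \<Rightarrow> 'o \<times> ('i \<Rightarrow> 'm) \<Rightarrow> bool" where
  "is_coproduct M I X S \<longleftrightarrow>
     fst S \<in> Obj M \<and> (\<forall>i \<in> I. snd S i \<in> hom M (X i) (fst S)) \<and>
     (\<forall>Y \<in> Obj M. \<forall>f. (\<forall>i \<in> I. f i \<in> hom M (X i) Y) \<longrightarrow>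
        (\<exists>!h. h \<in> hom M (fst S) Y \<and> (\<forall>i \<in> I. h \<cdot> snd S i = f i)))"
  for M (structure)

definition coproduct ::
  "('o, 'm, 'z) category_scheme \<Rightarrow> 'i set \<Rightarrow> ('i \<Rightarrow> 'o) \<Rightarrow> 'o \<times> ('i \<Rightarrow> 'm)" where
  "coproduct M I X = (SOME S. is_coproduct M I X S)"

definition cotuple ::
  "('o, 'm, 'z) category_scheme \<Rightarrow> 'i set \<Rightarrow> 'o \<times> ('i \<Rightarrow> 'm) \<Rightarrow> 'o \<Rightarrow> ('i \<Rightarrow> 'm) \<Rightarrow> 'm" where
  "cotuple M I S Y f = (THE h. h \<in> hom M (fst S) Y \<and> (\<forall>i \<in> I. h \<cdot> snd S i = f i))"
  for M (structure)

record ('j, 'k, 'o, 'm) cat_functor =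
  on_obj :: "'j \<Rightarrow> 'o"
  on_arr :: "'k \<Rightarrow> 'm"

definition is_functor ::
  "('j, 'k, 'y) category_scheme \<Rightarrow> ('o, 'm, 'z) category_scheme \<Rightarrow> ('j, 'k, 'o, 'm) cat_functor \<Rightarrow> bool"
  where
  "is_functor J M F \<longleftrightarrow>
     (\<forall>j \<in> Obj J. on_obj F j \<in> Obj M \<and> on_arr F (Ide J j) = Ide M (on_obj F j)) \<and>
     (\<forall>u \<in> Arr J. on_arr F u \<in> hom M (on_obj F (Dom J u)) (on_obj F (Cod J u))) \<and>
     (\<forall>u \<in> Arr J. \<forall>v \<in> Arr J. Dom J v = Cod J u \<longrightarrow>
        on_arr F (v \<cdot>\<^bsub>J\<^esub> u) = on_arr F v \<cdot>\<^bsub>M\<^esub> on_arr F u)"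

definition is_nat_trans ::
  "('j, 'k, 'y) category_scheme \<Rightarrow> ('o, 'm, 'z) category_scheme \<Rightarrow>
   ('j, 'k, 'o, 'm) cat_functor \<Rightarrow> ('j, 'k, 'o, 'm) cat_functor \<Rightarrow> ('j \<Rightarrow> 'm) \<Rightarrow> bool" where
  "is_nat_trans J M F G t \<longleftrightarrow>
     (\<forall>j \<in> Obj J. t j \<in> hom M (on_obj F j) (on_obj G j)) \<and>
     (\<forall>u \<in> Arr J. on_arr G u \<cdot> t (Dom J u) = t (Cod J u) \<cdot> on_arr F u)"
  for M (structure)

definition is_cone ::
  "('j, 'k, 'y) category_scheme \<Rightarrow> ('o, 'm, 'z) category_scheme \<Rightarrow>
   ('j, 'k, 'o, 'm) cat_functor \<Rightarrow> 'o \<Rightarrow> ('j \<Rightarrow> 'm) \<Rightarrow> bool" where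
  "is_cone J M F L p \<longleftrightarrow> L \<in> Obj M \<and>
     (\<forall>j \<in> Obj J. p j \<in> hom M L (on_obj F j)) \<and>
     (\<forall>u \<in> Arr J. on_arr F u \<cdot> p (Dom J u) = p (Cod J u))"
  for M (structure)

definition is_limit ::
  "('j, 'k, 'y) category_scheme \<Rightarrow> ('o, 'm, 'z) category_scheme \<Rightarrow>
   ('j, 'k, 'o, 'm) cat_functor \<Rightarrow> 'o \<Rightarrow> ('j \<Rightarrow> 'm) \<Rightarrow> bool" where
  "is_limit J M F L p \<longleftrightarrow> is_cone J M F L p \<and>
     (\<forall>X q. is_cone J M F X q \<longrightarrow> (\<exists>!h. h \<in> hom M X L \<and> (\<forall>j \<in> Obj J. p j \<cdot> h = q j)))"
  for M (structure)

definition is_cocone ::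
  "('j, 'k, 'y) category_scheme \<Rightarrow> ('o, 'm, 'z) category_scheme \<Rightarrow>
   ('j, 'k, 'o, 'm) cat_functor \<Rightarrow> 'o \<Rightarrow> ('j \<Rightarrow> 'm) \<Rightarrow> bool" where
  "is_cocone J M F L i \<longleftrightarrow> L \<in> Obj M \<and>
     (\<forall>j \<in> Obj J. i j \<in> hom M (on_obj F j) L) \<and>
     (\<forall>u \<in> Arr J. i (Cod J u) \<cdot> on_arr F u = i (Dom J u))"
  for M (structure)

definition is_colimit ::
  "('j, 'k, 'y) category_scheme \<Rightarrow> ('o, 'm, 'z) category_scheme \<Rightarrow>
   ('j, 'k, 'o, 'm) cat_functor \<Rightarrow> 'o \<Rightarrow> ('j \<Rightarrow> 'm) \<Rightarrow> bool" where
  "is_colimit J M F L i \<longleftrightarrow> is_cocone J M F L i \<and>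
     (\<forall>X q. is_cocone J M F X q \<longrightarrow> (\<exists>!h. h \<in> hom M L X \<and> (\<forall>j \<in> Obj J. h \<cdot> i j = q j)))"
  for M (structure)

text \<open>The type \<open>'u\<close> is the universe of indices: a category is small when its objects and its
  arrows form subsets of \<open>'u\<close>. It is unrelated to the types \<open>'o\<close> and \<open>'m\<close> of the objects and
  arrows of \<open>M\<close>, so \<open>M\<close> itself need not be small. The universe \<open>'u\<close> should be infinite, so that
  countable categories are small.\<close>

definition complete :: "'u itself \<Rightarrow> ('o, 'm, 'z) category_scheme \<Rightarrow> bool" where
  "complete (U :: 'u itself) M \<longleftrightarrow>
     (\<forall>(J :: ('u, 'u) category) F. category J \<and> is_functor J M F \<longrightarrow> (\<exists>L p. is_limit J M F L p))"

definition cocomplete :: "'u itself \<Rightarrow> ('o, 'm, 'z) category_scheme \<Rightarrow> bool" where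
  "cocomplete (U :: 'u itself) M \<longleftrightarrow>
     (\<forall>(J :: ('u, 'u) category) F. category J \<and> is_functor J M F \<longrightarrow> (\<exists>L i. is_colimit J M F L i))"

definition filtered :: "('j, 'k, 'y) category_scheme \<Rightarrow> bool" where
  "filtered J \<longleftrightarrow> category J \<and> Obj J \<noteq> {} \<and>
     (\<forall>a \<in> Obj J. \<forall>b \<in> Obj J. \<exists>c \<in> Obj J. hom J a c \<noteq> {} \<and> hom J b c \<noteq> {}) \<and>
     (\<forall>a b. \<forall>u \<in> hom J a b. \<forall>v \<in> hom J a b. \<exists>c. \<exists>w \<in> hom J b c. w \<cdot> u = w \<cdot> v)"
  for J (structure)

section \<open>Abelian categories\<close>

record ('o, 'm) preadditive = "('o, 'm) category" +
  Add :: "'m \<Rightarrow> 'm \<Rightarrow> 'm"  (infixl "\<oplus>\<index>" 60)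
  Zero :: "'o \<Rightarrow> 'o \<Rightarrow> 'm"

locale preadditive_category = category M
  for M :: "('o, 'm, 'z) preadditive_scheme" (structure) +
  assumes Add_in: "f \<in> hom M A B \<Longrightarrow> g \<in> hom M A B \<Longrightarrow> f \<oplus> g \<in> hom M A B"
    and Add_assoc: "f \<in> hom M A B \<Longrightarrow> g \<in> hom M A B \<Longrightarrow> h \<in> hom M A B \<Longrightarrow>
      (f \<oplus> g) \<oplus> h = f \<oplus> (g \<oplus> h)"
    and Add_commute: "f \<in> hom M A B \<Longrightarrow> g \<in> hom M A B \<Longrightarrow> f \<oplus> g = g \<oplus> f"
    and Zero_in: "A \<in> Obj M \<Longrightarrow> B \<in> Obj M \<Longrightarrow> Zero M A B \<in> hom M A B"
    and Add_Zero: "f \<in> hom M A B \<Longrightarrow> f \<oplus> Zero M A B = f"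
    and Add_inverse: "f \<in> hom M A B \<Longrightarrow> \<exists>g \<in> hom M A B. f \<oplus> g = Zero M A B"
    and Comp_Add: "f \<in> hom M A B \<Longrightarrow> g \<in> hom M A B \<Longrightarrow> h \<in> hom M B C \<Longrightarrow>
      h \<cdot> (f \<oplus> g) = (h \<cdot> f) \<oplus> (h \<cdot> g)"
    and Add_Comp: "h \<in> hom M A B \<Longrightarrow> f \<in> hom M B C \<Longrightarrow> g \<in> hom M B C \<Longrightarrow>
      (f \<oplus> g) \<cdot> h = (f \<cdot> h) \<oplus> (g \<cdot> h)"

fun sum_upto :: "('o, 'm, 'z) preadditive_scheme \<Rightarrow> (nat \<Rightarrow> 'm) \<Rightarrow> nat \<Rightarrow> 'm" where
  "sum_upto M f 0 = f 0"
| "sum_upto M f (Suc n) = sum_upto M f n \<oplus>\<^bsub>M\<^esub> f (Suc n)"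

definition is_kernel :: "('o, 'm, 'z) preadditive_scheme \<Rightarrow> 'm \<Rightarrow> 'm \<Rightarrow> bool" where
  "is_kernel M k f \<longleftrightarrow>
     k \<in> Arr M \<and> f \<in> Arr M \<and> Cod M k = Dom M f \<and> f \<cdot> k = Zero M (Dom M k) (Cod M f) \<and>
     (\<forall>X. \<forall>g \<in> hom M X (Dom M f). f \<cdot> g = Zero M X (Cod M f) \<longrightarrow>
        (\<exists>!u. u \<in> hom M X (Dom M k) \<and> k \<cdot> u = g))"
  for M (structure)

definition is_cokernel :: "('o, 'm, 'z) preadditive_scheme \<Rightarrow> 'm \<Rightarrow> 'm \<Rightarrow> bool" where
  "is_cokernel M q f \<longleftrightarrow>
     q \<in> Arr M \<and> f \<in> Arr M \<and> Dom M q = Cod M f \<and> q \<cdot> f = Zero M (Dom M f) (Cod M q) \<and>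
     (\<forall>X. \<forall>g \<in> hom M (Cod M f) X. g \<cdot> f = Zero M (Dom M f) X \<longrightarrow>
        (\<exists>!u. u \<in> hom M (Cod M q) X \<and> u \<cdot> q = g))"
  for M (structure)

definition short_exact :: "('o, 'm, 'z) preadditive_scheme \<Rightarrow> 'm \<Rightarrow> 'm \<Rightarrow> bool" where
  "short_exact M f g \<longleftrightarrow> is_kernel M f g \<and> is_cokernel M g f"

definition is_zero_object :: "('o, 'm, 'z) preadditive_scheme \<Rightarrow> 'o \<Rightarrow> bool" where
  "is_zero_object M Z \<longleftrightarrow> Z \<in> Obj M \<and>
     (\<forall>A \<in> Obj M. (\<exists>!f. f \<in> hom M Z A) \<and> (\<exists>!f. f \<in> hom M A Z))"

definition zero_object :: "('o, 'm, 'z) preadditive_scheme \<Rightarrow> 'o" where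
  "zero_object M = (SOME Z. is_zero_object M Z)"

locale abelian_category = preadditive_category M
  for M :: "('o, 'm, 'z) preadditive_scheme" (structure) +
  assumes zero_object_exists: "\<exists>Z. is_zero_object M Z"
    and biproduct_exists: "A \<in> Obj M \<Longrightarrow> B \<in> Obj M \<Longrightarrow>
      \<exists>S. \<exists>i \<in> hom M A S. \<exists>j \<in> hom M B S. \<exists>p \<in> hom M S A. \<exists>q \<in> hom M S B.
        p \<cdot> i = Ide M A \<and> q \<cdot> j = Ide M B \<and> p \<cdot> j = Zero M B A \<and> q \<cdot> i = Zero M A B \<and>
        (i \<cdot> p) \<oplus> (j \<cdot> q) = Ide M S"
    and kernel_exists: "f \<in> Arr M \<Longrightarrow> \<exists>k. is_kernel M k f"
    and cokernel_exists: "f \<in> Arr M \<Longrightarrow> \<exists>q. is_cokernel M q f"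
    and mono_is_kernel: "monomorphism M k \<Longrightarrow> \<exists>f. is_kernel M k f"
    and epi_is_cokernel: "epimorphism M q \<Longrightarrow> \<exists>f. is_cokernel M q f"

text \<open>AB5 in the form: small filtered colimits of short exact sequences are short exact
  (the existence of colimits being part of \<open>cocomplete\<close>).\<close>

definition AB5 :: "'u itself \<Rightarrow> ('o, 'm, 'z) preadditive_scheme \<Rightarrow> bool" where
  "AB5 (U :: 'u itself) M \<longleftrightarrow>
     (\<forall>(J :: ('u, 'u) category) F G H s t A a B b E e f g.
        filtered J \<and> is_functor J M F \<and> is_functor J M G \<and> is_functor J M H \<and>
        is_nat_trans J M F G s \<and> is_nat_trans J M G H t \<and>
        (\<forall>j \<in> Obj J. short_exact M (s j) (t j)) \<and>
        is_colimit J M F A a \<and> is_colimit J M G B b \<and> is_colimit J M H E e \<and>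
        f \<in> hom M A B \<and> (\<forall>j \<in> Obj J. f \<cdot> a j = b j \<cdot> s j) \<and>
        g \<in> hom M B E \<and> (\<forall>j \<in> Obj J. g \<cdot> b j = e j \<cdot> t j) \<longrightarrow>
        short_exact M f g)"
  for M (structure)

definition additive_map :: "('o, 'm, 'z) preadditive_scheme \<Rightarrow> ('m \<Rightarrow> 'm) \<Rightarrow> bool" where
  "additive_map M F \<longleftrightarrow> (\<forall>A B. \<forall>f \<in> hom M A B. \<forall>g \<in> hom M A B. F (f \<oplus> g) = F f \<oplus> F g)"
  for M (structure)

definition left_exact_map :: "('o, 'm, 'z) preadditive_scheme \<Rightarrow> ('m \<Rightarrow> 'm) \<Rightarrow> bool" where
  "left_exact_map M F \<longleftrightarrow> (\<forall>k f. is_kernel M k f \<longrightarrow> is_kernel M (F k) (F f))"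

section \<open>Monoidal categories\<close>

text \<open>The tensor product is \<open>\<otimes>\<close> on objects and \<open>\<boxtimes>\<close> on arrows. Monoidal categories are not assumed
  to be strict; \<open>Assoc A B C : (A \<otimes> B) \<otimes> C \<rightarrow> A \<otimes> (B \<otimes> C)\<close>.\<close>

record ('o, 'm) monoidal = "('o, 'm) preadditive" +
  TensorO :: "'o \<Rightarrow> 'o \<Rightarrow> 'o"  (infixl "\<otimes>\<index>" 70)
  TensorA :: "'m \<Rightarrow> 'm \<Rightarrow> 'm"  (infixl "\<boxtimes>\<index>" 70)
  Unit :: "'o"  ("\<one>\<index>")
  Assoc :: "'o \<Rightarrow> 'o \<Rightarrow> 'o \<Rightarrow> 'm"
  LUnit :: "'o \<Rightarrow> 'm"
  RUnit :: "'o \<Rightarrow> 'm"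

locale monoidal_category = category M
  for M :: "('o, 'm, 'z) monoidal_scheme" (structure) +
  assumes TensorO_in: "A \<in> Obj M \<Longrightarrow> B \<in> Obj M \<Longrightarrow> A \<otimes> B \<in> Obj M"
    and TensorA_in: "f \<in> hom M A A' \<Longrightarrow> g \<in> hom M B B' \<Longrightarrow> f \<boxtimes> g \<in> hom M (A \<otimes> B) (A' \<otimes> B')"
    and TensorA_Ide: "A \<in> Obj M \<Longrightarrow> B \<in> Obj M \<Longrightarrow> Ide M A \<boxtimes> Ide M B = Ide M (A \<otimes> B)"
    and TensorA_Comp: "f \<in> hom M A A' \<Longrightarrow> f' \<in> hom M A' A'' \<Longrightarrow>
      g \<in> hom M B B' \<Longrightarrow> g' \<in> hom M B' B'' \<Longrightarrow> (f' \<cdot> f) \<boxtimes> (g' \<cdot> g) = (f' \<boxtimes> g') \<cdot> (f \<boxtimes> g)"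
    and Unit_in: "\<one> \<in> Obj M"
    and Assoc_in: "A \<in> Obj M \<Longrightarrow> B \<in> Obj M \<Longrightarrow> C \<in> Obj M \<Longrightarrow>
      Assoc M A B C \<in> hom M (A \<otimes> B \<otimes> C) (A \<otimes> (B \<otimes> C)) \<and> isomorphism M (Assoc M A B C)"
    and Assoc_natural: "f \<in> hom M A A' \<Longrightarrow> g \<in> hom M B B' \<Longrightarrow> h \<in> hom M C C' \<Longrightarrow>
      Assoc M A' B' C' \<cdot> (f \<boxtimes> g \<boxtimes> h) = (f \<boxtimes> (g \<boxtimes> h)) \<cdot> Assoc M A B C"
    and LUnit_in: "A \<in> Obj M \<Longrightarrow> LUnit M A \<in> hom M (\<one> \<otimes> A) A \<and> isomorphism M (LUnit M A)"
    and LUnit_natural: "f \<in> hom M A A' \<Longrightarrow> LUnit M A' \<cdot> (Ide M \<one> \<boxtimes> f) = f \<cdot> LUnit M A"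
    and RUnit_in: "A \<in> Obj M \<Longrightarrow> RUnit M A \<in> hom M (A \<otimes> \<one>) A \<and> isomorphism M (RUnit M A)"
    and RUnit_natural: "f \<in> hom M A A' \<Longrightarrow> RUnit M A' \<cdot> (f \<boxtimes> Ide M \<one>) = f \<cdot> RUnit M A"
    and pentagon: "A \<in> Obj M \<Longrightarrow> B \<in> Obj M \<Longrightarrow> C \<in> Obj M \<Longrightarrow> D \<in> Obj M \<Longrightarrow>
      (Ide M A \<boxtimes> Assoc M B C D) \<cdot> Assoc M A (B \<otimes> C) D \<cdot> (Assoc M A B C \<boxtimes> Ide M D)
        = Assoc M A B (C \<otimes> D) \<cdot> Assoc M (A \<otimes> B) C D"
    and triangle: "A \<in> Obj M \<Longrightarrow> B \<in> Obj M \<Longrightarrow>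
      (Ide M A \<boxtimes> LUnit M B) \<cdot> Assoc M A \<one> B = RUnit M A \<boxtimes> Ide M B"

locale coabelian_monoidal_category = abelian_category M + monoidal_category M
  for M :: "('o, 'm, 'z) monoidal_scheme" (structure) +
  assumes tensor_left_additive: "X \<in> Obj M \<Longrightarrow> additive_map M (\<lambda>f. Ide M X \<boxtimes> f)"
    and tensor_right_additive: "X \<in> Obj M \<Longrightarrow> additive_map M (\<lambda>f. f \<boxtimes> Ide M X)"
    and tensor_left_exact: "X \<in> Obj M \<Longrightarrow> left_exact_map M (\<lambda>f. Ide M X \<boxtimes> f)"
    and tensor_right_exact: "X \<in> Obj M \<Longrightarrow> left_exact_map M (\<lambda>f. f \<boxtimes> Ide M X)"

definition tensor_commutes_with_sums :: "'u itself \<Rightarrow> ('o, 'm, 'z) monoidal_scheme \<Rightarrow> bool" where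
  "tensor_commutes_with_sums (U :: 'u itself) M \<longleftrightarrow>
     (\<forall>(I :: 'u set) X S. \<forall>Y \<in> Obj M. is_coproduct M I X S \<longrightarrow>
        is_coproduct M I (\<lambda>i. Y \<otimes> X i) (Y \<otimes> fst S, \<lambda>i. Ide M Y \<boxtimes> snd S i) \<and>
        is_coproduct M I (\<lambda>i. X i \<otimes> Y) (fst S \<otimes> Y, \<lambda>i. snd S i \<boxtimes> Ide M Y))"
  for M (structure)

section \<open>Coalgebras and graded coalgebras\<close>

record ('o, 'm) coalgebra =
  Car :: 'o
  Comult :: 'm
  Counit :: 'm

definition is_coalgebra ::
  "('o, 'm, 'z) monoidal_scheme \<Rightarrow> ('o, 'm, 'y) coalgebra_scheme \<Rightarrow> bool" where
  "is_coalgebra M C \<longleftrightarrow>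
     Car C \<in> Obj M \<and> Comult C \<in> hom M (Car C) (Car C \<otimes> Car C) \<and> Counit C \<in> hom M (Car C) \<one> \<and>
     Assoc M (Car C) (Car C) (Car C) \<cdot> (Comult C \<boxtimes> Ide M (Car C)) \<cdot> Comult C
       = (Ide M (Car C) \<boxtimes> Comult C) \<cdot> Comult C \<and>
     LUnit M (Car C) \<cdot> (Counit C \<boxtimes> Ide M (Car C)) \<cdot> Comult C = Ide M (Car C) \<and>
     RUnit M (Car C) \<cdot> (Ide M (Car C) \<boxtimes> Counit C) \<cdot> Comult C = Ide M (Car C)"
  for M (structure)

definition coalgebra_hom ::
  "('o, 'm, 'z) monoidal_scheme \<Rightarrow> ('o, 'm, 'x) coalgebra_scheme \<Rightarrow> ('o, 'm, 'y) coalgebra_scheme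
   \<Rightarrow> 'm \<Rightarrow> bool" where
  "coalgebra_hom M C D f \<longleftrightarrow> f \<in> hom M (Car C) (Car D) \<and>
     Comult D \<cdot> f = (f \<boxtimes> f) \<cdot> Comult C \<and> Counit D \<cdot> f = Counit C"
  for M (structure)

record ('o, 'm) graded_object =
  Tot :: 'o
  Deg :: "nat \<Rightarrow> 'o"
  Inj :: "nat \<Rightarrow> 'm"

definition is_graded_object ::
  "('o, 'm, 'z) category_scheme \<Rightarrow> ('o, 'm, 'y) graded_object_scheme \<Rightarrow> bool" where
  "is_graded_object M X \<longleftrightarrow> (\<forall>n. Deg X n \<in> Obj M) \<and> is_coproduct M UNIV (Deg X) (Tot X, Inj X)"

definition coproduct_proj ::
  "('o, 'm, 'z) preadditive_scheme \<Rightarrow> 'i set \<Rightarrow> ('i \<Rightarrow> 'o) \<Rightarrow> 'o \<times> ('i \<Rightarrow> 'm) \<Rightarrow> 'i \<Rightarrow> 'm" where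
  "coproduct_proj M I X S i =
     cotuple M I S (X i) (\<lambda>j. if j = i then Ide M (X i) else Zero M (X j) (X i))"

definition Proj ::
  "('o, 'm, 'z) preadditive_scheme \<Rightarrow> ('o, 'm, 'y) graded_object_scheme \<Rightarrow> nat \<Rightarrow> 'm" where
  "Proj M X n = coproduct_proj M UNIV (Deg X) (Tot X, Inj X) n"

text \<open>\<open>initial_inj M X n\<close> is \<open>\<sigma>\<^sub>n : X(n) = X\<^sub>0 \<oplus> \<dots> \<oplus> X\<^bsub>n-1\<^esub> \<rightarrow> X\<close>; its domain \<open>X(0)\<close> is an empty
  coproduct, that is, a zero object.\<close>

definition initial_inj ::
  "('o, 'm, 'z) category_scheme \<Rightarrow> ('o, 'm, 'y) graded_object_scheme \<Rightarrow> nat \<Rightarrow> 'm" where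
  "initial_inj M X n = cotuple M {..<n} (coproduct M {..<n} (Deg X)) (Tot X) (Inj X)"

definition graded_morphism ::
  "('o, 'm, 'z) category_scheme \<Rightarrow> ('o, 'm, 'x) graded_object_scheme \<Rightarrow>
   ('o, 'm, 'y) graded_object_scheme \<Rightarrow> 'm \<Rightarrow> bool" where
  "graded_morphism M X Y f \<longleftrightarrow> f \<in> hom M (Tot X) (Tot Y) \<and>
     (\<exists>g. \<forall>n. g n \<in> hom M (Deg X n) (Deg Y n) \<and> f \<cdot> Inj X n = Inj Y n \<cdot> g n)"
  for M (structure)

definition graded_part ::
  "('o, 'm, 'z) category_scheme \<Rightarrow> ('o, 'm, 'x) graded_object_scheme \<Rightarrow>
   ('o, 'm, 'y) graded_object_scheme \<Rightarrow> 'm \<Rightarrow> nat \<Rightarrow> 'm" where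
  "graded_part M X Y f n =
     (THE g. g \<in> hom M (Deg X n) (Deg Y n) \<and> f \<cdot> Inj X n = Inj Y n \<cdot> g)"
  for M (structure)

definition tensor_summands ::
  "('o, 'm, 'z) monoidal_scheme \<Rightarrow> ('o, 'm, 'x) graded_object_scheme \<Rightarrow>
   ('o, 'm, 'y) graded_object_scheme \<Rightarrow> nat \<times> nat \<Rightarrow> 'o" where
  "tensor_summands M X Y = (\<lambda>(a, b). Deg X a \<otimes> Deg Y b)"
  for M (structure)

definition graded_tensor ::
  "('o, 'm, 'z) monoidal_scheme \<Rightarrow> ('o, 'm, 'x) graded_object_scheme \<Rightarrow>
   ('o, 'm, 'y) graded_object_scheme \<Rightarrow> ('o, 'm) graded_object" where
  "graded_tensor M X Y =
     \<lparr>Tot = Tot X \<otimes> Tot Y,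
      Deg = (\<lambda>n. fst (coproduct M {(a, b). a + b = n} (tensor_summands M X Y))),
      Inj = (\<lambda>n. cotuple M {(a, b). a + b = n}
               (coproduct M {(a, b). a + b = n} (tensor_summands M X Y))
               (Tot X \<otimes> Tot Y) (\<lambda>(a, b). Inj X a \<boxtimes> Inj Y b))\<rparr>"
  for M (structure)

record ('o, 'm) graded_coalgebra = "('o, 'm) coalgebra" +
  Piece :: "nat \<Rightarrow> 'o"
  Incl :: "nat \<Rightarrow> 'm"

definition gobj :: "('o, 'm, 'y) graded_coalgebra_scheme \<Rightarrow> ('o, 'm) graded_object" where
  "gobj C = \<lparr>Tot = Car C, Deg = Piece C, Inj = Incl C\<rparr>"

definition is_graded_coalgebra ::
  "('o, 'm, 'z) monoidal_scheme \<Rightarrow> ('o, 'm, 'y) graded_coalgebra_scheme \<Rightarrow> bool" where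
  "is_graded_coalgebra M C \<longleftrightarrow> is_coalgebra M C \<and> is_graded_object M (gobj C) \<and>
     graded_morphism M (gobj C) (graded_tensor M (gobj C) (gobj C)) (Comult C)"

definition graded_coalgebra_hom ::
  "('o, 'm, 'z) monoidal_scheme \<Rightarrow> ('o, 'm, 'x) graded_coalgebra_scheme \<Rightarrow>
   ('o, 'm, 'y) graded_coalgebra_scheme \<Rightarrow> 'm \<Rightarrow> bool" where
  "graded_coalgebra_hom M C D f \<longleftrightarrow> coalgebra_hom M C D f \<and> graded_morphism M (gobj C) (gobj D) f"

text \<open>\<open>comult_part M C a b\<close> is \<open>\<Delta>\<^bsub>a,b\<^esub> : C\<^bsub>a+b\<^esub> \<rightarrow> C\<^sub>a \<otimes> C\<^sub>b\<close>.\<close>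

definition comult_part ::
  "('o, 'm, 'z) monoidal_scheme \<Rightarrow> ('o, 'm, 'y) graded_coalgebra_scheme \<Rightarrow> nat \<Rightarrow> nat \<Rightarrow> 'm" where
  "comult_part M C a b =
     (let I = {(a', b'). a' + b' = a + b}; X = tensor_summands M (gobj C) (gobj C)
      in coproduct_proj M I X (coproduct M I X) (a, b)
         \<cdot> graded_part M (gobj C) (graded_tensor M (gobj C) (gobj C)) (Comult C) (a + b))"
  for M (structure)

definition strongly_graded ::
  "('o, 'm, 'z) monoidal_scheme \<Rightarrow> ('o, 'm, 'y) graded_coalgebra_scheme \<Rightarrow> bool" where
  "strongly_graded M C \<longleftrightarrow> (\<forall>i j. monomorphism M (comult_part M C i j))"

definition zero_part ::
  "('o, 'm, 'z) monoidal_scheme \<Rightarrow> ('o, 'm, 'y) graded_coalgebra_scheme \<Rightarrow> ('o, 'm) coalgebra" where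
  "zero_part M C =
     \<lparr>Car = Piece C 0, Comult = comult_part M C 0 0, Counit = Counit C \<cdot> Incl C 0\<rparr>"
  for M (structure)

section \<open>The wedge product\<close>

text \<open>Tensor powers are bracketed to the left: \<open>X\<^bsup>\<otimes>(n+2)\<^esup> = X\<^bsup>\<otimes>(n+1)\<^esup> \<otimes> X\<close> and \<open>X\<^bsup>\<otimes>1\<^esup> = X\<close>.\<close>

fun tensor_pow_arr :: "('o, 'm, 'z) monoidal_scheme \<Rightarrow> 'm \<Rightarrow> nat \<Rightarrow> 'm" where
  "tensor_pow_arr M f 0 = Ide M \<one>\<^bsub>M\<^esub>"
| "tensor_pow_arr M f (Suc 0) = f"
| "tensor_pow_arr M f (Suc (Suc n)) = tensor_pow_arr M f (Suc n) \<boxtimes>\<^bsub>M\<^esub> f"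

text \<open>\<open>iterated_comult M C n : C \<rightarrow> C\<^bsup>\<otimes>(n+1)\<^esup>\<close>\<close>

fun iterated_comult ::
  "('o, 'm, 'z) monoidal_scheme \<Rightarrow> ('o, 'm, 'y) coalgebra_scheme \<Rightarrow> nat \<Rightarrow> 'm" where
  "iterated_comult M C 0 = Ide M (Car C)"
| "iterated_comult M C (Suc n) = (iterated_comult M C n \<boxtimes>\<^bsub>M\<^esub> Ide M (Car C)) \<cdot>\<^bsub>M\<^esub> Comult C"

text \<open>The wedge power of the subobject \<open>\<delta> : D \<rightarrow> C\<close>, represented by a monomorphism into \<open>C\<close>.\<close>

definition wedge ::
  "('o, 'm, 'z) monoidal_scheme \<Rightarrow> ('o, 'm, 'y) coalgebra_scheme \<Rightarrow> 'm \<Rightarrow> nat \<Rightarrow> 'm" where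
  "wedge M C \<delta> n =
     (if n = 0 then Zero M (zero_object M) (Car C)
      else let p = (SOME p. is_cokernel M p \<delta>)
           in SOME k. is_kernel M k (tensor_pow_arr M p n \<cdot> iterated_comult M C (n - 1)))"
  for M (structure)

section \<open>The cotensor product\<close>

text \<open>\<open>LCo V : V \<rightarrow> D \<otimes> V\<close> and \<open>RCo V : V \<rightarrow> V \<otimes> D\<close> are the coactions of a \<open>D\<close>-bicomodule \<open>V\<close>.\<close>

record ('o, 'm) bicomodule =
  BCar :: 'o
  LCo :: 'm
  RCo :: 'm

definition regular_bicomodule :: "('o, 'm, 'y) coalgebra_scheme \<Rightarrow> ('o, 'm) bicomodule" where
  "regular_bicomodule D = \<lparr>BCar = Car D, LCo = Comult D, RCo = Comult D\<rparr>"

text \<open>A coalgebra \<open>C\<close> as a bicomodule along a coalgebra homomorphism \<open>p : C \<rightarrow> D\<close>.\<close>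

definition induced_bicomodule ::
  "('o, 'm, 'z) monoidal_scheme \<Rightarrow> ('o, 'm, 'y) coalgebra_scheme \<Rightarrow> 'm \<Rightarrow> ('o, 'm) bicomodule" where
  "induced_bicomodule M C p =
     \<lparr>BCar = Car C, LCo = (p \<boxtimes> Ide M (Car C)) \<cdot> Comult C, RCo = (Ide M (Car C) \<boxtimes> p) \<cdot> Comult C\<rparr>"
  for M (structure)

definition degree_part_bicomodule ::
  "('o, 'm, 'z) monoidal_scheme \<Rightarrow> ('o, 'm, 'y) graded_coalgebra_scheme \<Rightarrow> nat
   \<Rightarrow> ('o, 'm) bicomodule" where
  "degree_part_bicomodule M C n =
     \<lparr>BCar = Piece C n, LCo = comult_part M C 0 n, RCo = comult_part M C n 0\<rparr>"

text \<open>The inclusion \<open>V \<box>\<^sub>D W \<rightarrow> V \<otimes> W\<close>.\<close>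

definition cotensor_incl ::
  "('o, 'm, 'z) monoidal_scheme \<Rightarrow> ('o, 'm, 'y) coalgebra_scheme \<Rightarrow>
   ('o, 'm) bicomodule \<Rightarrow> ('o, 'm) bicomodule \<Rightarrow> 'm" where
  "cotensor_incl M D V W =
     (SOME e. is_equalizer M e
        (Assoc M (BCar V) (Car D) (BCar W) \<cdot> (RCo V \<boxtimes> Ide M (BCar W)))
        (Ide M (BCar V) \<boxtimes> LCo W))"
  for M (structure)

definition cotensor ::
  "('o, 'm, 'z) monoidal_scheme \<Rightarrow> ('o, 'm, 'y) coalgebra_scheme \<Rightarrow>
   ('o, 'm) bicomodule \<Rightarrow> ('o, 'm) bicomodule \<Rightarrow> ('o, 'm) bicomodule" where
  "cotensor M D V W =
     (let e = cotensor_incl M D V W; E = Dom M e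
      in \<lparr>BCar = E,
          LCo = (THE l. l \<in> hom M E (Car D \<otimes> E) \<and>
            (Ide M (Car D) \<boxtimes> e) \<cdot> l
              = Assoc M (Car D) (BCar V) (BCar W) \<cdot> (LCo V \<boxtimes> Ide M (BCar W)) \<cdot> e),
          RCo = (THE r. r \<in> hom M E (E \<otimes> Car D) \<and>
            Assoc M (BCar V) (BCar W) (Car D) \<cdot> (e \<boxtimes> Ide M (Car D)) \<cdot> r
              = (Ide M (BCar V) \<boxtimes> RCo W) \<cdot> e)\<rparr>)"
  for M (structure)

text \<open>The factorization through \<open>V \<box>\<^sub>D W\<close> of a morphism \<open>f\<close> into \<open>V \<otimes> W\<close>.\<close>

definition cotensor_lift ::
  "('o, 'm, 'z) monoidal_scheme \<Rightarrow> ('o, 'm, 'y) coalgebra_scheme \<Rightarrow>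
   ('o, 'm) bicomodule \<Rightarrow> ('o, 'm) bicomodule \<Rightarrow> 'm \<Rightarrow> 'm" where
  "cotensor_lift M D V W f =
     (THE h. h \<in> hom M (Dom M f) (BCar (cotensor M D V W)) \<and> cotensor_incl M D V W \<cdot> h = f)"
  for M (structure)

text \<open>\<open>f \<box>\<^sub>D g : V \<box>\<^sub>D W \<rightarrow> V' \<box>\<^sub>D W'\<close>\<close>

definition cotensor_arr ::
  "('o, 'm, 'z) monoidal_scheme \<Rightarrow> ('o, 'm, 'y) coalgebra_scheme \<Rightarrow>
   ('o, 'm) bicomodule \<Rightarrow> ('o, 'm) bicomodule \<Rightarrow> ('o, 'm) bicomodule \<Rightarrow> ('o, 'm) bicomodule \<Rightarrow>
   'm \<Rightarrow> 'm \<Rightarrow> 'm" where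
  "cotensor_arr M D V W V' W' f g =
     cotensor_lift M D V' W' ((f \<boxtimes> g) \<cdot> cotensor_incl M D V W)"
  for M (structure)

text \<open>\<open>(V \<box>\<^sub>D W) \<box>\<^sub>D U \<rightarrow> V \<box>\<^sub>D (W \<box>\<^sub>D U)\<close>, the associativity constraint of \<open>\<box>\<^sub>D\<close>.\<close>

definition cotensor_assoc ::
  "('o, 'm, 'z) monoidal_scheme \<Rightarrow> ('o, 'm, 'y) coalgebra_scheme \<Rightarrow>
   ('o, 'm) bicomodule \<Rightarrow> ('o, 'm) bicomodule \<Rightarrow> ('o, 'm) bicomodule \<Rightarrow> 'm" where
  "cotensor_assoc M D V W U =
     (THE a. a \<in> hom M (BCar (cotensor M D (cotensor M D V W) U))
                       (BCar (cotensor M D V (cotensor M D W U))) \<and>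
        (Ide M (BCar V) \<boxtimes> cotensor_incl M D W U) \<cdot> cotensor_incl M D V (cotensor M D W U) \<cdot> a
        = Assoc M (BCar V) (BCar W) (BCar U)
            \<cdot> (cotensor_incl M D V W \<boxtimes> Ide M (BCar U)) \<cdot> cotensor_incl M D (cotensor M D V W) U)"
  for M (structure)

text \<open>Cotensor powers are bracketed to the left, with \<open>V\<^bsup>\<box>0\<^esup> = D\<close> and \<open>V\<^bsup>\<box>1\<^esup> = V\<close>.\<close>

fun cotensor_pow ::
  "('o, 'm, 'z) monoidal_scheme \<Rightarrow> ('o, 'm, 'y) coalgebra_scheme \<Rightarrow>
   ('o, 'm) bicomodule \<Rightarrow> nat \<Rightarrow> ('o, 'm) bicomodule" where
  "cotensor_pow M D V 0 = regular_bicomodule D"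
| "cotensor_pow M D V (Suc 0) = V"
| "cotensor_pow M D V (Suc (Suc n)) = cotensor M D (cotensor_pow M D V (Suc n)) V"

fun cotensor_pow_arr ::
  "('o, 'm, 'z) monoidal_scheme \<Rightarrow> ('o, 'm, 'y) coalgebra_scheme \<Rightarrow>
   ('o, 'm) bicomodule \<Rightarrow> ('o, 'm) bicomodule \<Rightarrow> 'm \<Rightarrow> nat \<Rightarrow> 'm" where
  "cotensor_pow_arr M D V W f 0 = Ide M (Car D)"
| "cotensor_pow_arr M D V W f (Suc 0) = f"
| "cotensor_pow_arr M D V W f (Suc (Suc n)) =
     cotensor_arr M D (cotensor_pow M D V (Suc n)) V (cotensor_pow M D W (Suc n)) W
       (cotensor_pow_arr M D V W f (Suc n)) f"

text \<open>The canonical isomorphism \<open>V\<^bsup>\<box>(m+n)\<^esup> \<rightarrow> V\<^bsup>\<box>m\<^esup> \<box>\<^sub>D V\<^bsup>\<box>n\<^esup>\<close> of the monoidal structure \<open>\<box>\<^sub>D\<close>. The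
  inverse unit constraints \<open>W \<rightarrow> D \<box>\<^sub>D W\<close> and \<open>W \<rightarrow> W \<box>\<^sub>D D\<close> are the corestricted coactions of \<open>W\<close>.\<close>

fun cotensor_pow_split ::
  "('o, 'm, 'z) monoidal_scheme \<Rightarrow> ('o, 'm, 'y) coalgebra_scheme \<Rightarrow>
   ('o, 'm) bicomodule \<Rightarrow> nat \<Rightarrow> nat \<Rightarrow> 'm" where
  "cotensor_pow_split M D V 0 n =
     cotensor_lift M D (regular_bicomodule D) (cotensor_pow M D V n) (LCo (cotensor_pow M D V n))"
| "cotensor_pow_split M D V (Suc m) 0 =
     cotensor_lift M D (cotensor_pow M D V (Suc m)) (regular_bicomodule D)
       (RCo (cotensor_pow M D V (Suc m)))"
| "cotensor_pow_split M D V (Suc m) (Suc 0) = Ide M (BCar (cotensor_pow M D V (Suc (Suc m))))"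
| "cotensor_pow_split M D V (Suc m) (Suc (Suc n)) =
     cotensor_assoc M D (cotensor_pow M D V (Suc m)) (cotensor_pow M D V (Suc n)) V
     \<cdot>\<^bsub>M\<^esub> cotensor_arr M D
          (cotensor_pow M D V (Suc m + Suc n)) V
          (cotensor M D (cotensor_pow M D V (Suc m)) (cotensor_pow M D V (Suc n))) V
          (cotensor_pow_split M D V (Suc m) (Suc n)) (Ide M (BCar V))"

definition cotensor_comult_part ::
  "('o, 'm, 'z) monoidal_scheme \<Rightarrow> ('o, 'm, 'y) coalgebra_scheme \<Rightarrow>
   ('o, 'm) bicomodule \<Rightarrow> nat \<Rightarrow> nat \<Rightarrow> 'm" where
  "cotensor_comult_part M D V m n =
     cotensor_incl M D (cotensor_pow M D V m) (cotensor_pow M D V n) \<cdot> cotensor_pow_split M D V m n"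
  for M (structure)

definition cotensor_coalgebra ::
  "('o, 'm, 'z) monoidal_scheme \<Rightarrow> ('o, 'm, 'y) coalgebra_scheme \<Rightarrow>
   ('o, 'm) bicomodule \<Rightarrow> ('o, 'm) graded_coalgebra" where
  "cotensor_coalgebra M D V =
     (let X = (\<lambda>n. BCar (cotensor_pow M D V n));
          S = coproduct M (UNIV :: nat set) X;
          i = snd S
      in \<lparr>Car = fst S,
          Comult = cotuple M UNIV S (fst S \<otimes> fst S)
            (\<lambda>n. sum_upto M (\<lambda>a. (i a \<boxtimes> i (n - a)) \<cdot> cotensor_comult_part M D V a (n - a)) n),
          Counit = Counit D \<cdot> coproduct_proj M UNIV X S 0,
          Piece = X,
          Incl = i\<rparr>)"
  for M (structure)

text \<open>\<open>cotensor_iterated_comult M C D p m : C \<rightarrow> C\<^bsup>\<box>m\<^esup>\<close> is the iterated comultiplication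
  (\<open>m - 1\<close> fold; for \<open>m = 0\<close> the counit \<open>p\<close>) of \<open>C\<close> as a coalgebra in the category of \<open>D\<close>-bicomodules, along
  \<open>p : C \<rightarrow> D\<close>.\<close>

fun cotensor_iterated_comult ::
  "('o, 'm, 'z) monoidal_scheme \<Rightarrow> ('o, 'm, 'x) coalgebra_scheme \<Rightarrow> ('o, 'm, 'y) coalgebra_scheme \<Rightarrow>
   'm \<Rightarrow> nat \<Rightarrow> 'm" where
  "cotensor_iterated_comult M C D p 0 = p"
| "cotensor_iterated_comult M C D p (Suc 0) = Ide M (Car C)"
| "cotensor_iterated_comult M C D p (Suc (Suc n)) =
     (let B = induced_bicomodule M C p
      in cotensor_arr M D B B (cotensor_pow M D B (Suc n)) B
           (cotensor_iterated_comult M C D p (Suc n)) (Ide M (Car C))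
         \<cdot>\<^bsub>M\<^esub> cotensor_lift M D B B (Comult C))"

section \<open>The cotensor coalgebra of a graded coalgebra\<close>

abbreviation proj ::
  "('o, 'm, 'z) monoidal_scheme \<Rightarrow> ('o, 'm, 'y) graded_coalgebra_scheme \<Rightarrow> nat \<Rightarrow> 'm" where
  "proj M C n \<equiv> Proj M (gobj C) n"

definition Tc ::
  "('o, 'm, 'z) monoidal_scheme \<Rightarrow> ('o, 'm, 'y) graded_coalgebra_scheme \<Rightarrow>
   ('o, 'm) graded_coalgebra" where
  "Tc M C = cotensor_coalgebra M (zero_part M C) (degree_part_bicomodule M C 1)"

end

theory Submission
  imports Defs "HOL-Library.Nat_Bijection"
begin

text \<open>The \<open>m\<close>-th component \<open>\<psi>\<^sub>m\<close> is the map \<open>C\<^sub>m \<rightarrow> C\<^sub>1\<^bsup>\<box>m\<^esup>\<close> with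
  \<open>inc \<cdot> \<psi>\<^bsub>m+1\<^esub> = (\<psi>\<^sub>m \<boxtimes> id) \<cdot> \<Delta>\<^bsub>m,1\<^esub>\<close>, and coassociativity gives
  \<open>\<Delta>\<^sup>T\<^bsub>a,b\<^esub> \<cdot> \<psi>\<^bsub>a+b\<^esub> = (\<psi>\<^sub>a \<boxtimes> \<psi>\<^sub>b) \<cdot> \<Delta>\<^bsub>a,b\<^esub>\<close> by induction on \<open>b\<close>; here \<open>\<Delta>\<^sup>T\<^bsub>a,b\<^esub>\<close> is
  monic for \<open>a, b \<ge> 1\<close>. The same recursion determines all projections of a coalgebra homomorphism
  into the cotensor coalgebra, and by AB5 the projections of a countable direct sum are jointly monic.
  So \<open>\<psi>\<close> is unique, and monic iff all \<open>\<psi>\<^sub>m\<close> are, iff all \<open>\<Delta>\<^bsub>a,1\<^esub>\<close> are, iff all \<open>\<Delta>\<^bsub>a,b\<^esub>\<close> are.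
  For the wedge powers, \<open>p\<^bsup>\<otimes>n\<^esup> \<cdot> \<Delta>\<^bsup>n-1\<^esup>\<close> kills \<open>C(n)\<close> and recovers \<open>e \<cdot> p\<^sub>m\<close> for \<open>m \<ge> n\<close>, where \<open>e\<close>
  is an iterate of the \<open>\<Delta>\<^bsub>a,1\<^esub>\<close>. Conversely, if \<open>C(2) = C\<^sub>0 \<and> C\<^sub>0\<close> and \<open>\<Delta>\<^bsub>j,1\<^esub>\<close> is monic for \<open>j < a\<close>,
  then \<open>\<Delta>\<^bsub>a,1\<^esub> \<cdot> g = 0\<close> forces \<open>\<Delta>\<^bsub>i,j\<^esub> \<cdot> g = 0\<close> for all \<open>i, j \<ge> 1\<close> with \<open>i + j = a + 1\<close>, so \<open>g\<close> lands
  in \<open>C(2)\<close> and vanishes.\<close>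

text \<open>Cotensor products and their structure maps are given only by descriptions
  (\<open>SOME\<close>, \<open>THE\<close>), so each is accessible only through its image under an
  inclusion \<open>inc\<close> into a tensor product. This is where coabelian enters: tensoring
  keeps \<open>inc\<close> an equalizer. Maps into iterated cotensor products thus exist by
  factoring, and are compared after a monic composite of whiskered inclusions and associators, where
  coassociativity, interchange and the pentagon decide. The closed formula for \<psi> and its
  recursion meet in \<open>\<phi> n\<close>, the iterated comultiplication over C_0 followed by the
  cotensor power of p_1, defined on all of C; its restriction to degree n satisfies the recursion.
  The pairs with a = 0 or b = 0 escape the comparison with the cotensor coalgebra; there the counit
  splits \<Delta>_{a,b}. In the wedge part everything rests on one factorization: p_m with m \<ge> 1
  kills C_0, hence factors through the cokernel p. AB5 is called for because a morphism into an
  infinite direct sum is not determined by its projections on formal grounds alone.\<close>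

declare cotensor_pow.simps(3) [simp del]

section \<open>Additive and abelian categories\<close>

context category begin

lemma hom_iff: "f \<in> hom M A B \<longleftrightarrow> f \<in> Arr M \<and> Dom M f = A \<and> Cod M f = B"
  by (simp add: hom_def)

lemma hom_Arr: "f \<in> hom M A B \<Longrightarrow> f \<in> Arr M"
  and hom_Dom: "f \<in> hom M A B \<Longrightarrow> Dom M f = A"
  and hom_Cod: "f \<in> hom M A B \<Longrightarrow> Cod M f = B"
  by (simp_all add: hom_def)

lemma hom_Obj: "f \<in> hom M A B \<Longrightarrow> A \<in> Obj M" "f \<in> hom M A B \<Longrightarrow> B \<in> Obj M"
  using Dom_in Cod_in by (auto simp: hom_def)

declare Dom_in [simp] Cod_in [simp]

lemma Comp_simps [simp]:
  assumes "f \<in> Arr M" "g \<in> Arr M" "Dom M g = Cod M f"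
  shows "g \<cdot> f \<in> Arr M" "Dom M (g \<cdot> f) = Dom M f" "Cod M (g \<cdot> f) = Cod M g"
  using Comp_in [of f "Dom M f" "Cod M f" g "Cod M g"] assms by (auto simp: hom_def)

lemma Ide_simps [simp]:
  assumes "A \<in> Obj M"
  shows "Ide M A \<in> Arr M" "Dom M (Ide M A) = A" "Cod M (Ide M A) = A"
  using Ide_in [OF assms] by (auto simp: hom_def)

text \<open>Composites are normalized by nesting to the right. The typing conditions are phrased
  with \<open>Dom\<close> and \<open>Cod\<close>, so that the simplifier can discharge them by
  computation.\<close>

lemma Comp_Comp [simp]:
  assumes "f \<in> Arr M" "g \<in> Arr M" "h \<in> Arr M" "Dom M g = Cod M f" "Dom M h = Cod M g"
  shows "(h \<cdot> g) \<cdot> f = h \<cdot> g \<cdot> f"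
  using Comp_assoc [of f "Dom M f" "Cod M f" g "Cod M g" h "Cod M h"] assms by (auto simp: hom_def)

lemma Comp_Ide_simps [simp]:
  assumes "f \<in> Arr M"
  shows "Dom M f = A \<Longrightarrow> f \<cdot> Ide M A = f" "Cod M f = A \<Longrightarrow> Ide M A \<cdot> f = f"
  using Comp_Ide [of f] Ide_Comp [of f] assms by (auto simp: hom_def)

text \<open>In a right-nested chain the pair \<open>h \<cdot> g\<close> no longer occurs as a
  subterm; this extends an equation for the pair by an arbitrary tail.\<close>

lemma Comp_tail:
  assumes "h \<cdot> g = k" "f \<in> Arr M" "g \<in> Arr M" "h \<in> Arr M" "Dom M g = Cod M f" "Dom M h = Cod M g"
  shows "h \<cdot> g \<cdot> f = k \<cdot> f"
  using assms Comp_Comp by metis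

lemma monomorphismI:
  assumes "f \<in> hom M A B"
    and "\<And>X g h. g \<in> hom M X A \<Longrightarrow> h \<in> hom M X A \<Longrightarrow> f \<cdot> g = f \<cdot> h \<Longrightarrow> g = h"
  shows "monomorphism M f"
  using assms unfolding monomorphism_def by (auto simp: hom_def)

lemma monomorphismD:
  assumes "monomorphism M f" "f \<cdot> g = f \<cdot> h" "g \<in> hom M X (Dom M f)" "h \<in> hom M X (Dom M f)"
  shows "g = h"
  using assms unfolding monomorphism_def by blast

lemma monomorphism_Arr: "monomorphism M f \<Longrightarrow> f \<in> Arr M"
  by (simp add: monomorphism_def)

lemma monomorphism_Comp:
  assumes "monomorphism M f" "monomorphism M g" "Dom M g = Cod M f"
  shows "monomorphism M (g \<cdot> f)"
proof (rule monomorphismI)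
  have a: "f \<in> Arr M" "g \<in> Arr M"
    using assms monomorphism_Arr by auto
  show "g \<cdot> f \<in> hom M (Dom M f) (Cod M g)"
    using a assms by (simp add: hom_iff)
  fix X u v assume u: "u \<in> hom M X (Dom M f)" "v \<in> hom M X (Dom M f)" "(g \<cdot> f) \<cdot> u = (g \<cdot> f) \<cdot> v"
  then have "g \<cdot> f \<cdot> u = g \<cdot> f \<cdot> v"
    using a assms by (simp add: hom_iff)
  then have "f \<cdot> u = f \<cdot> v"
    by (rule monomorphismD [OF assms(2), where X = X]) (use a u assms in \<open>auto simp: hom_iff\<close>)
  then show "u = v"
    using monomorphismD [OF assms(1)] u by blast
qed

lemma monomorphism_cancel:
  assumes "monomorphism M (g \<cdot> f)" "f \<in> Arr M" "g \<in> Arr M" "Dom M g = Cod M f"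
  shows "monomorphism M f"
proof (rule monomorphismI)
  show "f \<in> hom M (Dom M f) (Cod M f)"
    using assms by (simp add: hom_iff)
  fix X u v assume u: "u \<in> hom M X (Dom M f)" "v \<in> hom M X (Dom M f)" "f \<cdot> u = f \<cdot> v"
  then have "(g \<cdot> f) \<cdot> u = (g \<cdot> f) \<cdot> v"
    using assms by (simp add: hom_iff)
  with assms u show "u = v"
    by (intro monomorphismD [OF assms(1), of u v X]) auto
qed

lemma monomorphism_Ide: "A \<in> Obj M \<Longrightarrow> monomorphism M (Ide M A)"
  by (rule monomorphismI [where A = A and B = A]) (auto simp: hom_iff)

lemma split_monomorphism:
  assumes "r \<cdot> f = Ide M (Dom M f)" "f \<in> Arr M" "r \<in> Arr M" "Dom M r = Cod M f"
  shows "monomorphism M f"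
  by (rule monomorphism_cancel [of r]) (use assms in \<open>auto simp: monomorphism_Ide\<close>)

lemma isomorphismE:
  assumes "isomorphism M f"
  obtains g where "g \<in> hom M (Cod M f) (Dom M f)" "g \<cdot> f = Ide M (Dom M f)" "f \<cdot> g = Ide M (Cod M f)"
    "f \<in> Arr M"
  using assms unfolding isomorphism_def by auto

lemma isomorphism_monomorphism: "isomorphism M f \<Longrightarrow> monomorphism M f"
  by (metis isomorphismE split_monomorphism hom_iff)

lemma is_equalizer_monomorphism:
  assumes "is_equalizer M e f g"
  shows "monomorphism M e"
proof (rule monomorphismI)
  show e: "e \<in> hom M (Dom M e) (Cod M e)"
    using assms by (auto simp: is_equalizer_def hom_iff)
  fix X u v assume u: "u \<in> hom M X (Dom M e)" "v \<in> hom M X (Dom M e)" "e \<cdot> u = e \<cdot> v"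
  have fe: "f \<in> hom M (Cod M e) (Cod M g)" "g \<in> hom M (Cod M e) (Cod M g)" "f \<cdot> e = g \<cdot> e"
    using assms by (auto simp: is_equalizer_def)
  have "f \<cdot> e \<cdot> u = (f \<cdot> e) \<cdot> u"
    using fe(1) u e by (simp add: hom_iff)
  also have "\<dots> = g \<cdot> e \<cdot> u"
    using fe u e by (simp add: hom_iff)
  finally have "f \<cdot> e \<cdot> u = g \<cdot> e \<cdot> u" .
  moreover have "e \<cdot> u \<in> hom M X (Cod M e)"
    using u e Comp_in by blast
  ultimately show "u = v"
    using assms u unfolding is_equalizer_def by metis
qed

lemma is_equalizer_factor:
  assumes "is_equalizer M e f g" "h \<in> hom M X (Cod M e)" "f \<cdot> h = g \<cdot> h"
  obtains u where "u \<in> hom M X (Dom M e)" "e \<cdot> u = h"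
  using assms unfolding is_equalizer_def by blast

lemma cotuple:
  assumes "is_coproduct M I X S" "Y \<in> Obj M" "\<And>i. i \<in> I \<Longrightarrow> f i \<in> hom M (X i) Y"
  shows cotuple_in: "cotuple M I S Y f \<in> hom M (fst S) Y"
    and cotuple_Comp: "i \<in> I \<Longrightarrow> cotuple M I S Y f \<cdot> snd S i = f i"
proof -
  have "\<exists>!h. h \<in> hom M (fst S) Y \<and> (\<forall>i \<in> I. h \<cdot> snd S i = f i)"
    using assms unfolding is_coproduct_def by blast
  from theI' [OF this] show "cotuple M I S Y f \<in> hom M (fst S) Y"
    "i \<in> I \<Longrightarrow> cotuple M I S Y f \<cdot> snd S i = f i"
    by (auto simp: cotuple_def)
qed

lemma coproduct_ext:
  assumes "is_coproduct M I X S" "g \<in> hom M (fst S) Y" "h \<in> hom M (fst S) Y"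
    and "\<And>i. i \<in> I \<Longrightarrow> g \<cdot> snd S i = h \<cdot> snd S i"
  shows "g = h"
proof -
  have Y: "Y \<in> Obj M"
    using assms hom_Obj by blast
  have *: "\<forall>i \<in> I. g \<cdot> snd S i \<in> hom M (X i) Y"
    using assms Comp_in unfolding is_coproduct_def by blast
  have "\<exists>!k. k \<in> hom M (fst S) Y \<and> (\<forall>i \<in> I. k \<cdot> snd S i = g \<cdot> snd S i)"
    using assms(1) Y * unfolding is_coproduct_def by (elim conjE) (rule_tac x = Y in ballE, auto)
  then show ?thesis
    using assms by metis
qed

lemma is_coproduct_in: "is_coproduct M I X S \<Longrightarrow> i \<in> I \<Longrightarrow> snd S i \<in> hom M (X i) (fst S)"
  by (simp add: is_coproduct_def)

end

section \<open>Differences, kernels, cokernels and finite sums\<close>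

context preadditive_category begin

lemma Zero_simps [simp]:
  assumes "A \<in> Obj M" "B \<in> Obj M"
  shows "Zero M A B \<in> Arr M" "Dom M (Zero M A B) = A" "Cod M (Zero M A B) = B"
  using Zero_in [OF assms] by (auto simp: hom_def)

lemma Add_simps [simp]:
  assumes "f \<in> Arr M" "g \<in> Arr M" "Dom M f = Dom M g" "Cod M f = Cod M g"
  shows "f \<oplus> g \<in> Arr M" "Dom M (f \<oplus> g) = Dom M g" "Cod M (f \<oplus> g) = Cod M g"
  using Add_in [of f "Dom M f" "Cod M f" g] assms by (auto simp: hom_def)

lemma Zero_Add: "f \<in> hom M A B \<Longrightarrow> Zero M A B \<oplus> f = f"
  using Add_Zero Add_commute Zero_in hom_Obj by metis

lemma Add_left_cancel:
  assumes "f \<in> hom M A B" "g \<in> hom M A B" "h \<in> hom M A B" "f \<oplus> g = f \<oplus> h"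
  shows "g = h"
proof -
  obtain k where k: "k \<in> hom M A B" "f \<oplus> k = Zero M A B"
    using Add_inverse assms by blast
  have "(k \<oplus> f) \<oplus> g = (k \<oplus> f) \<oplus> h"
    using assms k Add_assoc [of k A B f] by metis
  then show ?thesis
    using k assms Add_commute [of k A B f] Zero_Add by auto
qed

lemma Add_idem_Zero: "f \<in> hom M A B \<Longrightarrow> f \<oplus> f = f \<Longrightarrow> f = Zero M A B"
  using Add_left_cancel [of f A B f "Zero M A B"] Add_Zero Zero_in hom_Obj by metis

lemma Comp_Zero [simp]:
  assumes "h \<in> Arr M" "Dom M h = B" "A \<in> Obj M"
  shows "h \<cdot> Zero M A B = Zero M A (Cod M h)"
proof (rule Add_idem_Zero)
  have B: "B \<in> Obj M"
    using assms by auto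
  have h: "h \<in> hom M B (Cod M h)" "Zero M A B \<in> hom M A B"
    using assms B by (auto simp: hom_iff)
  show "h \<cdot> Zero M A B \<in> hom M A (Cod M h)"
    using h Comp_in by blast
  show "h \<cdot> Zero M A B \<oplus> h \<cdot> Zero M A B = h \<cdot> Zero M A B"
    using Comp_Add [OF h(2) h(2) h(1)] Add_Zero h by simp
qed

lemma Zero_Comp [simp]:
  assumes "h \<in> Arr M" "Cod M h = B" "C \<in> Obj M"
  shows "Zero M B C \<cdot> h = Zero M (Dom M h) C"
proof (rule Add_idem_Zero)
  have B: "B \<in> Obj M"
    using assms by auto
  have h: "h \<in> hom M (Dom M h) B" "Zero M B C \<in> hom M B C"
    using assms B by (auto simp: hom_iff)
  show "Zero M B C \<cdot> h \<in> hom M (Dom M h) C"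
    using h Comp_in by blast
  show "Zero M B C \<cdot> h \<oplus> Zero M B C \<cdot> h = Zero M B C \<cdot> h"
    using Add_Comp [OF h(1) h(2) h(2)] Add_Zero h by simp
qed

text \<open>Given by a description because the structure carries no negation:
  \<open>Add_inverse\<close> only asserts that inverses exist.\<close>

definition
  "Sub f g = (THE h. h \<in> hom M (Dom M f) (Cod M f) \<and> h \<oplus> g = f)"

lemma Sub:
  assumes "f \<in> hom M A B" "g \<in> hom M A B"
  shows Sub_in: "Sub f g \<in> hom M A B" and Sub_Add: "Sub f g \<oplus> g = f"
    and Sub_eqI: "h \<in> hom M A B \<Longrightarrow> h \<oplus> g = f \<Longrightarrow> Sub f g = h"
proof -
  obtain k where k: "k \<in> hom M A B" "g \<oplus> k = Zero M A B"
    using Add_inverse assms by blast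
  have "(f \<oplus> k) \<oplus> g = f"
    using k assms Add_assoc [of f A B k g] Add_commute [of g A B k] Add_Zero by simp
  moreover have "f \<oplus> k \<in> hom M A B"
    using Add_in assms k by blast
  moreover have uniq: "h = h'" if "h \<in> hom M A B" "h' \<in> hom M A B" "h \<oplus> g = h' \<oplus> g" for h h'
    using that assms Add_left_cancel Add_commute by metis
  ultimately have ex: "\<exists>!h. h \<in> hom M (Dom M f) (Cod M f) \<and> h \<oplus> g = f"
    using assms hom_Dom hom_Cod by metis
  show 1: "Sub f g \<in> hom M A B" "Sub f g \<oplus> g = f"
    using theI' [OF ex] assms hom_Dom hom_Cod unfolding Sub_def by metis+
  show "h \<in> hom M A B \<Longrightarrow> h \<oplus> g = f \<Longrightarrow> Sub f g = h"
    using uniq 1 by metis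
qed

lemma Sub_Zero_iff:
  assumes "f \<in> hom M A B" "g \<in> hom M A B"
  shows "Sub f g = Zero M A B \<longleftrightarrow> f = g"
  using Sub [OF assms] Zero_Add assms Zero_in hom_Obj by metis

lemma Comp_Sub:
  assumes "f \<in> hom M A B" "g \<in> hom M A B" "h \<in> hom M B C"
  shows "h \<cdot> Sub f g = Sub (h \<cdot> f) (h \<cdot> g)"
proof (rule sym, rule Sub_eqI)
  show "h \<cdot> Sub f g \<oplus> h \<cdot> g = h \<cdot> f"
    using Comp_Add [OF Sub_in [OF assms(1,2)] assms(2,3)] Sub_Add assms by simp
qed (use assms Sub_in Comp_in in blast)+

lemma Sub_Comp:
  assumes "f \<in> hom M B C" "g \<in> hom M B C" "h \<in> hom M A B"
  shows "Sub f g \<cdot> h = Sub (f \<cdot> h) (g \<cdot> h)"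
proof (rule sym, rule Sub_eqI)
  show "Sub f g \<cdot> h \<oplus> g \<cdot> h = f \<cdot> h"
    using Add_Comp [OF assms(3) Sub_in [OF assms(1,2)] assms(2)] Sub_Add assms by simp
qed (use assms Sub_in Comp_in in blast)+

lemma monomorphism_ZeroI:
  assumes f: "f \<in> hom M A B"
    and "\<And>X g. g \<in> hom M X A \<Longrightarrow> f \<cdot> g = Zero M X B \<Longrightarrow> g = Zero M X A"
  shows "monomorphism M f"
proof (rule monomorphismI [OF f])
  fix X g h assume g: "g \<in> hom M X A" "h \<in> hom M X A" "f \<cdot> g = f \<cdot> h"
  then have "f \<cdot> Sub g h = Zero M X B"
    using Comp_Sub [of g X A h f B] Sub_Zero_iff f Comp_in by metis
  then show "g = h"
    using assms(2) Sub_in Sub_Zero_iff g by blast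
qed

lemma monomorphism_ZeroD:
  assumes "monomorphism M f" "g \<in> hom M X (Dom M f)" "f \<cdot> g = Zero M X (Cod M f)"
  shows "g = Zero M X (Dom M f)"
proof (rule monomorphismD [OF assms(1)])
  show "Zero M X (Dom M f) \<in> hom M X (Dom M f)"
    using assms Zero_in hom_Obj by blast
  show "f \<cdot> g = f \<cdot> Zero M X (Dom M f)"
    using assms monomorphism_Arr hom_Obj by simp
qed (use assms in auto)

lemma is_kernelD:
  assumes "is_kernel M k f"
  shows is_kernel_Arr: "k \<in> hom M (Dom M k) (Dom M f)" "f \<in> Arr M"
    and is_kernel_Zero: "f \<cdot> k = Zero M (Dom M k) (Cod M f)"
    and is_kernel_factor: "g \<in> hom M X (Dom M f) \<Longrightarrow> f \<cdot> g = Zero M X (Cod M f) \<Longrightarrow>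
      \<exists>u \<in> hom M X (Dom M k). k \<cdot> u = g"
proof -
  show "k \<in> hom M (Dom M k) (Dom M f)" "f \<in> Arr M" "f \<cdot> k = Zero M (Dom M k) (Cod M f)"
    using assms unfolding is_kernel_def by (auto simp: hom_iff)
  show "\<exists>u \<in> hom M X (Dom M k). k \<cdot> u = g"
    if "g \<in> hom M X (Dom M f)" "f \<cdot> g = Zero M X (Cod M f)"
    using assms that unfolding is_kernel_def by blast
qed

lemma is_kernel_monomorphism:
  assumes "is_kernel M k f"
  shows "monomorphism M k"
proof (rule monomorphismI [OF is_kernel_Arr(1) [OF assms]])
  fix X u v assume u: "u \<in> hom M X (Dom M k)" "v \<in> hom M X (Dom M k)" "k \<cdot> u = k \<cdot> v"
  note k = is_kernelD [OF assms]
  have "f \<cdot> k \<cdot> u = (f \<cdot> k) \<cdot> u"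
    using k(1,2) u by (simp add: hom_iff)
  also have "\<dots> = Zero M X (Cod M f)"
    using k u by (simp add: hom_iff)
  finally have "\<exists>!w. w \<in> hom M X (Dom M k) \<and> k \<cdot> w = k \<cdot> u"
    using assms u k(1) Comp_in unfolding is_kernel_def by blast
  then show "u = v"
    using u by metis
qed

lemma is_kernelI:
  assumes "monomorphism M k" "f \<in> Arr M" "Cod M k = Dom M f" "f \<cdot> k = Zero M (Dom M k) (Cod M f)"
    and "\<And>X g. g \<in> hom M X (Dom M f) \<Longrightarrow> f \<cdot> g = Zero M X (Cod M f) \<Longrightarrow>
      \<exists>u \<in> hom M X (Dom M k). k \<cdot> u = g"
  shows "is_kernel M k f"
proof -
  have "\<exists>!u. u \<in> hom M X (Dom M k) \<and> k \<cdot> u = g"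
    if g: "g \<in> hom M X (Dom M f)" "f \<cdot> g = Zero M X (Cod M f)" for X g
    using assms(5) [OF g] monomorphismD [OF assms(1)] by metis
  then show ?thesis
    using assms monomorphism_Arr unfolding is_kernel_def by blast
qed

lemma is_kernel_same_subobject:
  assumes "is_kernel M k f" "is_kernel M l f"
  shows "same_subobject M k l"
proof -
  note k = is_kernelD [OF assms(1)] and l = is_kernelD [OF assms(2)]
  have 1: "Cod M k = Cod M l" "Cod M l = Dom M f"
    using k(1) l(1) by (auto simp: hom_iff)
  obtain u where u: "u \<in> hom M (Dom M k) (Dom M l)" "l \<cdot> u = k"
    using l(4) [OF k(1,3)] by blast
  obtain v where v: "v \<in> hom M (Dom M l) (Dom M k)" "k \<cdot> v = l"
    using k(4) [OF l(1,3)] by blast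
  have "v \<cdot> u = Ide M (Dom M k)"
    by (rule monomorphismD [OF is_kernel_monomorphism [OF assms(1)], where X = "Dom M k"])
      (use u v k(1) l(1) Comp_Comp [of u v k] in \<open>auto simp: hom_iff\<close>)
  moreover have "u \<cdot> v = Ide M (Dom M l)"
    by (rule monomorphismD [OF is_kernel_monomorphism [OF assms(2)], where X = "Dom M l"])
      (use u v k(1) l(1) Comp_Comp [of v u l] in \<open>auto simp: hom_iff\<close>)
  ultimately have "isomorphism M u"
    using u v by (auto simp: isomorphism_def hom_iff)
  then show ?thesis
    unfolding same_subobject_def using assms is_kernel_monomorphism 1 u by blast
qed

lemma is_kernel_Sub_iff:
  assumes "e \<in> Arr M" "f \<in> hom M (Cod M e) B" "g \<in> hom M (Cod M e) B"
  shows "is_kernel M e (Sub f g) \<longleftrightarrow> is_equalizer M e f g"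
proof -
  have s: "Sub f g \<in> hom M (Cod M e) B"
    using Sub_in assms by blast
  have *: "Sub f g \<cdot> h = Zero M X B \<longleftrightarrow> f \<cdot> h = g \<cdot> h" if "h \<in> hom M X (Cod M e)" for X h
    using Sub_Comp [OF assms(2,3) that] Sub_Zero_iff Comp_in [OF that] assms by metis
  have e: "e \<in> hom M (Dom M e) (Cod M e)"
    using assms by (simp add: hom_iff)
  show ?thesis
    unfolding is_kernel_def is_equalizer_def
    using * [OF e] s assms by (simp add: hom_Arr hom_Dom hom_Cod * cong: conj_cong)
qed

lemma is_cokernelD:
  assumes "is_cokernel M q f"
  shows is_cokernel_Arr: "q \<in> hom M (Cod M f) (Cod M q)" "f \<in> Arr M"
    and is_cokernel_Zero: "q \<cdot> f = Zero M (Dom M f) (Cod M q)"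
    and is_cokernel_factor: "g \<in> hom M (Cod M f) X \<Longrightarrow> g \<cdot> f = Zero M (Dom M f) X \<Longrightarrow>
      \<exists>u \<in> hom M (Cod M q) X. u \<cdot> q = g"
proof -
  show "q \<in> hom M (Cod M f) (Cod M q)" "f \<in> Arr M" "q \<cdot> f = Zero M (Dom M f) (Cod M q)"
    using assms unfolding is_cokernel_def by (auto simp: hom_iff)
  show "\<exists>u \<in> hom M (Cod M q) X. u \<cdot> q = g"
    if "g \<in> hom M (Cod M f) X" "g \<cdot> f = Zero M (Dom M f) X"
    using assms that unfolding is_cokernel_def by blast
qed

lemma is_cokernel_cancel:
  assumes "is_cokernel M q f" "u \<in> hom M (Cod M q) X" "v \<in> hom M (Cod M q) X" "u \<cdot> q = v \<cdot> q"
  shows "u = v"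
proof -
  note q = is_cokernelD [OF assms(1)]
  have "(u \<cdot> q) \<cdot> f = u \<cdot> q \<cdot> f"
    using q(1,2) assms(2) by (simp add: hom_iff)
  also have "\<dots> = Zero M (Dom M f) X"
    using q assms by (simp add: hom_iff)
  finally have "\<exists>!w. w \<in> hom M (Cod M q) X \<and> w \<cdot> q = u \<cdot> q"
    using assms q(1) Comp_in unfolding is_cokernel_def by blast
  then show "u = v"
    using assms by metis
qed

lemma coproduct_proj:
  assumes "is_coproduct M I X S" "\<And>j. j \<in> I \<Longrightarrow> X j \<in> Obj M" "i \<in> I"
  shows coproduct_proj_in: "coproduct_proj M I X S i \<in> hom M (fst S) (X i)"
    and coproduct_proj_Comp: "j \<in> I \<Longrightarrow> coproduct_proj M I X S i \<cdot> snd S j =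
      (if j = i then Ide M (X i) else Zero M (X j) (X i))"
proof -
  have "\<And>j. j \<in> I \<Longrightarrow> (if j = i then Ide M (X i) else Zero M (X j) (X i)) \<in> hom M (X j) (X i)"
    using assms by (auto simp: hom_iff)
  from cotuple [OF assms(1) assms(2) [OF assms(3)] this]
  show "coproduct_proj M I X S i \<in> hom M (fst S) (X i)"
    "j \<in> I \<Longrightarrow> coproduct_proj M I X S i \<cdot> snd S j = (if j = i then Ide M (X i) else Zero M (X j) (X i))"
    unfolding coproduct_proj_def by blast+
qed

lemma sum_upto_in: "(\<And>i. i \<le> n \<Longrightarrow> f i \<in> hom M A B) \<Longrightarrow> sum_upto M f n \<in> hom M A B"
  by (induction n) (auto intro: Add_in)

lemma sum_upto_cong: "(\<And>i. i \<le> n \<Longrightarrow> f i = g i) \<Longrightarrow> sum_upto M f n = sum_upto M g n"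
  by (induction n) auto

lemma Comp_sum_upto:
  assumes "\<And>i. i \<le> n \<Longrightarrow> f i \<in> hom M A B" "h \<in> hom M B C"
  shows "h \<cdot> sum_upto M f n = sum_upto M (\<lambda>i. h \<cdot> f i) n"
  using assms(1)
proof (induction n)
  case (Suc n)
  then show ?case
    using Comp_Add [OF sum_upto_in [of n f A B] Suc.prems [of "Suc n"] assms(2)] by simp
qed simp

lemma sum_upto_Comp:
  assumes "\<And>i. i \<le> n \<Longrightarrow> f i \<in> hom M B C" "h \<in> hom M A B"
  shows "sum_upto M f n \<cdot> h = sum_upto M (\<lambda>i. f i \<cdot> h) n"
  using assms(1)
proof (induction n)
  case (Suc n)
  then show ?case
    using Add_Comp [OF assms(2) sum_upto_in [of n f B C] Suc.prems [of "Suc n"]] by simp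
qed simp

lemma sum_upto_Zero:
  assumes "A \<in> Obj M" "B \<in> Obj M" "\<And>i. i \<le> n \<Longrightarrow> f i = Zero M A B"
  shows "sum_upto M f n = Zero M A B"
  using assms by (induction n) (auto intro: Add_Zero Zero_in)

lemma sum_upto_single:
  assumes "f k \<in> hom M A B" "k \<le> n" "\<And>i. i \<le> n \<Longrightarrow> i \<noteq> k \<Longrightarrow> f i = Zero M A B"
  shows "sum_upto M f n = f k"
  using assms(2,3)
proof (induction n)
  case (Suc n)
  have O: "A \<in> Obj M" "B \<in> Obj M"
    using assms(1) hom_Obj by blast+
  show ?case
  proof (cases "k = Suc n")
    case True
    then have "sum_upto M f n = Zero M A B"
      using Suc.prems O by (intro sum_upto_Zero) auto
    then show ?thesis
      using True assms(1) by (simp add: Zero_Add)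
  next
    case False
    then show ?thesis
      using Suc assms(1) by (simp add: Add_Zero)
  qed
qed simp

end

context abelian_category begin

text \<open>Some \<open>f\<close> has kernel \<open>k\<close>. As \<open>f\<close> kills
  \<open>k\<close> it factors through the cokernel \<open>q\<close>, so whatever \<open>q\<close>
  kills is also killed by \<open>f\<close> and factors through \<open>k\<close>.\<close>

lemma monomorphism_cokernel:
  assumes "monomorphism M k" "is_cokernel M q k"
  shows "is_kernel M k q"
proof (rule is_kernelI [OF assms(1)])
  note q = is_cokernelD [OF assms(2)]
  obtain f where f: "is_kernel M k f"
    using mono_is_kernel assms by blast
  note k = is_kernelD [OF f]
  obtain u where u: "u \<in> hom M (Cod M q) (Cod M f)" "u \<cdot> q = f"
    using q(4) [of f "Cod M f"] k by (auto simp: hom_iff)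
  fix X g assume g: "g \<in> hom M X (Dom M q)" "q \<cdot> g = Zero M X (Cod M q)"
  have "f \<cdot> g = u \<cdot> q \<cdot> g"
    using u g q(1) by (auto simp: hom_iff)
  also have "\<dots> = Zero M X (Cod M f)"
    using u g q(1) by (auto simp: hom_iff)
  finally show "\<exists>u \<in> hom M X (Dom M k). k \<cdot> u = g"
    using k(4) [of g X] g k(1) q(1) by (auto simp: hom_iff)
qed (use is_cokernelD [OF assms(2)] in \<open>auto simp: hom_iff\<close>)

lemma equalizer_exists:
  assumes "f \<in> hom M A B" "g \<in> hom M A B"
  shows "\<exists>e. is_equalizer M e f g"
proof -
  obtain k where k: "is_kernel M k (Sub f g)"
    using kernel_exists Sub_in [OF assms] hom_Arr by blast
  then have "Cod M k = A" "k \<in> Arr M"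
    using Sub_in [OF assms] by (auto simp: is_kernel_def hom_iff)
  then show ?thesis
    using is_kernel_Sub_iff [of k f B g] assms k by blast
qed

end

section \<open>Coabelian monoidal categories\<close>

context monoidal_category begin

abbreviation associator ("\<a>") where "\<a> \<equiv> Assoc M"
abbreviation lwhisker (infixl "\<lhd>" 70) where "A \<lhd> f \<equiv> Ide M A \<boxtimes> f"
abbreviation rwhisker (infixl "\<rhd>" 70) where "f \<rhd> A \<equiv> f \<boxtimes> Ide M A"

lemma Unit_Obj [simp]: "\<one> \<in> Obj M"
  by (rule Unit_in)

lemma TensorO_Obj [simp]: "A \<in> Obj M \<Longrightarrow> B \<in> Obj M \<Longrightarrow> A \<otimes> B \<in> Obj M"
  by (rule TensorO_in)

lemma TensorA_simps [simp]:
  assumes "f \<in> Arr M" "g \<in> Arr M"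
  shows "f \<boxtimes> g \<in> Arr M" "Dom M (f \<boxtimes> g) = Dom M f \<otimes> Dom M g" "Cod M (f \<boxtimes> g) = Cod M f \<otimes> Cod M g"
  using TensorA_in [of f "Dom M f" "Cod M f" g "Dom M g" "Cod M g"] assms by (auto simp: hom_def)

declare TensorA_Ide [simp]

lemma Assoc_simps [simp]:
  assumes "A \<in> Obj M" "B \<in> Obj M" "C \<in> Obj M"
  shows "\<a> A B C \<in> Arr M" "Dom M (\<a> A B C) = A \<otimes> B \<otimes> C"
    "Cod M (\<a> A B C) = A \<otimes> (B \<otimes> C)"
  using Assoc_in [OF assms] by (auto simp: hom_def)

lemma LUnit_simps [simp]:
  "A \<in> Obj M \<Longrightarrow> LUnit M A \<in> Arr M" "A \<in> Obj M \<Longrightarrow> Dom M (LUnit M A) = \<one> \<otimes> A"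
  "A \<in> Obj M \<Longrightarrow> Cod M (LUnit M A) = A"
  using LUnit_in by (auto simp: hom_def)

lemma RUnit_simps [simp]:
  "A \<in> Obj M \<Longrightarrow> RUnit M A \<in> Arr M" "A \<in> Obj M \<Longrightarrow> Dom M (RUnit M A) = A \<otimes> \<one>"
  "A \<in> Obj M \<Longrightarrow> Cod M (RUnit M A) = A"
  using RUnit_in by (auto simp: hom_def)

lemma Assoc_monomorphism: "A \<in> Obj M \<Longrightarrow> B \<in> Obj M \<Longrightarrow> C \<in> Obj M \<Longrightarrow> monomorphism M (\<a> A B C)"
  using Assoc_in isomorphism_monomorphism by blast

lemma merge_tensor:
  assumes "f \<in> Arr M" "g \<in> Arr M" "f' \<in> Arr M" "g' \<in> Arr M" "Dom M f' = Cod M f" "Dom M g' = Cod M g"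
  shows "(f' \<boxtimes> g') \<cdot> (f \<boxtimes> g) = (f' \<cdot> f) \<boxtimes> (g' \<cdot> g)"
  using TensorA_Comp [of f "Dom M f" "Cod M f" f' "Cod M f'" g "Dom M g" "Cod M g" g' "Cod M g'"] assms
  by (auto simp: hom_def)

lemma merge_tensor_tail:
  assumes "f \<in> Arr M" "g \<in> Arr M" "f' \<in> Arr M" "g' \<in> Arr M" "Dom M f' = Cod M f" "Dom M g' = Cod M g"
    and "k \<in> Arr M" "Cod M k = Dom M f \<otimes> Dom M g"
  shows "(f' \<boxtimes> g') \<cdot> (f \<boxtimes> g) \<cdot> k = ((f' \<cdot> f) \<boxtimes> (g' \<cdot> g)) \<cdot> k"
  using assms by (subst merge_tensor [symmetric]) simp_all

text \<open>Interchange law oriented towards fusing neighbouring tensor products of arrows; the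
  second rule does so inside a right-nested chain.\<close>

lemmas merge = merge_tensor merge_tensor_tail

lemma Assoc_left1:
  assumes "f \<in> Arr M" "g \<in> Arr M" "h \<in> Arr M" "Dom M f = A" "Dom M g = B" "Dom M h = C"
  shows "(f \<boxtimes> (g \<boxtimes> h)) \<cdot> \<a> A B C = \<a> (Cod M f) (Cod M g) (Cod M h) \<cdot> (f \<boxtimes> g \<boxtimes> h)"
  using Assoc_natural [of f A "Cod M f" g B "Cod M g" h C "Cod M h"] assms by (auto simp: hom_def)

lemma Assoc_left1_tail:
  assumes "f \<in> Arr M" "g \<in> Arr M" "h \<in> Arr M" "Dom M f = A" "Dom M g = B" "Dom M h = C"
    and "k \<in> Arr M" "Cod M k = A \<otimes> B \<otimes> C"
  shows "(f \<boxtimes> (g \<boxtimes> h)) \<cdot> \<a> A B C \<cdot> k = \<a> (Cod M f) (Cod M g) (Cod M h) \<cdot> (f \<boxtimes> g \<boxtimes> h) \<cdot> k"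
proof -
  have O: "A \<in> Obj M" "B \<in> Obj M" "C \<in> Obj M"
    using assms by auto
  have "(f \<boxtimes> (g \<boxtimes> h)) \<cdot> \<a> A B C \<cdot> k = ((f \<boxtimes> (g \<boxtimes> h)) \<cdot> \<a> A B C) \<cdot> k"
    using assms O by simp
  also have "\<dots> = \<a> (Cod M f) (Cod M g) (Cod M h) \<cdot> (f \<boxtimes> g \<boxtimes> h) \<cdot> k"
    using assms O by (subst Assoc_left1) simp_all
  finally show ?thesis .
qed

text \<open>The simplifier contracts \<open>B \<lhd> Ide M C\<close> to
  \<open>Ide M (B \<otimes> C)\<close>, so the general naturality rule no longer matches this
  instance.\<close>

lemma Assoc_left2:
  assumes "f \<in> Arr M" "Dom M f = A" "B \<in> Obj M" "C \<in> Obj M"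
  shows "(f \<rhd> (B \<otimes> C)) \<cdot> \<a> A B C = \<a> (Cod M f) B C \<cdot> (f \<rhd> B \<rhd> C)"
  using Assoc_left1 [of f "Ide M B" "Ide M C" A B C] assms by simp

lemma Assoc_left2_tail:
  assumes "f \<in> Arr M" "Dom M f = A" "B \<in> Obj M" "C \<in> Obj M" "k \<in> Arr M" "Cod M k = A \<otimes> B \<otimes> C"
  shows "(f \<rhd> (B \<otimes> C)) \<cdot> \<a> A B C \<cdot> k = \<a> (Cod M f) B C \<cdot> (f \<rhd> B \<rhd> C) \<cdot> k"
  using Assoc_left1_tail [of f "Ide M B" "Ide M C" A B C] assms by simp

text \<open>Naturality of the associator, moving it to the left of a composite.
  \<open>Assoc_right\<close> is the opposite orientation, and each calculation picks one of
  them.\<close>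

lemmas Assoc_left = Assoc_left1 Assoc_left1_tail Assoc_left2 Assoc_left2_tail

lemma Assoc_right1:
  assumes "f \<in> Arr M" "g \<in> Arr M" "h \<in> Arr M" "Cod M f = A" "Cod M g = B" "Cod M h = C"
  shows "\<a> A B C \<cdot> (f \<boxtimes> g \<boxtimes> h) = (f \<boxtimes> (g \<boxtimes> h)) \<cdot> \<a> (Dom M f) (Dom M g) (Dom M h)"
  using Assoc_left1 [of f g h] assms by simp

lemma Assoc_right1_tail:
  assumes "f \<in> Arr M" "g \<in> Arr M" "h \<in> Arr M" "Cod M f = A" "Cod M g = B" "Cod M h = C"
    and "k \<in> Arr M" "Cod M k = Dom M f \<otimes> Dom M g \<otimes> Dom M h"
  shows "\<a> A B C \<cdot> (f \<boxtimes> g \<boxtimes> h) \<cdot> k = (f \<boxtimes> (g \<boxtimes> h)) \<cdot> \<a> (Dom M f) (Dom M g) (Dom M h) \<cdot> k"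
  using Assoc_left1_tail [of f g h "Dom M f" "Dom M g" "Dom M h" k] assms by simp

lemma Assoc_right2:
  assumes "h \<in> Arr M" "Cod M h = C" "A \<in> Obj M" "B \<in> Obj M"
  shows "\<a> A B C \<cdot> ((A \<otimes> B) \<lhd> h) = (A \<lhd> (B \<lhd> h)) \<cdot> \<a> A B (Dom M h)"
  using Assoc_right1 [of "Ide M A" "Ide M B" h A B C] assms by simp

lemma Assoc_right2_tail:
  assumes "h \<in> Arr M" "Cod M h = C" "A \<in> Obj M" "B \<in> Obj M" "k \<in> Arr M" "Cod M k = A \<otimes> B \<otimes> Dom M h"
  shows "\<a> A B C \<cdot> ((A \<otimes> B) \<lhd> h) \<cdot> k = (A \<lhd> (B \<lhd> h)) \<cdot> \<a> A B (Dom M h) \<cdot> k"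
  using Assoc_right1_tail [of "Ide M A" "Ide M B" h A B C k] assms by simp

lemmas Assoc_right = Assoc_right1 Assoc_right1_tail Assoc_right2 Assoc_right2_tail

text \<open>The pentagon in the shape left behind by fusing: an arrow \<open>u\<close> preceding the
  associator inside the whiskered factor has been absorbed into it.\<close>

lemma pentagon_whisker:
  assumes "A \<in> Obj M" "B \<in> Obj M" "C \<in> Obj M" "D \<in> Obj M" "u \<in> Arr M" "Cod M u = A \<otimes> B \<otimes> C"
  shows "(A \<lhd> \<a> B C D) \<cdot> \<a> A (B \<otimes> C) D \<cdot> ((\<a> A B C \<cdot> u) \<rhd> D)
    = \<a> A B (C \<otimes> D) \<cdot> \<a> (A \<otimes> B) C D \<cdot> (u \<rhd> D)"
proof -
  have "(A \<lhd> \<a> B C D) \<cdot> \<a> A (B \<otimes> C) D \<cdot> ((\<a> A B C \<cdot> u) \<rhd> D)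
    = ((A \<lhd> \<a> B C D) \<cdot> \<a> A (B \<otimes> C) D \<cdot> (\<a> A B C \<rhd> D)) \<cdot> (u \<rhd> D)"
    using assms by (simp add: merge)
  also have "\<dots> = (\<a> A B (C \<otimes> D) \<cdot> \<a> (A \<otimes> B) C D) \<cdot> (u \<rhd> D)"
    using assms by (simp add: pentagon del: Comp_Comp)
  finally show ?thesis
    using assms by simp
qed

lemma pentagon_whisker_tail:
  assumes "A \<in> Obj M" "B \<in> Obj M" "C \<in> Obj M" "D \<in> Obj M" "u \<in> Arr M" "Cod M u = A \<otimes> B \<otimes> C"
    and "k \<in> Arr M" "Cod M k = Dom M u \<otimes> D"
  shows "(A \<lhd> \<a> B C D) \<cdot> \<a> A (B \<otimes> C) D \<cdot> ((\<a> A B C \<cdot> u) \<rhd> D) \<cdot> k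
    = \<a> A B (C \<otimes> D) \<cdot> \<a> (A \<otimes> B) C D \<cdot> (u \<rhd> D) \<cdot> k"
proof -
  have "(A \<lhd> \<a> B C D) \<cdot> \<a> A (B \<otimes> C) D \<cdot> ((\<a> A B C \<cdot> u) \<rhd> D) \<cdot> k
    = ((A \<lhd> \<a> B C D) \<cdot> \<a> A (B \<otimes> C) D \<cdot> ((\<a> A B C \<cdot> u) \<rhd> D)) \<cdot> k"
    using assms by simp
  also have "\<dots> = (\<a> A B (C \<otimes> D) \<cdot> \<a> (A \<otimes> B) C D \<cdot> (u \<rhd> D)) \<cdot> k"
    using assms by (simp add: pentagon_whisker del: Comp_Comp)
  finally show ?thesis
    using assms by simp
qed

end

section \<open>Exactness of the tensor product\<close>

context coabelian_monoidal_category begin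

lemma Ide_TensorA_Zero [simp]:
  assumes "X \<in> Obj M" "A \<in> Obj M" "B \<in> Obj M"
  shows "X \<lhd> Zero M A B = Zero M (X \<otimes> A) (X \<otimes> B)"
proof (rule Add_idem_Zero)
  show "(X \<lhd> Zero M A B) \<oplus> (X \<lhd> Zero M A B) = X \<lhd> Zero M A B"
    using tensor_left_additive [OF assms(1)] Zero_in [of A B] Add_Zero [of "Zero M A B"] assms
    unfolding additive_map_def by metis
qed (use assms in \<open>simp add: hom_iff\<close>)

lemma Zero_TensorA_Ide [simp]:
  assumes "X \<in> Obj M" "A \<in> Obj M" "B \<in> Obj M"
  shows "Zero M A B \<rhd> X = Zero M (A \<otimes> X) (B \<otimes> X)"
proof (rule Add_idem_Zero)
  show "(Zero M A B \<rhd> X) \<oplus> (Zero M A B \<rhd> X) = Zero M A B \<rhd> X"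
    using tensor_right_additive [OF assms(1)] Zero_in [of A B] Add_Zero [of "Zero M A B"] assms
    unfolding additive_map_def by metis
qed (use assms in \<open>simp add: hom_iff\<close>)

lemma TensorA_Zero [simp]:
  assumes "f \<in> Arr M" "A \<in> Obj M" "B \<in> Obj M"
  shows "f \<boxtimes> Zero M A B = Zero M (Dom M f \<otimes> A) (Cod M f \<otimes> B)"
proof -
  have "f \<boxtimes> Zero M A B = (f \<rhd> B) \<cdot> (Dom M f \<lhd> Zero M A B)"
    using assms by (subst merge_tensor) simp_all
  then show ?thesis
    using assms by simp
qed

lemma Zero_TensorA [simp]:
  assumes "f \<in> Arr M" "A \<in> Obj M" "B \<in> Obj M"
  shows "Zero M A B \<boxtimes> f = Zero M (A \<otimes> Dom M f) (B \<otimes> Cod M f)"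
proof -
  have "Zero M A B \<boxtimes> f = (B \<lhd> f) \<cdot> (Zero M A B \<rhd> Dom M f)"
    using assms by (subst merge_tensor) simp_all
  then show ?thesis
    using assms by simp
qed

text \<open>In an abelian category a monomorphism is a kernel, and tensoring preserves
  kernels.\<close>

lemma monomorphism_Ide_TensorA:
  assumes "monomorphism M f" "X \<in> Obj M"
  shows "monomorphism M (X \<lhd> f)"
  using mono_is_kernel [OF assms(1)] tensor_left_exact [OF assms(2)] is_kernel_monomorphism
  unfolding left_exact_map_def by blast

lemma monomorphism_TensorA_Ide:
  assumes "monomorphism M f" "X \<in> Obj M"
  shows "monomorphism M (f \<rhd> X)"
  using mono_is_kernel [OF assms(1)] tensor_right_exact [OF assms(2)] is_kernel_monomorphism
  unfolding left_exact_map_def by blast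

text \<open>Additivity carries differences to differences and left exactness carries their kernels
  to kernels. \<open>G\<close> is the object part of \<open>F\<close>.\<close>

lemma is_equalizer_map:
  assumes "is_equalizer M e f g" "additive_map M F" "left_exact_map M F"
    and F: "\<And>A B f. f \<in> hom M A B \<Longrightarrow> F f \<in> hom M (G A) (G B)"
  shows "is_equalizer M (F e) (F f) (F g)"
proof -
  have e: "e \<in> Arr M" "f \<in> hom M (Cod M e) (Cod M g)" "g \<in> hom M (Cod M e) (Cod M g)"
    using assms(1) by (auto simp: is_equalizer_def)
  then have "is_kernel M (F e) (F (Sub f g))"
    using is_kernel_Sub_iff assms(1,3) unfolding left_exact_map_def by blast
  moreover have "Sub (F f) (F g) = F (Sub f g)"
  proof (rule Sub_eqI [OF F [OF e(2)] F [OF e(3)] F [OF Sub_in [OF e(2,3)]]])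
    show "F (Sub f g) \<oplus> F g = F f"
      using assms(2) Sub_in [OF e(2,3)] Sub_Add [OF e(2,3)] e(3) unfolding additive_map_def by metis
  qed
  moreover have "F e \<in> Arr M" "F f \<in> hom M (Cod M (F e)) (G (Cod M g))" "F g \<in> hom M (Cod M (F e)) (G (Cod M g))"
    using F [of e "Dom M e" "Cod M e"] F e by (auto simp: hom_iff)
  ultimately show ?thesis
    using is_kernel_Sub_iff by metis
qed

lemma is_equalizer_Ide_TensorA:
  assumes "is_equalizer M e f g" "X \<in> Obj M"
  shows "is_equalizer M (X \<lhd> e) (X \<lhd> f) (X \<lhd> g)"
  using is_equalizer_map [OF assms(1) tensor_left_additive [OF assms(2)] tensor_left_exact [OF assms(2)],
      where G = "\<lambda>A. X \<otimes> A"] assms(2) by (auto simp: hom_iff)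

lemma is_equalizer_TensorA_Ide:
  assumes "is_equalizer M e f g" "X \<in> Obj M"
  shows "is_equalizer M (e \<rhd> X) (f \<rhd> X) (g \<rhd> X)"
  using is_equalizer_map [OF assms(1) tensor_right_additive [OF assms(2)] tensor_right_exact [OF assms(2)],
      where G = "\<lambda>A. A \<otimes> X"] assms(2) by (auto simp: hom_iff)

end

section \<open>The cotensor product\<close>

text \<open>The instances are the degree zero coalgebra, over which cotensor products are taken, and
  the given coalgebra itself.\<close>

locale coassociative_comultiplication = coabelian_monoidal_category M
  for M :: "('o, 'm, 'z) monoidal_scheme" (structure) +
  fixes D :: "('o, 'm, 'y) coalgebra_scheme"
  assumes Car_Obj [simp]: "Car D \<in> Obj M"
    and Comult_in: "Comult D \<in> hom M (Car D) (Car D \<otimes> Car D)"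
    and coassoc: "\<a> (Car D) (Car D) (Car D) \<cdot> (Comult D \<rhd> Car D) \<cdot> Comult D
      = (Car D \<lhd> Comult D) \<cdot> Comult D"
begin

lemma Comult_simps [simp]:
  "Comult D \<in> Arr M" "Dom M (Comult D) = Car D" "Cod M (Comult D) = Car D \<otimes> Car D"
  using Comult_in by (auto simp: hom_iff)

abbreviation K where "K \<equiv> Car D"

text \<open>Bicomodules over \<open>D\<close> are taken without the counit laws.\<close>

definition bicomodule_on where
  "bicomodule_on X l r \<longleftrightarrow> X \<in> Obj M \<and> l \<in> hom M X (K \<otimes> X) \<and> r \<in> hom M X (X \<otimes> K) \<and>
     \<a> K K X \<cdot> (Comult D \<rhd> X) \<cdot> l = (K \<lhd> l) \<cdot> l \<and>
     \<a> X K K \<cdot> (r \<rhd> K) \<cdot> r = (X \<lhd> Comult D) \<cdot> r \<and>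
     \<a> K X K \<cdot> (l \<rhd> K) \<cdot> r = (K \<lhd> r) \<cdot> l"

definition bicomod :: "('o, 'm) bicomodule \<Rightarrow> bool" where
  "bicomod V \<longleftrightarrow> bicomodule_on (BCar V) (LCo V) (RCo V)"

lemma bicomod_simps [simp]:
  assumes "bicomod V"
  shows "BCar V \<in> Obj M" "LCo V \<in> Arr M" "Dom M (LCo V) = BCar V" "Cod M (LCo V) = K \<otimes> BCar V"
    "RCo V \<in> Arr M" "Dom M (RCo V) = BCar V" "Cod M (RCo V) = BCar V \<otimes> K"
  using assms by (auto simp: bicomod_def bicomodule_on_def hom_iff)

lemma bicomod_coassoc:
  assumes "bicomod V"
  shows LCo_coassoc: "\<a> K K (BCar V) \<cdot> (Comult D \<rhd> BCar V) \<cdot> LCo V = (K \<lhd> LCo V) \<cdot> LCo V"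
    and RCo_coassoc: "\<a> (BCar V) K K \<cdot> (RCo V \<rhd> K) \<cdot> RCo V = (BCar V \<lhd> Comult D) \<cdot> RCo V"
    and LCo_RCo: "\<a> K (BCar V) K \<cdot> (LCo V \<rhd> K) \<cdot> RCo V = (K \<lhd> RCo V) \<cdot> LCo V"
  using assms by (auto simp: bicomod_def bicomodule_on_def)

lemma bicomod_regular: "bicomod (regular_bicomodule D)"
  using coassoc Comult_in by (simp add: bicomod_def bicomodule_on_def regular_bicomodule_def)

section \<open>The cotensor product as an equalizer and its left coaction\<close>

abbreviation inc where "inc V W \<equiv> cotensor_incl M D V W"
abbreviation cot (infixl "\<box>" 70) where "V \<box> W \<equiv> cotensor M D V W"

context
  fixes V W :: "('o, 'm) bicomodule"
  assumes V [simp]: "bicomod V" and W [simp]: "bicomod W"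
begin

lemma inc_equalizer: "is_equalizer M (inc V W)
    (\<a> (BCar V) (Car D) (BCar W) \<cdot> (RCo V \<rhd> BCar W)) (BCar V \<lhd> LCo W)"
  unfolding cotensor_incl_def
  by (rule someI_ex, rule equalizer_exists [where A = "BCar V \<otimes> BCar W" and B = "BCar V \<otimes> (Car D \<otimes> BCar W)"])
    (auto simp: hom_iff)

lemma inc_simps [simp]:
  "inc V W \<in> Arr M" "Cod M (inc V W) = BCar V \<otimes> BCar W" "Dom M (inc V W) = BCar (V \<box> W)"
  using inc_equalizer by (auto simp: is_equalizer_def hom_iff cotensor_def Let_def)

lemma BCar_cotensor_Obj [simp]: "BCar (V \<box> W) \<in> Obj M"
  using Dom_in [of "inc V W"] by simp

lemma inc_eq: "\<a> (BCar V) (Car D) (BCar W) \<cdot> (RCo V \<rhd> BCar W) \<cdot> inc V W =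
    (BCar V \<lhd> LCo W) \<cdot> inc V W"
  using inc_equalizer by (simp add: is_equalizer_def)

lemma inc_monomorphism: "monomorphism M (inc V W)"
  using inc_equalizer is_equalizer_monomorphism by blast

lemma inc_factor:
  assumes "h \<in> hom M X (BCar V \<otimes> BCar W)"
    and "\<a> (BCar V) (Car D) (BCar W) \<cdot> (RCo V \<rhd> BCar W) \<cdot> h = (BCar V \<lhd> LCo W) \<cdot> h"
  obtains u where "u \<in> hom M X (BCar (V \<box> W))" "inc V W \<cdot> u = h"
  using is_equalizer_factor [OF inc_equalizer, of h X] assms by (auto simp: hom_iff)

lemma inc_cancel:
  assumes "inc V W \<cdot> u = inc V W \<cdot> v" "u \<in> hom M X (BCar (V \<box> W))" "v \<in> hom M X (BCar (V \<box> W))"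
  shows "u = v"
  using monomorphismD [OF inc_monomorphism] assms by auto

lemma cotensor_lift:
  assumes "h \<in> hom M X (BCar V \<otimes> BCar W)"
    and "\<a> (BCar V) (Car D) (BCar W) \<cdot> (RCo V \<rhd> BCar W) \<cdot> h = (BCar V \<lhd> LCo W) \<cdot> h"
  shows "cotensor_lift M D V W h \<in> hom M X (BCar (V \<box> W))" "inc V W \<cdot> cotensor_lift M D V W h = h"
proof -
  have "Dom M h = X"
    using assms hom_Dom by blast
  then have "\<exists>!u. u \<in> hom M (Dom M h) (BCar (V \<box> W)) \<and> inc V W \<cdot> u = h"
    using inc_factor [OF assms] inc_cancel by metis
  from theI' [OF this] show "cotensor_lift M D V W h \<in> hom M X (BCar (V \<box> W))"
    "inc V W \<cdot> cotensor_lift M D V W h = h"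
    unfolding cotensor_lift_def using \<open>Dom M h = X\<close> by auto
qed

text \<open>Tensored with \<open>K\<close> on the left, \<open>inc V W\<close> is still an
  equalizer. The left coaction of \<open>V\<close> lands in it because it commutes with the right
  coaction of \<open>V\<close>, the one being equalized.\<close>

lemma LCo_cotensor_ex:
  "\<exists>l \<in> hom M (BCar (V \<box> W)) (K \<otimes> BCar (V \<box> W)).
     (K \<lhd> inc V W) \<cdot> l = \<a> K (BCar V) (BCar W) \<cdot> (LCo V \<rhd> BCar W) \<cdot> inc V W"
proof -
  \<comment> \<open>Opaque names turn the calculation into one about plain arrows whose domains and
    codomains are simp rules.\<close>
  define A B l r m e where "A = BCar V" "B = BCar W" "l = LCo V" "r = RCo V" "m = LCo W" "e = inc V W"
  note defs = this
  have [simp]: "A \<in> Obj M" "B \<in> Obj M" "l \<in> Arr M" "Dom M l = A" "Cod M l = K \<otimes> A"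
    "r \<in> Arr M" "Dom M r = A" "Cod M r = A \<otimes> K" "m \<in> Arr M" "Dom M m = B" "Cod M m = K \<otimes> B"
    "e \<in> Arr M" "Dom M e = BCar (V \<box> W)" "Cod M e = A \<otimes> B"
    by (auto simp: defs)
  have "(K \<lhd> (\<a> A K B \<cdot> (r \<rhd> B))) \<cdot> \<a> K A B \<cdot> (l \<rhd> B) \<cdot> e
      = (K \<lhd> \<a> A K B) \<cdot> (K \<lhd> (r \<rhd> B)) \<cdot> \<a> K A B \<cdot> (l \<rhd> B) \<cdot> e" (is "?l = _")
    by (simp add: merge)
  also have "\<dots> = (K \<lhd> \<a> A K B) \<cdot> \<a> K (A \<otimes> K) B \<cdot> (((K \<lhd> r) \<cdot> l) \<rhd> B) \<cdot> e"
    by (simp add: Assoc_left merge)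
  also have "\<dots> = (K \<lhd> \<a> A K B) \<cdot> \<a> K (A \<otimes> K) B
      \<cdot> ((\<a> K A K \<cdot> (l \<rhd> K) \<cdot> r) \<rhd> B) \<cdot> e"
    using LCo_RCo [OF V] by (simp add: defs)
  also have "\<dots> = \<a> K A (K \<otimes> B) \<cdot> \<a> (K \<otimes> A) K B \<cdot> (l \<rhd> K \<rhd> B) \<cdot> (r \<rhd> B) \<cdot> e"
    by (simp add: pentagon_whisker_tail merge)
  also have "\<dots> = \<a> K A (K \<otimes> B) \<cdot> (l \<rhd> (K \<otimes> B)) \<cdot> \<a> A K B \<cdot> (r \<rhd> B) \<cdot> e"
    by (simp add: Assoc_right)
  also have "\<dots> = \<a> K A (K \<otimes> B) \<cdot> (l \<boxtimes> m) \<cdot> e"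
    using inc_eq by (simp add: defs [symmetric] merge)
  also have "\<dots> = (K \<lhd> (A \<lhd> m)) \<cdot> \<a> K A B \<cdot> (l \<rhd> B) \<cdot> e" (is "_ = ?r")
    by (simp add: Assoc_left merge)
  finally have eq: "?l = ?r" .
  have "\<a> K A B \<cdot> (l \<rhd> B) \<cdot> e \<in> hom M (BCar (V \<box> W)) (Cod M (K \<lhd> e))"
    by (simp add: hom_iff)
  then obtain u where "u \<in> hom M (BCar (V \<box> W)) (Dom M (K \<lhd> e))"
    "(K \<lhd> e) \<cdot> u = \<a> K A B \<cdot> (l \<rhd> B) \<cdot> e"
    using is_equalizer_factor [OF is_equalizer_Ide_TensorA [OF inc_equalizer Car_Obj]] eq
    unfolding defs [symmetric] by metis
  then show ?thesis
    unfolding defs [symmetric] by auto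
qed

end

section \<open>Colinear maps\<close>

definition rcolin :: "('o, 'm) bicomodule \<Rightarrow> ('o, 'm) bicomodule \<Rightarrow> 'm \<Rightarrow> bool" where
  "rcolin V W f \<longleftrightarrow> f \<in> hom M (BCar V) (BCar W) \<and> RCo W \<cdot> f = (f \<rhd> K) \<cdot> RCo V"

definition lcolin :: "('o, 'm) bicomodule \<Rightarrow> ('o, 'm) bicomodule \<Rightarrow> 'm \<Rightarrow> bool" where
  "lcolin V W f \<longleftrightarrow> f \<in> hom M (BCar V) (BCar W) \<and> LCo W \<cdot> f = (K \<lhd> f) \<cdot> LCo V"

lemma lcolin_Ide: "bicomod V \<Longrightarrow> lcolin V V (Ide M (BCar V))"
  by (simp add: lcolin_def hom_iff)

lemma rcolin_Ide: "bicomod V \<Longrightarrow> rcolin V V (Ide M (BCar V))"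
  by (simp add: rcolin_def hom_iff)

lemma rcolin_Comp:
  assumes "rcolin U V f" "rcolin V W g" "bicomod U" "bicomod V" "bicomod W"
  shows "rcolin U W (g \<cdot> f)"
proof -
  have [simp]: "f \<in> Arr M" "Dom M f = BCar U" "Cod M f = BCar V" "g \<in> Arr M" "Dom M g = BCar V" "Cod M g = BCar W"
    and f: "RCo V \<cdot> f = (f \<rhd> K) \<cdot> RCo U" and g: "RCo W \<cdot> g = (g \<rhd> K) \<cdot> RCo V"
    using assms by (auto simp: rcolin_def hom_iff)
  note [simp] = assms(3-5)
  have "RCo W \<cdot> g \<cdot> f = (g \<rhd> K) \<cdot> RCo V \<cdot> f"
    using Comp_tail [OF g, of f] by simp
  also have "\<dots> = ((g \<cdot> f) \<rhd> K) \<cdot> RCo U"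
    by (simp add: f merge)
  finally show ?thesis
    by (simp add: rcolin_def hom_iff)
qed

section \<open>The right coaction and the bicomodule structure of a cotensor product\<close>

context
  fixes V W :: "('o, 'm) bicomodule"
  assumes V [simp]: "bicomod V" and W [simp]: "bicomod W"
begin

text \<open>Mirror image of the left coaction, using that the two coactions of \<open>W\<close>
  commute, with one complication: the coaction lands in \<open>A \<otimes> (B \<otimes> K)\<close>,
  whereas the equalizer tensored with \<open>K\<close> sits over
  \<open>A \<otimes> B \<otimes> K\<close>. Hence the inverse associator \<open>ai\<close>.\<close>

lemma RCo_cotensor_ex:
  "\<exists>r \<in> hom M (BCar (V \<box> W)) (BCar (V \<box> W) \<otimes> K).
     \<a> (BCar V) (BCar W) K \<cdot> (inc V W \<rhd> K) \<cdot> r = (BCar V \<lhd> RCo W) \<cdot> inc V W"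
proof -
  define A B m r n e where "A = BCar V" "B = BCar W" "m = LCo W" "r = RCo V" "n = RCo W" "e = inc V W"
  note defs = this
  have [simp]: "A \<in> Obj M" "B \<in> Obj M" "n \<in> Arr M" "Dom M n = B" "Cod M n = B \<otimes> K"
    "r \<in> Arr M" "Dom M r = A" "Cod M r = A \<otimes> K" "m \<in> Arr M" "Dom M m = B" "Cod M m = K \<otimes> B"
    "e \<in> Arr M" "Dom M e = BCar (V \<box> W)" "Cod M e = A \<otimes> B"
    by (auto simp: defs)
  obtain ai where "ai \<in> hom M (A \<otimes> (B \<otimes> K)) (A \<otimes> B \<otimes> K)"
    and ai: "\<a> A B K \<cdot> ai = Ide M (A \<otimes> (B \<otimes> K))"
    using Assoc_in [of A B K] by (auto simp: hom_iff elim: isomorphismE)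
  then have [simp]: "ai \<in> Arr M" "Dom M ai = A \<otimes> (B \<otimes> K)" "Cod M ai = A \<otimes> B \<otimes> K"
    by (auto simp: hom_iff)
  define x where "x = ai \<cdot> (A \<lhd> n) \<cdot> e"
  have [simp]: "x \<in> Arr M" "Dom M x = BCar (V \<box> W)" "Cod M x = A \<otimes> B \<otimes> K"
    by (auto simp: x_def)
  have x: "\<a> A B K \<cdot> x = (A \<lhd> n) \<cdot> e"
    using Comp_tail [OF ai, of "(A \<lhd> n) \<cdot> e"] by (simp add: x_def)
  have "((\<a> A K B \<cdot> (r \<rhd> B)) \<rhd> K) \<cdot> x = (A \<lhd> m \<rhd> K) \<cdot> x"
  proof (rule monomorphismD [where X = "BCar (V \<box> W)"])
    \<comment> \<open>These associators take the common codomain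
      \<open>A \<otimes> (K \<otimes> B) \<otimes> K\<close> to
      \<open>A \<otimes> (K \<otimes> (B \<otimes> K))\<close>, where the pentagon applies.\<close>
    show "monomorphism M ((A \<lhd> \<a> K B K) \<cdot> \<a> A (K \<otimes> B) K)"
      by (intro monomorphism_Comp monomorphism_Ide_TensorA Assoc_monomorphism) auto
    have "(A \<lhd> \<a> K B K) \<cdot> \<a> A (K \<otimes> B) K \<cdot> ((\<a> A K B \<cdot> (r \<rhd> B)) \<rhd> K) \<cdot> x
      = \<a> A K (B \<otimes> K) \<cdot> \<a> (A \<otimes> K) B K \<cdot> (r \<rhd> B \<rhd> K) \<cdot> x"
      by (simp add: pentagon_whisker_tail)
    also have "\<dots> = \<a> A K (B \<otimes> K) \<cdot> (r \<rhd> (B \<otimes> K)) \<cdot> \<a> A B K \<cdot> x"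
      by (simp add: Assoc_right)
    also have "\<dots> = \<a> A K (B \<otimes> K) \<cdot> ((A \<otimes> K) \<lhd> n) \<cdot> (r \<rhd> B) \<cdot> e"
      by (simp add: x merge)
    also have "\<dots> = (A \<lhd> (K \<lhd> n)) \<cdot> \<a> A K B \<cdot> (r \<rhd> B) \<cdot> e"
      by (simp add: Assoc_right)
    also have "\<dots> = (A \<lhd> ((K \<lhd> n) \<cdot> m)) \<cdot> e"
      using inc_eq [OF V W] by (simp add: defs [symmetric] merge)
    also have "\<dots> = (A \<lhd> (\<a> K B K \<cdot> (m \<rhd> K) \<cdot> n)) \<cdot> e"
      using LCo_RCo [OF W] by (simp add: defs)
    also have "\<dots> = (A \<lhd> \<a> K B K) \<cdot> (A \<lhd> (m \<rhd> K)) \<cdot> \<a> A B K \<cdot> x"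
      by (simp add: x merge)
    also have "\<dots> = (A \<lhd> \<a> K B K) \<cdot> \<a> A (K \<otimes> B) K \<cdot> (A \<lhd> m \<rhd> K) \<cdot> x"
      by (simp add: Assoc_left)
    finally show "((A \<lhd> \<a> K B K) \<cdot> \<a> A (K \<otimes> B) K) \<cdot> ((\<a> A K B \<cdot> (r \<rhd> B)) \<rhd> K) \<cdot> x
      = ((A \<lhd> \<a> K B K) \<cdot> \<a> A (K \<otimes> B) K) \<cdot> (A \<lhd> m \<rhd> K) \<cdot> x"
      by simp
  qed (auto simp: hom_iff)
  moreover have "x \<in> hom M (BCar (V \<box> W)) (Cod M (e \<rhd> K))"
    by (simp add: hom_iff)
  ultimately obtain u where u: "u \<in> hom M (BCar (V \<box> W)) (Dom M (e \<rhd> K))" "(e \<rhd> K) \<cdot> u = x"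
    using is_equalizer_factor [OF is_equalizer_TensorA_Ide [OF inc_equalizer [OF V W] Car_Obj]]
    unfolding defs [symmetric] by metis
  then show ?thesis
    using x unfolding defs [symmetric] by (intro bexI [of _ u]) auto
qed

text \<open>The description in \<open>cotensor\<close> is well posed: uniqueness holds because
  tensoring keeps \<open>inc V W\<close> monic. The same reasoning serves the right
  coaction.\<close>

lemma LCo_cotensor:
  shows LCo_cotensor_in: "LCo (V \<box> W) \<in> hom M (BCar (V \<box> W)) (K \<otimes> BCar (V \<box> W))"
    and inc_LCo: "(K \<lhd> inc V W) \<cdot> LCo (V \<box> W) =
      \<a> K (BCar V) (BCar W) \<cdot> (LCo V \<rhd> BCar W) \<cdot> inc V W"
proof -
  let ?P = "\<lambda>l. l \<in> hom M (BCar (V \<box> W)) (K \<otimes> BCar (V \<box> W)) \<and> (K \<lhd> inc V W) \<cdot> l =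
      \<a> K (BCar V) (BCar W) \<cdot> (LCo V \<rhd> BCar W) \<cdot> inc V W"
  have "l = l'" if "?P l" "?P l'" for l l'
    by (rule monomorphismD [OF monomorphism_Ide_TensorA [OF inc_monomorphism [OF V W] Car_Obj],
          where X = "BCar (V \<box> W)"]) (use that in \<open>simp_all add: hom_iff\<close>)
  then have "\<exists>!l. ?P l"
    using LCo_cotensor_ex [OF V W] by blast
  then have "?P (THE l. ?P l)"
    by (rule theI')
  moreover have "(THE l. ?P l) = LCo (V \<box> W)"
    unfolding cotensor_def Let_def by simp
  ultimately have "?P (LCo (V \<box> W))"
    by (rule back_subst [where P = ?P])
  then show "LCo (V \<box> W) \<in> hom M (BCar (V \<box> W)) (K \<otimes> BCar (V \<box> W))"
    "(K \<lhd> inc V W) \<cdot> LCo (V \<box> W) =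
      \<a> K (BCar V) (BCar W) \<cdot> (LCo V \<rhd> BCar W) \<cdot> inc V W"
    by auto
qed

lemma RCo_cotensor:
  shows RCo_cotensor_in: "RCo (V \<box> W) \<in> hom M (BCar (V \<box> W)) (BCar (V \<box> W) \<otimes> K)"
    and inc_RCo: "\<a> (BCar V) (BCar W) K \<cdot> (inc V W \<rhd> K) \<cdot> RCo (V \<box> W) =
      (BCar V \<lhd> RCo W) \<cdot> inc V W"
proof -
  let ?P = "\<lambda>r. r \<in> hom M (BCar (V \<box> W)) (BCar (V \<box> W) \<otimes> K) \<and>
      \<a> (BCar V) (BCar W) K \<cdot> (inc V W \<rhd> K) \<cdot> r = (BCar V \<lhd> RCo W) \<cdot> inc V W"
  have "r = r'" if "?P r" "?P r'" for r r'
  proof (rule monomorphismD [where X = "BCar (V \<box> W)"])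
    show "monomorphism M (\<a> (BCar V) (BCar W) K \<cdot> (inc V W \<rhd> K))"
      by (intro monomorphism_Comp Assoc_monomorphism monomorphism_TensorA_Ide inc_monomorphism) auto
  qed (use that in \<open>auto simp: hom_iff\<close>)
  then have "\<exists>!r. ?P r"
    using RCo_cotensor_ex by blast
  then have "?P (THE r. ?P r)"
    by (rule theI')
  moreover have "(THE r. ?P r) = RCo (V \<box> W)"
    unfolding cotensor_def Let_def by simp
  ultimately have "?P (RCo (V \<box> W))"
    by (rule back_subst [where P = ?P])
  then show "RCo (V \<box> W) \<in> hom M (BCar (V \<box> W)) (BCar (V \<box> W) \<otimes> K)"
    "\<a> (BCar V) (BCar W) K \<cdot> (inc V W \<rhd> K) \<cdot> RCo (V \<box> W) =
      (BCar V \<lhd> RCo W) \<cdot> inc V W"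
    by auto
qed

text \<open>Each law is tested behind a tensored inclusion. There the left law becomes that of
  \<open>V\<close> and the right law that of \<open>W\<close>, while the mixed law is the
  interchange of maps acting on different factors.\<close>

lemma bicomod_cotensor: "bicomod (V \<box> W)"
proof -
  define A B E l m r n L R e where "A = BCar V" "B = BCar W" "E = BCar (V \<box> W)" "l = LCo V" "m = LCo W"
    "r = RCo V" "n = RCo W" "L = LCo (V \<box> W)" "R = RCo (V \<box> W)" "e = inc V W"
  note defs = this
  have [simp]: "A \<in> Obj M" "B \<in> Obj M" "E \<in> Obj M" "n \<in> Arr M" "Dom M n = B" "Cod M n = B \<otimes> K"
    "l \<in> Arr M" "Dom M l = A" "Cod M l = K \<otimes> A"
    "r \<in> Arr M" "Dom M r = A" "Cod M r = A \<otimes> K" "m \<in> Arr M" "Dom M m = B" "Cod M m = K \<otimes> B"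
    "e \<in> Arr M" "Dom M e = E" "Cod M e = A \<otimes> B"
    "L \<in> Arr M" "Dom M L = E" "Cod M L = K \<otimes> E" "R \<in> Arr M" "Dom M R = E" "Cod M R = E \<otimes> K"
    using LCo_cotensor_in RCo_cotensor_in by (auto simp: defs hom_iff)
  note L = inc_LCo [folded defs] and R = inc_RCo [folded defs]
  note lr = bicomod_coassoc [OF V, folded defs] and mn = bicomod_coassoc [OF W, folded defs]
  have e: "monomorphism M e"
    unfolding defs by (rule inc_monomorphism) auto
  have 1: "\<a> K K E \<cdot> (Comult D \<rhd> E) \<cdot> L = (K \<lhd> L) \<cdot> L"
  proof (rule monomorphismD [where X = E])
    show "monomorphism M (K \<lhd> (K \<lhd> e))"
      using e by (intro monomorphism_Ide_TensorA) auto
    have "(K \<lhd> (K \<lhd> e)) \<cdot> \<a> K K E \<cdot> (Comult D \<rhd> E) \<cdot> L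
      = \<a> K K (A \<otimes> B) \<cdot> (Comult D \<rhd> (A \<otimes> B)) \<cdot> (K \<lhd> e) \<cdot> L" (is "?l = _")
      by (simp add: Assoc_left merge)
    also have "\<dots> = \<a> K K (A \<otimes> B) \<cdot> (Comult D \<rhd> (A \<otimes> B)) \<cdot> \<a> K A B \<cdot> (l \<rhd> B) \<cdot> e"
      by (simp add: L)
    also have "\<dots> = \<a> K K (A \<otimes> B) \<cdot> \<a> (K \<otimes> K) A B \<cdot> (((Comult D \<rhd> A) \<cdot> l) \<rhd> B) \<cdot> e"
      by (simp add: Assoc_left merge)
    also have "\<dots> = (K \<lhd> \<a> K A B) \<cdot> \<a> K (K \<otimes> A) B
        \<cdot> ((\<a> K K A \<cdot> (Comult D \<rhd> A) \<cdot> l) \<rhd> B) \<cdot> e"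
      by (simp add: pentagon_whisker_tail)
    also have "\<dots> = (K \<lhd> \<a> K A B) \<cdot> \<a> K (K \<otimes> A) B
        \<cdot> (K \<lhd> l \<rhd> B) \<cdot> (l \<rhd> B) \<cdot> e"
      by (simp add: lr(1) merge)
    also have "\<dots> = (K \<lhd> \<a> K A B) \<cdot> (K \<lhd> (l \<rhd> B)) \<cdot> (K \<lhd> e) \<cdot> L"
      by (simp add: Assoc_right L)
    also have "\<dots> = (K \<lhd> (\<a> K A B \<cdot> (l \<rhd> B) \<cdot> e)) \<cdot> L"
      by (simp add: merge)
    also have "\<dots> = (K \<lhd> ((K \<lhd> e) \<cdot> L)) \<cdot> L"
      by (simp add: L)
    also have "\<dots> = (K \<lhd> (K \<lhd> e)) \<cdot> (K \<lhd> L) \<cdot> L" (is "_ = ?r")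
      by (simp add: merge)
    finally show "?l = ?r" .
  qed (auto simp: hom_iff)
  have 2: "\<a> E K K \<cdot> (R \<rhd> K) \<cdot> R = (E \<lhd> Comult D) \<cdot> R"
  proof (rule monomorphismD [where X = E])
    show "monomorphism M (\<a> A B (K \<otimes> K) \<cdot> (e \<rhd> (K \<otimes> K)))"
      using e by (intro monomorphism_Comp Assoc_monomorphism monomorphism_TensorA_Ide) auto
    have "\<a> A B (K \<otimes> K) \<cdot> (e \<rhd> (K \<otimes> K)) \<cdot> \<a> E K K \<cdot> (R \<rhd> K) \<cdot> R
      = \<a> A B (K \<otimes> K) \<cdot> \<a> (A \<otimes> B) K K \<cdot> (((e \<rhd> K) \<cdot> R) \<rhd> K) \<cdot> R"
      by (simp add: Assoc_left merge)
    also have "\<dots> = (A \<lhd> \<a> B K K) \<cdot> \<a> A (B \<otimes> K) K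
        \<cdot> ((\<a> A B K \<cdot> (e \<rhd> K) \<cdot> R) \<rhd> K) \<cdot> R"
      by (simp add: pentagon_whisker_tail)
    also have "\<dots> = (A \<lhd> \<a> B K K) \<cdot> \<a> A (B \<otimes> K) K
        \<cdot> (A \<lhd> n \<rhd> K) \<cdot> (e \<rhd> K) \<cdot> R"
      by (simp add: R merge)
    also have "\<dots> = (A \<lhd> \<a> B K K) \<cdot> (A \<lhd> (n \<rhd> K)) \<cdot> (A \<lhd> n) \<cdot> e"
      by (simp add: R Assoc_right)
    also have "\<dots> = (A \<lhd> (B \<lhd> Comult D)) \<cdot> (A \<lhd> n) \<cdot> e"
      by (simp add: merge mn(2))
    also have "\<dots> = (A \<lhd> (B \<lhd> Comult D)) \<cdot> \<a> A B K \<cdot> (e \<rhd> K) \<cdot> R"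
      by (simp add: R)
    also have "\<dots> = \<a> A B (K \<otimes> K) \<cdot> (e \<rhd> (K \<otimes> K)) \<cdot> (E \<lhd> Comult D) \<cdot> R"
      by (simp add: Assoc_left merge)
    finally show "(\<a> A B (K \<otimes> K) \<cdot> (e \<rhd> (K \<otimes> K))) \<cdot> \<a> E K K \<cdot> (R \<rhd> K) \<cdot> R
      = (\<a> A B (K \<otimes> K) \<cdot> (e \<rhd> (K \<otimes> K))) \<cdot> (E \<lhd> Comult D) \<cdot> R"
      by simp
  qed (auto simp: hom_iff)
  have 3: "\<a> K E K \<cdot> (L \<rhd> K) \<cdot> R = (K \<lhd> R) \<cdot> L"
  proof (rule monomorphismD [where X = E])
    show "monomorphism M ((K \<lhd> \<a> A B K) \<cdot> (K \<lhd> (e \<rhd> K)))"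
      using e by (intro monomorphism_Comp Assoc_monomorphism monomorphism_TensorA_Ide monomorphism_Ide_TensorA) auto
    have "(K \<lhd> \<a> A B K) \<cdot> (K \<lhd> (e \<rhd> K)) \<cdot> \<a> K E K \<cdot> (L \<rhd> K) \<cdot> R
      = (K \<lhd> \<a> A B K) \<cdot> \<a> K (A \<otimes> B) K \<cdot> (((K \<lhd> e) \<cdot> L) \<rhd> K) \<cdot> R"
      by (simp add: Assoc_left merge_tensor_tail)
    also have "\<dots> = \<a> K A (B \<otimes> K) \<cdot> \<a> (K \<otimes> A) B K \<cdot> (l \<rhd> B \<rhd> K) \<cdot> (e \<rhd> K) \<cdot> R"
      by (simp add: L pentagon_whisker_tail merge)
    also have "\<dots> = \<a> K A (B \<otimes> K) \<cdot> (l \<rhd> (B \<otimes> K)) \<cdot> \<a> A B K \<cdot> (e \<rhd> K) \<cdot> R"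
      by (simp add: Assoc_right)
    also have "\<dots> = \<a> K A (B \<otimes> K) \<cdot> ((K \<otimes> A) \<lhd> n) \<cdot> (l \<rhd> B) \<cdot> e"
      by (simp add: R merge)
    also have "\<dots> = (K \<lhd> (A \<lhd> n)) \<cdot> (K \<lhd> e) \<cdot> L"
      by (simp add: Assoc_right L)
    also have "\<dots> = (K \<lhd> (\<a> A B K \<cdot> (e \<rhd> K) \<cdot> R)) \<cdot> L"
      by (simp add: R merge)
    also have "\<dots> = (K \<lhd> \<a> A B K) \<cdot> (K \<lhd> (e \<rhd> K)) \<cdot> (K \<lhd> R) \<cdot> L"
      by (simp add: merge)
    finally show "((K \<lhd> \<a> A B K) \<cdot> (K \<lhd> (e \<rhd> K))) \<cdot> \<a> K E K \<cdot> (L \<rhd> K) \<cdot> R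
      = ((K \<lhd> \<a> A B K) \<cdot> (K \<lhd> (e \<rhd> K))) \<cdot> (K \<lhd> R) \<cdot> L"
      by simp
  qed (auto simp: hom_iff)
  show ?thesis
    unfolding bicomod_def bicomodule_on_def using 1 2 3 by (simp add: defs [symmetric] hom_iff)
qed

end

text \<open>\<open>f \<boxtimes> g\<close> preserves the equalizing condition because
  \<open>f\<close> respects the right coactions and \<open>g\<close> the left ones, which are the
  two that the cotensor product equalizes.\<close>

lemma cotensor_arr:
  assumes [simp]: "bicomod V" "bicomod W" "bicomod V'" "bicomod W'"
    and f: "rcolin V V' f" and g: "lcolin W W' g"
  shows cotensor_arr_in: "cotensor_arr M D V W V' W' f g \<in> hom M (BCar (V \<box> W)) (BCar (V' \<box> W'))"
    and inc_cotensor_arr: "inc V' W' \<cdot> cotensor_arr M D V W V' W' f g = (f \<boxtimes> g) \<cdot> inc V W"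
proof -
  have [simp]: "f \<in> Arr M" "Dom M f = BCar V" "Cod M f = BCar V'" "g \<in> Arr M" "Dom M g = BCar W" "Cod M g = BCar W'"
    using f g by (auto simp: rcolin_def lcolin_def hom_iff)
  have "\<a> (BCar V') K (BCar W') \<cdot> (RCo V' \<rhd> BCar W') \<cdot> (f \<boxtimes> g) \<cdot> inc V W
    = \<a> (BCar V') K (BCar W') \<cdot> ((RCo V' \<cdot> f) \<boxtimes> g) \<cdot> inc V W" (is "?l = _")
    by (simp add: merge)
  also have "\<dots> = \<a> (BCar V') K (BCar W') \<cdot> (f \<rhd> K \<boxtimes> g) \<cdot> (RCo V \<rhd> BCar W) \<cdot> inc V W"
    using f by (simp add: rcolin_def merge)
  also have "\<dots> = (f \<boxtimes> (K \<lhd> g)) \<cdot> (BCar V \<lhd> LCo W) \<cdot> inc V W"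
    by (simp add: Assoc_right inc_eq)
  also have "\<dots> = (BCar V' \<lhd> LCo W') \<cdot> (f \<boxtimes> g) \<cdot> inc V W" (is "_ = ?r")
    using g by (simp add: lcolin_def merge)
  finally have "?l = ?r" .
  then show "cotensor_arr M D V W V' W' f g \<in> hom M (BCar (V \<box> W)) (BCar (V' \<box> W'))"
    "inc V' W' \<cdot> cotensor_arr M D V W V' W' f g = (f \<boxtimes> g) \<cdot> inc V W"
    unfolding cotensor_arr_def
    using cotensor_lift [of V' W' "(f \<boxtimes> g) \<cdot> inc V W" "BCar (V \<box> W)"] by (auto simp: hom_iff)
qed

text \<open>Right colinearity into a cotensor product can be tested in the tensor product, since
  \<open>inc V W\<close> stays monic after tensoring with \<open>K\<close>.\<close>

lemma rcolin_through:
  assumes [simp]: "bicomod V" "bicomod W" "bicomod U" and k: "k \<in> hom M (BCar U) (BCar (V \<box> W))"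
    and eq: "(BCar V \<lhd> RCo W) \<cdot> inc V W \<cdot> k =
      \<a> (BCar V) (BCar W) K \<cdot> ((inc V W \<cdot> k) \<rhd> K) \<cdot> RCo U"
  shows "rcolin U (V \<box> W) k"
proof -
  note [simp] = bicomod_cotensor
  have [simp]: "k \<in> Arr M" "Dom M k = BCar U" "Cod M k = BCar (V \<box> W)"
    using k by (auto simp: hom_iff)
  have "RCo (V \<box> W) \<cdot> k = (k \<rhd> K) \<cdot> RCo U"
  proof (rule monomorphismD [where X = "BCar U"])
    show "monomorphism M (\<a> (BCar V) (BCar W) K \<cdot> (inc V W \<rhd> K))"
      by (intro monomorphism_Comp Assoc_monomorphism monomorphism_TensorA_Ide inc_monomorphism) auto
    have "(\<a> (BCar V) (BCar W) K \<cdot> (inc V W \<rhd> K) \<cdot> RCo (V \<box> W)) \<cdot> k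
      = (BCar V \<lhd> RCo W) \<cdot> inc V W \<cdot> k"
      by (simp add: inc_RCo)
    then show "(\<a> (BCar V) (BCar W) K \<cdot> (inc V W \<rhd> K)) \<cdot> RCo (V \<box> W) \<cdot> k
      = (\<a> (BCar V) (BCar W) K \<cdot> (inc V W \<rhd> K)) \<cdot> (k \<rhd> K) \<cdot> RCo U"
      by (simp add: eq merge)
  qed (auto simp: hom_iff)
  then show ?thesis
    using k by (simp add: rcolin_def)
qed

lemma rcolin_cotensor_arr:
  assumes [simp]: "bicomod V" "bicomod W" "bicomod V'" "bicomod W'"
    and f: "rcolin V V' f" and g: "lcolin W W' g" and g': "rcolin W W' g"
  shows "rcolin (V \<box> W) (V' \<box> W') (cotensor_arr M D V W V' W' f g)"
proof (rule rcolin_through)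
  note [simp] = bicomod_cotensor
  have [simp]: "f \<in> Arr M" "Dom M f = BCar V" "Cod M f = BCar V'" "g \<in> Arr M" "Dom M g = BCar W" "Cod M g = BCar W'"
    using f g by (auto simp: rcolin_def lcolin_def hom_iff)
  note k = cotensor_arr [OF assms(1-4) f g]
  have "(BCar V' \<lhd> RCo W') \<cdot> (f \<boxtimes> g) \<cdot> inc V W = (f \<boxtimes> (g \<rhd> K)) \<cdot> (BCar V \<lhd> RCo W) \<cdot> inc V W"
    using g' by (simp add: merge rcolin_def)
  also have "\<dots> = (f \<boxtimes> (g \<rhd> K)) \<cdot> \<a> (BCar V) (BCar W) K \<cdot> (inc V W \<rhd> K) \<cdot> RCo (V \<box> W)"
    by (simp add: inc_RCo)
  also have "\<dots> = \<a> (BCar V') (BCar W') K \<cdot> (((f \<boxtimes> g) \<cdot> inc V W) \<rhd> K) \<cdot> RCo (V \<box> W)"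
    by (simp add: Assoc_left merge)
  finally show "(BCar V' \<lhd> RCo W') \<cdot> inc V' W' \<cdot> cotensor_arr M D V W V' W' f g
    = \<a> (BCar V') (BCar W') K \<cdot> ((inc V' W' \<cdot> cotensor_arr M D V W V' W' f g) \<rhd> K) \<cdot> RCo (V \<box> W)"
    by (simp add: k)
  show "cotensor_arr M D V W V' W' f g \<in> hom M (BCar (V \<box> W)) (BCar (V' \<box> W'))"
    by (rule k)
qed (auto simp: bicomod_cotensor)

text \<open>Coassociativity followed by an arrow on each of the three tensor factors. Inserting
  identities, projections or a coalgebra homomorphism yields most identities used later.\<close>

lemma coassoc_map:
  assumes "f \<in> Arr M" "Dom M f = K" "g \<in> Arr M" "Dom M g = K" "h \<in> Arr M" "Dom M h = K"
  shows "\<a> (Cod M f) (Cod M g) (Cod M h) \<cdot> (((f \<boxtimes> g) \<cdot> Comult D) \<boxtimes> h) \<cdot> Comult D =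
    (f \<boxtimes> ((g \<boxtimes> h) \<cdot> Comult D)) \<cdot> Comult D"
proof -
  have "\<a> (Cod M f) (Cod M g) (Cod M h) \<cdot> (((f \<boxtimes> g) \<cdot> Comult D) \<boxtimes> h) \<cdot> Comult D
    = \<a> (Cod M f) (Cod M g) (Cod M h) \<cdot> (f \<boxtimes> g \<boxtimes> h) \<cdot> (Comult D \<rhd> K) \<cdot> Comult D"
    using assms by (simp add: merge)
  also have "\<dots> = (f \<boxtimes> (g \<boxtimes> h)) \<cdot> (K \<lhd> Comult D) \<cdot> Comult D"
    using assms coassoc by (simp add: Assoc_right)
  also have "\<dots> = (f \<boxtimes> ((g \<boxtimes> h) \<cdot> Comult D)) \<cdot> Comult D"
    using assms by (simp add: merge)
  finally show ?thesis .
qed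

section \<open>The associativity constraint of the cotensor product\<close>

context
  fixes V W U :: "('o, 'm) bicomodule"
  assumes V [simp]: "bicomod V" and W [simp]: "bicomod W" and U [simp]: "bicomod U"
begin

text \<open>Two factorizations are needed. The first, through
  \<open>BCar V \<otimes> BCar (W \<box> U)\<close>, uses that the right coaction of
  \<open>V \<box> W\<close> is that of \<open>W\<close>. The second, through
  \<open>V \<box> (W \<box> U)\<close>, reduces behind a monic to the equalizing condition of
  \<open>V \<box> W\<close>.\<close>

lemma cotensor_assoc_ex:
  "\<exists>a \<in> hom M (BCar (V \<box> W \<box> U)) (BCar (V \<box> (W \<box> U))).
     (BCar V \<lhd> inc W U) \<cdot> inc V (W \<box> U) \<cdot> a =
       \<a> (BCar V) (BCar W) (BCar U) \<cdot> (inc V W \<rhd> BCar U) \<cdot> inc (V \<box> W) U"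
proof -
  note [simp] = bicomod_cotensor
  define A B G E F H r m n q L R e f h where "A = BCar V" "B = BCar W" "G = BCar U"
    "E = BCar (V \<box> W)" "F = BCar (W \<box> U)" "H = BCar (V \<box> W \<box> U)" "r = RCo V" "m = LCo W"
    "n = RCo W" "q = LCo U" "L = LCo (W \<box> U)" "R = RCo (V \<box> W)" "e = inc V W" "f = inc W U"
    "h = inc (V \<box> W) U"
  note defs = this
  have [simp]: "A \<in> Obj M" "B \<in> Obj M" "G \<in> Obj M" "E \<in> Obj M" "F \<in> Obj M" "H \<in> Obj M"
    "n \<in> Arr M" "Dom M n = B" "Cod M n = B \<otimes> K" "r \<in> Arr M" "Dom M r = A" "Cod M r = A \<otimes> K"
    "m \<in> Arr M" "Dom M m = B" "Cod M m = K \<otimes> B" "q \<in> Arr M" "Dom M q = G" "Cod M q = K \<otimes> G"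
    "e \<in> Arr M" "Dom M e = E" "Cod M e = A \<otimes> B" "f \<in> Arr M" "Dom M f = F" "Cod M f = B \<otimes> G"
    "h \<in> Arr M" "Dom M h = H" "Cod M h = E \<otimes> G"
    "L \<in> Arr M" "Dom M L = F" "Cod M L = K \<otimes> F" "R \<in> Arr M" "Dom M R = E" "Cod M R = E \<otimes> K"
    by (auto simp: defs)
  define x where "x = \<a> A B G \<cdot> (e \<rhd> G) \<cdot> h"
  have [simp]: "x \<in> Arr M" "Dom M x = H" "Cod M x = A \<otimes> (B \<otimes> G)"
    by (auto simp: x_def)
  have "(A \<lhd> (\<a> B K G \<cdot> (n \<rhd> G))) \<cdot> x
    = (A \<lhd> \<a> B K G) \<cdot> (A \<lhd> (n \<rhd> G)) \<cdot> \<a> A B G \<cdot> (e \<rhd> G) \<cdot> h" (is "?l = _")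
    by (simp add: merge x_def)
  also have "\<dots> = (A \<lhd> \<a> B K G) \<cdot> \<a> A (B \<otimes> K) G \<cdot> (((A \<lhd> n) \<cdot> e) \<rhd> G) \<cdot> h"
    by (simp add: Assoc_left merge)
  also have "\<dots> = (A \<lhd> \<a> B K G) \<cdot> \<a> A (B \<otimes> K) G
      \<cdot> ((\<a> A B K \<cdot> (e \<rhd> K) \<cdot> R) \<rhd> G) \<cdot> h"
    using inc_RCo [OF V W] by (simp add: defs)
  also have "\<dots> = \<a> A B (K \<otimes> G) \<cdot> \<a> (A \<otimes> B) K G \<cdot> (e \<rhd> K \<rhd> G) \<cdot> (R \<rhd> G) \<cdot> h"
    by (simp add: pentagon_whisker_tail merge)
  also have "\<dots> = \<a> A B (K \<otimes> G) \<cdot> (e \<rhd> (K \<otimes> G)) \<cdot> (E \<lhd> q) \<cdot> h"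
    using inc_eq [of "V \<box> W" U, folded defs] by (simp add: Assoc_right)
  also have "\<dots> = (A \<lhd> (B \<lhd> q)) \<cdot> x" (is "_ = ?r")
    by (simp add: x_def Assoc_left merge)
  finally have "?l = ?r" .
  moreover have "x \<in> hom M H (Cod M (A \<lhd> f))"
    by (simp add: hom_iff)
  moreover have A: "A \<in> Obj M"
    by simp
  ultimately obtain y where "y \<in> hom M H (Dom M (A \<lhd> f))" and y: "(A \<lhd> f) \<cdot> y = x"
    using is_equalizer_factor [OF is_equalizer_Ide_TensorA [OF inc_equalizer [OF W U] A]]
    unfolding defs [symmetric] by metis
  then have [simp]: "y \<in> Arr M" "Dom M y = H" "Cod M y = A \<otimes> F"
    by (auto simp: hom_iff)
  have "\<a> A K F \<cdot> (r \<rhd> F) \<cdot> y = (A \<lhd> L) \<cdot> y"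
  proof (rule monomorphismD [where X = H])
    show "monomorphism M (A \<lhd> (K \<lhd> f))"
      unfolding defs by (intro monomorphism_Ide_TensorA inc_monomorphism) auto
    have "(A \<lhd> (K \<lhd> f)) \<cdot> (A \<lhd> L) \<cdot> y
      = (A \<lhd> (\<a> K B G \<cdot> (m \<rhd> G) \<cdot> f)) \<cdot> y"
      using inc_LCo [OF W U, folded defs] by (simp add: merge)
    also have "\<dots> = (A \<lhd> \<a> K B G) \<cdot> (A \<lhd> (m \<rhd> G)) \<cdot> x"
      by (simp add: merge y [symmetric])
    also have "\<dots> = (A \<lhd> \<a> K B G) \<cdot> \<a> A (K \<otimes> B) G \<cdot> (((A \<lhd> m) \<cdot> e) \<rhd> G) \<cdot> h"
      by (simp add: x_def Assoc_left merge)
    also have "\<dots> = (A \<lhd> \<a> K B G) \<cdot> \<a> A (K \<otimes> B) G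
        \<cdot> ((\<a> A K B \<cdot> (r \<rhd> B) \<cdot> e) \<rhd> G) \<cdot> h"
      using inc_eq [OF V W] by (simp add: defs)
    also have "\<dots> = \<a> A K (B \<otimes> G) \<cdot> \<a> (A \<otimes> K) B G \<cdot> (r \<rhd> B \<rhd> G) \<cdot> (e \<rhd> G) \<cdot> h"
      by (simp add: pentagon_whisker_tail merge)
    also have "\<dots> = \<a> A K (B \<otimes> G) \<cdot> (r \<rhd> (B \<otimes> G)) \<cdot> (A \<lhd> f) \<cdot> y"
      unfolding y x_def by (simp add: Assoc_right)
    also have "\<dots> = (A \<lhd> (K \<lhd> f)) \<cdot> \<a> A K F \<cdot> (r \<rhd> F) \<cdot> y"
      by (simp add: Assoc_left merge)
    finally show "(A \<lhd> (K \<lhd> f)) \<cdot> \<a> A K F \<cdot> (r \<rhd> F) \<cdot> y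
      = (A \<lhd> (K \<lhd> f)) \<cdot> (A \<lhd> L) \<cdot> y" ..
  qed (auto simp: hom_iff)
  then obtain a where "a \<in> hom M H (BCar (V \<box> (W \<box> U)))" "inc V (W \<box> U) \<cdot> a = y"
    using inc_factor [of V "W \<box> U" y H] by (auto simp: hom_iff defs)
  then show ?thesis
    using y unfolding x_def defs by auto
qed

lemma cotensor_assoc:
  shows cotensor_assoc_in: "cotensor_assoc M D V W U \<in> hom M (BCar (V \<box> W \<box> U)) (BCar (V \<box> (W \<box> U)))"
    and inc_cotensor_assoc: "(BCar V \<lhd> inc W U) \<cdot> inc V (W \<box> U) \<cdot> cotensor_assoc M D V W U =
       \<a> (BCar V) (BCar W) (BCar U) \<cdot> (inc V W \<rhd> BCar U) \<cdot> inc (V \<box> W) U"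
proof -
  note [simp] = bicomod_cotensor
  let ?P = "\<lambda>a. a \<in> hom M (BCar (V \<box> W \<box> U)) (BCar (V \<box> (W \<box> U))) \<and>
     (BCar V \<lhd> inc W U) \<cdot> inc V (W \<box> U) \<cdot> a =
       \<a> (BCar V) (BCar W) (BCar U) \<cdot> (inc V W \<rhd> BCar U) \<cdot> inc (V \<box> W) U"
  have "a = a'" if "?P a" "?P a'" for a a'
  proof (rule monomorphismD [where X = "BCar (V \<box> W \<box> U)"])
    show "monomorphism M ((BCar V \<lhd> inc W U) \<cdot> inc V (W \<box> U))"
      by (intro monomorphism_Comp monomorphism_Ide_TensorA inc_monomorphism) auto
  qed (use that in \<open>auto simp: hom_iff\<close>)
  then have "\<exists>!a. ?P a"
    using cotensor_assoc_ex by blast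
  then have "?P (THE a. ?P a)"
    by (rule theI')
  then have "?P (cotensor_assoc M D V W U)"
    unfolding cotensor_assoc_def .
  then show "cotensor_assoc M D V W U \<in> hom M (BCar (V \<box> W \<box> U)) (BCar (V \<box> (W \<box> U)))"
    "(BCar V \<lhd> inc W U) \<cdot> inc V (W \<box> U) \<cdot> cotensor_assoc M D V W U =
       \<a> (BCar V) (BCar W) (BCar U) \<cdot> (inc V W \<rhd> BCar U) \<cdot> inc (V \<box> W) U"
    by auto
qed

text \<open>Keeps the splitting maps of cotensor powers right colinear, so that they can again be
  cotensored with a bicomodule on the right.\<close>

lemma rcolin_cotensor_assoc: "rcolin (V \<box> W \<box> U) (V \<box> (W \<box> U)) (cotensor_assoc M D V W U)"
proof (rule rcolin_through)
  note [simp] = bicomod_cotensor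
  define A B G E F H p Q R R' e f g h a where "A = BCar V" "B = BCar W" "G = BCar U"
    "E = BCar (V \<box> W)" "F = BCar (W \<box> U)" "H = BCar (V \<box> W \<box> U)" "p = RCo U"
    "Q = BCar (V \<box> (W \<box> U))" "R = RCo (W \<box> U)" "R' = RCo (V \<box> W \<box> U)"
    "e = inc V W" "f = inc W U" "g = inc V (W \<box> U)" "h = inc (V \<box> W) U" "a = cotensor_assoc M D V W U"
  note defs = this
  have [simp]: "A \<in> Obj M" "B \<in> Obj M" "G \<in> Obj M" "E \<in> Obj M" "F \<in> Obj M" "H \<in> Obj M"
    "p \<in> Arr M" "Dom M p = G" "Cod M p = G \<otimes> K"
    "e \<in> Arr M" "Dom M e = E" "Cod M e = A \<otimes> B" "f \<in> Arr M" "Dom M f = F" "Cod M f = B \<otimes> G"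
    "h \<in> Arr M" "Dom M h = H" "Cod M h = E \<otimes> G" "g \<in> Arr M" "Dom M g = Q" "Cod M g = A \<otimes> F"
    "R \<in> Arr M" "Dom M R = F" "Cod M R = F \<otimes> K" "R' \<in> Arr M" "Dom M R' = H" "Cod M R' = H \<otimes> K"
    "a \<in> Arr M" "Dom M a = H" "Cod M a = Q"
    using cotensor_assoc_in by (auto simp: defs hom_iff)
  note a = inc_cotensor_assoc [folded defs] and R = inc_RCo [OF W U, folded defs]
    and R' = inc_RCo [of "V \<box> W" U, folded defs]
  have "(A \<lhd> R) \<cdot> g \<cdot> a = \<a> A F K \<cdot> ((g \<cdot> a) \<rhd> K) \<cdot> R'"
  proof (rule monomorphismD [where X = H])
    show "monomorphism M ((A \<lhd> \<a> B G K) \<cdot> (A \<lhd> (f \<rhd> K)))"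
      by (intro monomorphism_Comp monomorphism_Ide_TensorA monomorphism_TensorA_Ide Assoc_monomorphism)
        (auto simp: defs intro: inc_monomorphism)
    have "(A \<lhd> \<a> B G K) \<cdot> (A \<lhd> (f \<rhd> K)) \<cdot> (A \<lhd> R) \<cdot> g \<cdot> a
      = (A \<lhd> (B \<lhd> p)) \<cdot> (A \<lhd> f) \<cdot> g \<cdot> a"
      by (simp add: merge R)
    also have "\<dots> = \<a> A B (G \<otimes> K) \<cdot> (e \<rhd> (G \<otimes> K)) \<cdot> (E \<lhd> p) \<cdot> h"
      by (simp add: a Assoc_left merge)
    also have "\<dots> = \<a> A B (G \<otimes> K) \<cdot> (e \<rhd> (G \<otimes> K)) \<cdot> \<a> E G K \<cdot> (h \<rhd> K) \<cdot> R'"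
      using R' by simp
    also have "\<dots> = \<a> A B (G \<otimes> K) \<cdot> \<a> (A \<otimes> B) G K \<cdot> (((e \<rhd> G) \<cdot> h) \<rhd> K) \<cdot> R'"
      by (simp add: Assoc_left merge)
    also have "\<dots> = (A \<lhd> \<a> B G K) \<cdot> \<a> A (B \<otimes> G) K
        \<cdot> ((\<a> A B G \<cdot> (e \<rhd> G) \<cdot> h) \<rhd> K) \<cdot> R'"
      by (simp add: pentagon_whisker_tail)
    also have "\<dots> = (A \<lhd> \<a> B G K) \<cdot> \<a> A (B \<otimes> G) K
        \<cdot> (A \<lhd> f \<rhd> K) \<cdot> ((g \<cdot> a) \<rhd> K) \<cdot> R'"
      by (simp add: a [symmetric] merge)
    finally show "((A \<lhd> \<a> B G K) \<cdot> (A \<lhd> (f \<rhd> K))) \<cdot> (A \<lhd> R) \<cdot> g \<cdot> a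
      = ((A \<lhd> \<a> B G K) \<cdot> (A \<lhd> (f \<rhd> K))) \<cdot> \<a> A F K \<cdot> ((g \<cdot> a) \<rhd> K) \<cdot> R'"
      by (simp add: Assoc_right)
  qed (auto simp: hom_iff)
  then show "(BCar V \<lhd> RCo (W \<box> U)) \<cdot> inc V (W \<box> U) \<cdot> cotensor_assoc M D V W U
    = \<a> (BCar V) (BCar (W \<box> U)) K \<cdot> ((inc V (W \<box> U) \<cdot> cotensor_assoc M D V W U) \<rhd> K)
      \<cdot> RCo (V \<box> W \<box> U)"
    by (simp add: defs)
qed (auto simp: bicomod_cotensor cotensor_assoc_in)

end

section \<open>Cotensor powers and the components of the cotensor comultiplication\<close>

context
  fixes V :: "('o, 'm) bicomodule"
  assumes V [simp]: "bicomod V"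
begin

abbreviation P where "P n \<equiv> cotensor_pow M D V n"
abbreviation cp where "cp m n \<equiv> cotensor_comult_part M D V m n"
abbreviation Q where "Q n \<equiv> BCar (P n)"
abbreviation J where "J n \<equiv> inc (P n) V"

lemma bicomod_pow [simp]: "bicomod (P n)"
proof -
  have "bicomod (P (Suc n))" for n
    by (induction n) (auto simp: cotensor_pow.simps(3) intro: bicomod_cotensor)
  then show ?thesis
    by (cases n) (auto intro: bicomod_regular)
qed

text \<open>The defining equation used backwards, so that cotensor products fold into powers; the
  unfolding direction was removed from the simpset.\<close>

lemma pow_Suc_Suc [simp]: "P (Suc n) \<box> V = P (Suc (Suc n))"
  by (simp add: cotensor_pow.simps(3))

text \<open>Coassociativity of the coaction makes it factor through the cotensor product, and the
  inclusion then undoes the factorization.\<close>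

lemma cotensor_comult_part_0:
  "cp 0 n = LCo (P n)"
proof -
  have "inc (P 0) (P n) \<cdot> cotensor_lift M D (P 0) (P n) (LCo (P n)) = LCo (P n)"
    by (rule cotensor_lift [where X = "Q n"])
      (use LCo_coassoc [of "P n"] in \<open>auto simp: hom_iff regular_bicomodule_def
        bicomod_regular [unfolded regular_bicomodule_def]\<close>)
  then show ?thesis
    by (simp add: cotensor_comult_part_def)
qed

lemma cotensor_comult_part_Suc_0:
  "cp (Suc m) 0 = RCo (P (Suc m))"
proof -
  have "inc (P (Suc m)) (P 0) \<cdot> cotensor_lift M D (P (Suc m)) (P 0) (RCo (P (Suc m))) = RCo (P (Suc m))"
    by (rule cotensor_lift [where X = "Q (Suc m)"])
      (use RCo_coassoc [of "P (Suc m)"] in \<open>auto simp: hom_iff regular_bicomodule_def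
        bicomod_regular [unfolded regular_bicomodule_def]\<close>)
  then show ?thesis
    by (simp add: cotensor_comult_part_def)
qed

lemma cotensor_comult_part_Suc_1:
  "cp (Suc m) (Suc 0) = J (Suc m)"
  using inc_simps [of "P (Suc m)" V] by (simp add: cotensor_comult_part_def)

text \<open>Right colinearity has to be carried through the induction: the next splitting map is
  formed by cotensoring this one with \<open>V\<close>, which requires it.\<close>

lemma cotensor_pow_split:
  "rcolin (P (Suc m + Suc n)) (P (Suc m) \<box> P (Suc n)) (cotensor_pow_split M D V (Suc m) (Suc n))"
proof (induction n)
  case 0
  then show ?case
    using rcolin_Ide [of "P (Suc (Suc m))"] by simp
next
  case (Suc n)
  show ?case
    using Suc rcolin_Comp [OF rcolin_cotensor_arr [OF _ _ _ _ Suc lcolin_Ide rcolin_Ide]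
       rcolin_cotensor_assoc [of "P (Suc m)" "P (Suc n)" V]]
    by (simp add: bicomod_cotensor)
qed

lemma cotensor_comult_part_in:
  "cp m n \<in> hom M (Q (m + n)) (Q m \<otimes> Q n)"
proof (cases m)
  case 0
  then show ?thesis
    by (simp add: cotensor_comult_part_0 hom_iff regular_bicomodule_def)
next
  case (Suc k)
  show ?thesis
  proof (cases n)
    case 0
    then show ?thesis
      by (simp add: cotensor_comult_part_Suc_0 hom_iff regular_bicomodule_def Suc)
  next
    case (Suc l)
    show ?thesis
      using cotensor_pow_split [of k l] \<open>m = Suc k\<close> Suc
      by (simp add: cotensor_comult_part_def rcolin_def hom_iff)
  qed
qed

lemma cotensor_comult_part_simps [simp]:
  "cp m n \<in> Arr M" "Dom M (cp m n) = Q (m + n)"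
  "Cod M (cp m n) = Q m \<otimes> Q n"
  using cotensor_comult_part_in by (auto simp: hom_iff)

text \<open>As \<open>J k\<close> is the component in degrees (k, 1) for k \<ge> 1, this is
  coassociativity of the cotensor coalgebra in degrees (m + 1, n + 1, 1). It is the recursion of
  \<open>cotensor_pow_split\<close> seen through the inclusions.\<close>

lemma cotensor_comult_part_Suc_Suc:
  "(Q (Suc m) \<lhd> J (Suc n)) \<cdot> cp (Suc m) (Suc (Suc n)) =
   \<a> (Q (Suc m)) (Q (Suc n)) (BCar V) \<cdot>
     (cp (Suc m) (Suc n) \<rhd> BCar V) \<cdot> J (Suc m + Suc n)"
proof -
  define s where "s = cotensor_pow_split M D V (Suc m) (Suc n)"
  define k where "k = cotensor_arr M D (P (Suc m + Suc n)) V (P (Suc m) \<box> P (Suc n)) V s (Ide M (BCar V))"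
  have s: "rcolin (P (Suc m + Suc n)) (P (Suc m) \<box> P (Suc n)) s"
    unfolding s_def by (rule cotensor_pow_split)
  have [simp]: "s \<in> Arr M" "Dom M s = Q (Suc m + Suc n)" "Cod M s = BCar (P (Suc m) \<box> P (Suc n))"
    using s by (auto simp: rcolin_def hom_iff)
  have k: "k \<in> hom M (BCar (P (Suc m + Suc n) \<box> V)) (BCar (P (Suc m) \<box> P (Suc n) \<box> V))"
    "inc (P (Suc m) \<box> P (Suc n)) V \<cdot> k = (s \<rhd> BCar V) \<cdot> J (Suc m + Suc n)"
    unfolding k_def using cotensor_arr [OF _ _ _ _ s lcolin_Ide [OF V]] by (simp_all add: bicomod_cotensor)
  note [simp] = bicomod_cotensor
  define a where "a = cotensor_assoc M D (P (Suc m)) (P (Suc n)) V"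
  have a: "a \<in> hom M (BCar (P (Suc m) \<box> P (Suc n) \<box> V)) (BCar (P (Suc m) \<box> (P (Suc n) \<box> V)))"
    "(Q (Suc m) \<lhd> J (Suc n)) \<cdot> inc (P (Suc m)) (P (Suc n) \<box> V) \<cdot> a =
     \<a> (Q (Suc m)) (Q (Suc n)) (BCar V) \<cdot> (inc (P (Suc m)) (P (Suc n)) \<rhd> BCar V)
       \<cdot> inc (P (Suc m) \<box> P (Suc n)) V"
    unfolding a_def using cotensor_assoc [OF bicomod_pow [of "Suc m"] bicomod_pow [of "Suc n"] V] by simp_all
  have [simp]: "k \<in> Arr M" "Dom M k = BCar (P (Suc (Suc (Suc (m + n)))))" "Cod M k = BCar (P (Suc m) \<box> P (Suc n) \<box> V)"
    "a \<in> Arr M" "Dom M a = BCar (P (Suc m) \<box> P (Suc n) \<box> V)" "Cod M a = BCar (P (Suc m) \<box> P (Suc (Suc n)))"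
    using k a by (auto simp: hom_iff)
  have pow_split: "cotensor_pow_split M D V (Suc m) (Suc (Suc n)) = a \<cdot> k"
    by (simp add: s_def k_def a_def)
  have "(Q (Suc m) \<lhd> J (Suc n)) \<cdot> cp (Suc m) (Suc (Suc n))
    = ((Q (Suc m) \<lhd> J (Suc n)) \<cdot> inc (P (Suc m)) (P (Suc n) \<box> V) \<cdot> a) \<cdot> k"
    by (simp add: cotensor_comult_part_def pow_split del: cotensor_pow_split.simps)
  also have "\<dots> = \<a> (Q (Suc m)) (Q (Suc n)) (BCar V) \<cdot>
     (inc (P (Suc m)) (P (Suc n)) \<rhd> BCar V) \<cdot> (s \<rhd> BCar V) \<cdot> J (Suc m + Suc n)"
    unfolding a(2) using k(2) by simp
  also have "\<dots> = \<a> (Q (Suc m)) (Q (Suc n)) (BCar V) \<cdot>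
     (cp (Suc m) (Suc n) \<rhd> BCar V) \<cdot> J (Suc m + Suc n)"
    by (simp add: merge cotensor_comult_part_def s_def [symmetric])
  finally show ?thesis .
qed

text \<open>By the recursion, the component followed by a whiskered inclusion is a composite of
  monomorphisms, and a right factor of a monomorphism is monic.\<close>

lemma cotensor_comult_part_monomorphism: "monomorphism M (cp (Suc m) (Suc n))"
proof (induction n)
  case 0
  then show ?case
    using inc_monomorphism [of "P (Suc m)" V] by (simp add: cotensor_comult_part_Suc_1)
next
  case (Suc n)
  have "monomorphism M (\<a> (Q (Suc m)) (Q (Suc n)) (BCar V) \<cdot>
     (cp (Suc m) (Suc n) \<rhd> BCar V) \<cdot> J (Suc m + Suc n))"
    by (intro monomorphism_Comp Assoc_monomorphism monomorphism_TensorA_Ide inc_monomorphism Suc) auto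
  then show ?case
    unfolding cotensor_comult_part_Suc_Suc [symmetric] by (rule monomorphism_cancel) simp_all
qed

end

end

section \<open>Morphisms into cotensor powers\<close>

text \<open>The components of a graded coalgebra detached from their direct sum: degree 0 is the
  base coalgebra \<open>D\<close> and degree 1 the bicomodule \<open>V\<close>. Statements about
  components can then be proved without any sums.\<close>

locale comultiplicative_family = coassociative_comultiplication M D
  for M :: "('o, 'm, 'z) monoidal_scheme" (structure) and D :: "('o, 'm, 'y) coalgebra_scheme" +
  fixes X :: "nat \<Rightarrow> 'o" and d :: "nat \<Rightarrow> nat \<Rightarrow> 'm" and V :: "('o, 'm) bicomodule"
  assumes X_0: "X 0 = K" and d_0_0: "d 0 0 = Comult D"
    and X_Obj [simp]: "\<And>n. X n \<in> Obj M"
    and d_in: "\<And>a b. d a b \<in> hom M (X (a + b)) (X a \<otimes> X b)"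
    and d_coassoc: "\<And>a b c. \<a> (X a) (X b) (X c) \<cdot> (d a b \<rhd> X c) \<cdot> d (a + b) c =
      (X a \<lhd> d b c) \<cdot> d a (b + c)"
    and V_def: "V = \<lparr>BCar = X (Suc 0), LCo = d 0 (Suc 0), RCo = d (Suc 0) 0\<rparr>"
begin

lemma d_simps [simp]: "d a b \<in> Arr M" "Dom M (d a b) = X (a + b)" "Cod M (d a b) = X a \<otimes> X b"
  using d_in by (auto simp: hom_iff)

text \<open>The three laws are coassociativity in degrees (0, 0, n), (n, 0, 0) and (0, n,
  0).\<close>

lemma bicomod_piece: "bicomod \<lparr>BCar = X n, LCo = d 0 n, RCo = d n 0\<rparr>"
  using d_coassoc [of 0 0 n] d_coassoc [of n 0 0] d_coassoc [of 0 n 0]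
  by (simp add: bicomod_def bicomodule_on_def hom_iff X_0 [symmetric] d_0_0 [symmetric])

lemma bicomod_V [simp]: "bicomod V"
  unfolding V_def by (rule bicomod_piece)

lemma V_simps: "BCar V = X (Suc 0)" "LCo V = d 0 (Suc 0)" "RCo V = d (Suc 0) 0"
  by (simp_all add: V_def)

end

text \<open>A family known only through its recursion; as the inclusions are monic, the recursion
  pins it down. Existence comes later from the iterated comultiplication.\<close>

locale cotensor_family = comultiplicative_family M D X d V
  for M :: "('o, 'm, 'z) monoidal_scheme" (structure) and D :: "('o, 'm, 'y) coalgebra_scheme"
    and X :: "nat \<Rightarrow> 'o" and d :: "nat \<Rightarrow> nat \<Rightarrow> 'm" and V :: "('o, 'm) bicomodule" +
  fixes \<psi> :: "nat \<Rightarrow> 'm"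
  assumes \<psi>_0: "\<psi> 0 = Ide M (X 0)" and \<psi>_1: "\<psi> (Suc 0) = Ide M (X (Suc 0))"
    and \<psi>_in: "\<And>n. \<psi> n \<in> hom M (X n) (Q V n)"
    and \<psi>_Suc: "\<And>n. J V (Suc n) \<cdot> \<psi> (Suc (Suc n)) = (\<psi> (Suc n) \<rhd> X (Suc 0)) \<cdot> d (Suc n) (Suc 0)"
begin

lemma \<psi>_simps [simp]: "\<psi> a \<in> Arr M" "Dom M (\<psi> a) = X a" "Cod M (\<psi> a) = Q V a"
  using \<psi>_in by (auto simp: hom_iff)

text \<open>The left coaction of a left-bracketed power sits on its first factor, so an induction
  has to reach it; the step is coassociativity in degrees (0, k + 1, 1).\<close>

lemma LCo_\<psi>: "LCo (P V n) \<cdot> \<psi> n = (X 0 \<lhd> \<psi> n) \<cdot> d 0 n"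
proof (cases n)
  case 0
  then show ?thesis
    by (simp add: regular_bicomodule_def \<psi>_0 d_0_0 X_0)
next
  case (Suc k)
  have "LCo (P V (Suc k)) \<cdot> \<psi> (Suc k) = (X 0 \<lhd> \<psi> (Suc k)) \<cdot> d 0 (Suc k)"
  proof (induction k)
    case 0
    then show ?case
      by (simp add: V_simps \<psi>_1)
  next
    case (Suc k)
    note [simp] = V_simps X_0 [symmetric]
    have inc: "J V (Suc k) \<in> Arr M" "Cod M (J V (Suc k)) = Q V (Suc k) \<otimes> X (Suc 0)"
      "Dom M (J V (Suc k)) = Q V (Suc (Suc k))"
      by auto
    note [simp] = inc
    show ?case
    proof (rule monomorphismD [where X = "X (Suc (Suc k))"])
      show "monomorphism M (X 0 \<lhd> J V (Suc k))"
        by (intro monomorphism_Ide_TensorA inc_monomorphism) auto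
      have "(X 0 \<lhd> J V (Suc k)) \<cdot> LCo (P V (Suc (Suc k))) \<cdot> \<psi> (Suc (Suc k))
        = \<a> (X 0) (Q V (Suc k)) (X (Suc 0)) \<cdot> (LCo (P V (Suc k)) \<rhd> X (Suc 0))
          \<cdot> J V (Suc k) \<cdot> \<psi> (Suc (Suc k))" (is "?l = _")
        using Comp_tail [OF inc_LCo [of "P V (Suc k)" V], of "\<psi> (Suc (Suc k))"] by simp
      also have "\<dots> = \<a> (X 0) (Q V (Suc k)) (X (Suc 0))
          \<cdot> ((LCo (P V (Suc k)) \<cdot> \<psi> (Suc k)) \<rhd> X (Suc 0)) \<cdot> d (Suc k) (Suc 0)"
        unfolding \<psi>_Suc by (simp add: merge)
      also have "\<dots> = \<a> (X 0) (Q V (Suc k)) (X (Suc 0))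
          \<cdot> (X 0 \<lhd> \<psi> (Suc k) \<rhd> X (Suc 0)) \<cdot> (d 0 (Suc k) \<rhd> X (Suc 0)) \<cdot> d (Suc k) (Suc 0)"
        unfolding Suc by (simp add: merge)
      also have "\<dots> = (X 0 \<lhd> (\<psi> (Suc k) \<rhd> X (Suc 0))) \<cdot> (X 0 \<lhd> d (Suc k) (Suc 0)) \<cdot> d 0 (Suc (Suc k))"
        using d_coassoc [of 0 "Suc k" "Suc 0"] by (simp add: Assoc_right)
      also have "\<dots> = (X 0 \<lhd> J V (Suc k)) \<cdot> (X 0 \<lhd> \<psi> (Suc (Suc k))) \<cdot> d 0 (Suc (Suc k))" (is "_ = ?r")
        using \<psi>_Suc by (simp add: merge)
      finally show "?l = ?r" .
    qed (auto simp: hom_iff)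
  qed
  then show ?thesis
    by (simp add: Suc)
qed

text \<open>No induction here: the right coaction sits on the last factor \<open>V\<close>, on which
  the recursion acts as the identity.\<close>

lemma RCo_\<psi>: "RCo (P V (Suc n)) \<cdot> \<psi> (Suc n) = (\<psi> (Suc n) \<rhd> X 0) \<cdot> d (Suc n) 0"
proof (cases n)
  case 0
  then show ?thesis
    by (simp add: V_simps \<psi>_1)
next
  case (Suc k)
  note [simp] = V_simps X_0 [symmetric]
  have [simp]: "J V (Suc k) \<in> Arr M" "Cod M (J V (Suc k)) = Q V (Suc k) \<otimes> X (Suc 0)"
    "Dom M (J V (Suc k)) = Q V (Suc (Suc k))"
    by auto
  have "(Q V (Suc k) \<lhd> d (Suc 0) 0) \<cdot> J V (Suc k) \<cdot> \<psi> (Suc (Suc k))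
    = (\<psi> (Suc k) \<boxtimes> (Ide M (X (Suc 0)) \<rhd> X 0)) \<cdot> (X (Suc k) \<lhd> d (Suc 0) 0) \<cdot> d (Suc k) (Suc 0)" (is "?l = _")
    unfolding \<psi>_Suc by (simp add: merge)
  also have "\<dots> = (\<psi> (Suc k) \<boxtimes> (Ide M (X (Suc 0)) \<rhd> X 0))
      \<cdot> \<a> (X (Suc k)) (X (Suc 0)) (X 0) \<cdot> (d (Suc k) (Suc 0) \<rhd> X 0) \<cdot> d (Suc (Suc k)) 0"
    using d_coassoc [of "Suc k" "Suc 0" 0] by simp
  also have "\<dots> = \<a> (Q V (Suc k)) (X (Suc 0)) (X 0)
      \<cdot> (((\<psi> (Suc k) \<rhd> X (Suc 0)) \<cdot> d (Suc k) (Suc 0)) \<rhd> X 0) \<cdot> d (Suc (Suc k)) 0"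
    by (simp add: Assoc_left merge)
  also have "\<dots> = \<a> (Q V (Suc k)) (X (Suc 0)) (X 0)
      \<cdot> ((J V (Suc k) \<cdot> \<psi> (Suc (Suc k))) \<rhd> X 0) \<cdot> d (Suc (Suc k)) 0" (is "_ = ?r")
    unfolding \<psi>_Suc ..
  finally have *: "?l = ?r" .
  \<comment> \<open>The piece of degree k + 2 is packaged as a bicomodule so that
    \<open>rcolin_through\<close> applies to it.\<close>
  have "rcolin \<lparr>BCar = X (Suc (Suc k)), LCo = d 0 (Suc (Suc k)), RCo = d (Suc (Suc k)) 0\<rparr>
     (P V (Suc k) \<box> V) (\<psi> (Suc (Suc k)))"
    by (rule rcolin_through) (use * in \<open>auto simp: bicomod_piece hom_iff\<close>)
  then show ?thesis
    by (simp add: rcolin_def Suc)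
qed

text \<open>For a = 0 or b = 0 this is colinearity, and for a \<ge> 1, b = 1 it is the recursion.
  The step plays coassociativity of \<open>d\<close> in degrees (a, b, 1) against
  \<open>cotensor_comult_part_Suc_Suc\<close>.\<close>

lemma comult_part_\<psi>: "cp V a b \<cdot> \<psi> (a + b) = (\<psi> a \<boxtimes> \<psi> b) \<cdot> d a b"
proof (cases a)
  case 0
  then show ?thesis
    using LCo_\<psi> [of b] by (simp add: cotensor_comult_part_0 \<psi>_0)
next
  case a: (Suc m)
  show ?thesis
  proof (cases b)
    case 0
    then show ?thesis
      using RCo_\<psi> [of m] by (simp add: cotensor_comult_part_Suc_0 \<psi>_0 a)
  next
    case b: (Suc n)
    have "cp V (Suc m) (Suc n) \<cdot> \<psi> (Suc m + Suc n) = (\<psi> (Suc m) \<boxtimes> \<psi> (Suc n)) \<cdot> d (Suc m) (Suc n)"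
    proof (induction n)
      case 0
      then show ?case
        using \<psi>_Suc [of m] by (simp add: cotensor_comult_part_Suc_1 \<psi>_1)
    next
      case (Suc n)
      note [simp] = V_simps
      have [simp]: "J V (Suc k) \<in> Arr M" "Cod M (J V (Suc k)) = Q V (Suc k) \<otimes> X (Suc 0)"
        "Dom M (J V (Suc k)) = Q V (Suc (Suc k))" for k
        by auto
      show ?case
      proof (rule monomorphismD [where X = "X (Suc m + Suc (Suc n))"])
        show "monomorphism M (Q V (Suc m) \<lhd> J V (Suc n))"
          by (intro monomorphism_Ide_TensorA inc_monomorphism) auto
        have "(Q V (Suc m) \<lhd> J V (Suc n))
            \<cdot> cp V (Suc m) (Suc (Suc n)) \<cdot> \<psi> (Suc m + Suc (Suc n))
          = \<a> (Q V (Suc m)) (Q V (Suc n)) (X (Suc 0)) \<cdot>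
            (cp V (Suc m) (Suc n) \<rhd> X (Suc 0))
            \<cdot> J V (Suc m + Suc n) \<cdot> \<psi> (Suc m + Suc (Suc n))" (is "?l = _")
          using Comp_tail [OF cotensor_comult_part_Suc_Suc [of V m n], of "\<psi> (Suc m + Suc (Suc n))"] by simp
        also have "\<dots> = \<a> (Q V (Suc m)) (Q V (Suc n)) (X (Suc 0)) \<cdot>
            ((cp V (Suc m) (Suc n) \<cdot> \<psi> (Suc m + Suc n)) \<rhd> X (Suc 0))
            \<cdot> d (Suc m + Suc n) (Suc 0)"
          using \<psi>_Suc [of "Suc (m + n)"] by (simp add: merge)
        also have "\<dots> = \<a> (Q V (Suc m)) (Q V (Suc n)) (X (Suc 0)) \<cdot>
            (\<psi> (Suc m) \<boxtimes> \<psi> (Suc n) \<rhd> X (Suc 0)) \<cdot> (d (Suc m) (Suc n) \<rhd> X (Suc 0))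
            \<cdot> d (Suc m + Suc n) (Suc 0)"
          unfolding Suc by (simp add: merge)
        also have "\<dots> = (\<psi> (Suc m) \<boxtimes> (\<psi> (Suc n) \<rhd> X (Suc 0))) \<cdot>
            (X (Suc m) \<lhd> d (Suc n) (Suc 0)) \<cdot> d (Suc m) (Suc (Suc n))"
          using d_coassoc [of "Suc m" "Suc n" "Suc 0"] by (simp add: Assoc_right)
        also have "\<dots> = (\<psi> (Suc m) \<boxtimes> (J V (Suc n) \<cdot> \<psi> (Suc (Suc n)))) \<cdot> d (Suc m) (Suc (Suc n))"
          unfolding \<psi>_Suc by (simp add: merge)
        also have "\<dots> = (Q V (Suc m) \<lhd> J V (Suc n)) \<cdot>
            (\<psi> (Suc m) \<boxtimes> \<psi> (Suc (Suc n))) \<cdot> d (Suc m) (Suc (Suc n))" (is "_ = ?r")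
          by (simp add: merge)
        finally show "?l = ?r" .
      qed (auto simp: hom_iff)
    qed
    then show ?thesis
      by (simp add: a b)
  qed
qed

end

section \<open>Functoriality of cotensor powers and iterated comultiplication over the base\<close>

context coassociative_comultiplication begin

text \<open>Both colinearities of \<open>f\<close> are used: the left one makes \<open>f\<close>
  admissible as right factor of the next cotensor map, the right one passes to that map, which is
  the left factor one step later.\<close>

lemma cotensor_pow_arr:
  assumes [simp]: "bicomod V" "bicomod W" and f: "rcolin V W f" "lcolin V W f"
  shows rcolin_cotensor_pow_arr: "rcolin (P V (Suc n)) (P W (Suc n)) (cotensor_pow_arr M D V W f (Suc n))"
    and inc_cotensor_pow_arr: "inc (P W (Suc n)) W \<cdot> cotensor_pow_arr M D V W f (Suc (Suc n)) =
      (cotensor_pow_arr M D V W f (Suc n) \<boxtimes> f) \<cdot> inc (P V (Suc n)) V"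
proof -
  show *: "rcolin (P V (Suc n)) (P W (Suc n)) (cotensor_pow_arr M D V W f (Suc n))" for n
  proof (induction n)
    case (Suc n)
    then show ?case
      using rcolin_cotensor_arr [OF _ _ _ _ Suc f(2,1)] by simp
  qed (simp add: f)
  show "inc (P W (Suc n)) W \<cdot> cotensor_pow_arr M D V W f (Suc (Suc n)) =
      (cotensor_pow_arr M D V W f (Suc n) \<boxtimes> f) \<cdot> inc (P V (Suc n)) V"
    using inc_cotensor_arr [OF _ _ _ _ * f(2)] by simp
qed

context
  fixes C :: "('o, 'm, 'x) coalgebra_scheme" and p :: 'm and B
  assumes C: "coassociative_comultiplication M C" and p: "p \<in> hom M (Car C) K"
    and p_Comult: "Comult D \<cdot> p = (p \<boxtimes> p) \<cdot> Comult C"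
  defines "B \<equiv> induced_bicomodule M C p"
begin

interpretation C: coassociative_comultiplication M C
  by (rule C)

lemma p_simps: "p \<in> Arr M" "Dom M p = Car C" "Cod M p = K"
  using p by (auto simp: hom_iff)

lemma B_simps: "BCar B = Car C" "LCo B = (p \<rhd> Car C) \<cdot> Comult C" "RCo B = (Car C \<lhd> p) \<cdot> Comult C"
  by (auto simp: B_def induced_bicomodule_def)

text \<open>Each law is coassociativity of \<open>C\<close> with \<open>p\<close> applied to two of
  the three tensor factors.\<close>

lemma bicomod_induced: "bicomod B"
  supply [simp] = p_simps
  using C.coassoc_map [of p p "Ide M (Car C)"] C.coassoc_map [of "Ide M (Car C)" p p]
    C.coassoc_map [of p "Ide M (Car C)" p]
  by (simp add: bicomod_def bicomodule_on_def B_simps hom_iff merge p_Comult)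

text \<open>Coassociativity with \<open>p\<close> on the middle factor says that the
  comultiplication equalizes the coactions; with \<open>p\<close> on the last factor it gives right
  colinearity of the lift.\<close>

lemma Comult_lift:
  "rcolin B (B \<box> B) (cotensor_lift M D B B (Comult C))"
  "inc B B \<cdot> cotensor_lift M D B B (Comult C) = Comult C"
proof -
  note [simp] = p_simps bicomod_induced
  have "\<a> (BCar B) K (BCar B) \<cdot> (RCo B \<rhd> BCar B) \<cdot> Comult C = (BCar B \<lhd> LCo B) \<cdot> Comult C"
    using C.coassoc_map [of "Ide M (Car C)" p "Ide M (Car C)"] by (simp add: B_simps)
  then have l: "cotensor_lift M D B B (Comult C) \<in> hom M (Car C) (BCar (B \<box> B))"
    "inc B B \<cdot> cotensor_lift M D B B (Comult C) = Comult C"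
    using cotensor_lift [of B B "Comult C" "Car C"] by (auto simp: hom_iff B_simps)
  then show "inc B B \<cdot> cotensor_lift M D B B (Comult C) = Comult C"
    by simp
  show "rcolin B (B \<box> B) (cotensor_lift M D B B (Comult C))"
    by (rule rcolin_through)
      (use l C.coassoc_map [of "Ide M (Car C)" "Ide M (Car C)" p] in \<open>simp_all add: B_simps merge\<close>)
qed

text \<open>Seen through the inclusion, iterating over the base is ordinary comultiplication
  followed by the previous iterate on the left factor. Right colinearity of that iterate is what
  lets the cotensor map exist.\<close>

lemma cotensor_iterated_comult:
  shows rcolin_cotensor_iterated_comult: "rcolin B (P B (Suc n)) (cotensor_iterated_comult M C D p (Suc n))"
    and inc_cotensor_iterated_comult: "inc (P B (Suc n)) B \<cdot> cotensor_iterated_comult M C D p (Suc (Suc n)) =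
      (cotensor_iterated_comult M C D p (Suc n) \<rhd> Car C) \<cdot> Comult C"
proof -
  note [simp] = p_simps bicomod_induced
  let ?it = "cotensor_iterated_comult M C D p"
  have it: "?it (Suc (Suc n)) = cotensor_arr M D B B (P B (Suc n)) B (?it (Suc n)) (Ide M (Car C))
      \<cdot> cotensor_lift M D B B (Comult C)" for n
    by (simp add: B_def Let_def)
  have I: "lcolin B B (Ide M (Car C))" "rcolin B B (Ide M (Car C))"
    using lcolin_Ide [of B] rcolin_Ide [of B] by (simp_all add: B_simps)
  show *: "rcolin B (P B (Suc n)) (?it (Suc n))" for n
  proof (induction n)
    case 0
    then show ?case
      by (simp add: I)
  next
    case (Suc n)
    then show ?case
      unfolding it using rcolin_Comp [OF Comult_lift(1) rcolin_cotensor_arr [OF _ _ _ _ Suc I]]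
      by (simp add: bicomod_cotensor del: cotensor_iterated_comult.simps)
  qed
  have a: "inc (P B (Suc n)) B \<cdot> cotensor_arr M D B B (P B (Suc n)) B (?it (Suc n)) (Ide M (Car C)) =
      (?it (Suc n) \<rhd> Car C) \<cdot> inc B B"
    "cotensor_arr M D B B (P B (Suc n)) B (?it (Suc n)) (Ide M (Car C)) \<in> hom M (BCar (B \<box> B)) (BCar (P B (Suc n) \<box> B))"
    using cotensor_arr [OF _ _ _ _ * I(1)] by simp_all
  have l: "cotensor_lift M D B B (Comult C) \<in> hom M (Car C) (BCar (B \<box> B))"
    using Comult_lift(1) by (simp add: rcolin_def B_simps)
  have "inc (P B (Suc n)) B \<cdot> ?it (Suc (Suc n)) =
    (inc (P B (Suc n)) B \<cdot> cotensor_arr M D B B (P B (Suc n)) B (?it (Suc n)) (Ide M (Car C))) \<cdot> cotensor_lift M D B B (Comult C)"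
    unfolding it using a(2) l by (simp add: hom_iff del: cotensor_iterated_comult.simps)
  also have "\<dots> = (?it (Suc n) \<rhd> Car C) \<cdot> inc B B \<cdot> cotensor_lift M D B B (Comult C)"
    unfolding a(1) using l * [of n] by (simp add: hom_iff rcolin_def B_simps del: cotensor_iterated_comult.simps)
  finally show "inc (P B (Suc n)) B \<cdot> ?it (Suc (Suc n)) = (?it (Suc n) \<rhd> Car C) \<cdot> Comult C"
    unfolding Comult_lift(2) .
qed

text \<open>Extracts from the closed formula a recursion in which no cotensor product of maps
  remains. The last clause rebrackets the composite into the form in which the formula is finally
  stated.\<close>

lemma cotensor_pow_arr_iterated_comult:
  fixes V :: "('o, 'm) bicomodule"
  assumes [simp]: "bicomod V" and f: "rcolin B V f" "lcolin B V f"
  defines "\<phi> \<equiv> \<lambda>n. cotensor_pow_arr M D B V f n \<cdot> cotensor_iterated_comult M C D p n"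
  shows "\<phi> 0 = p" "\<phi> (Suc 0) = f" "\<phi> n \<in> hom M (Car C) (BCar (P V n))"
    and "inc (P V (Suc n)) V \<cdot> \<phi> (Suc (Suc n)) = (\<phi> (Suc n) \<boxtimes> f) \<cdot> Comult C"
    and "k \<in> hom M A (Car C) \<Longrightarrow>
      \<phi> n \<cdot> k = cotensor_pow_arr M D B V f n \<cdot> cotensor_iterated_comult M C D p n \<cdot> k"
proof -
  note [simp] = p_simps bicomod_induced
  have f_in [simp]: "f \<in> Arr M" "Dom M f = Car C" "Cod M f = BCar V"
    using f by (auto simp: rcolin_def hom_iff B_simps)
  show 0: "\<phi> 0 = p" "\<phi> (Suc 0) = f"
    by (simp_all add: \<phi>_def)
  let ?it = "cotensor_iterated_comult M C D p" and ?pa = "cotensor_pow_arr M D B V f"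
  have it [simp]: "?it (Suc n) \<in> Arr M" "Dom M (?it (Suc n)) = Car C" "Cod M (?it (Suc n)) = BCar (P B (Suc n))" for n
    using rcolin_cotensor_iterated_comult [of n] by (auto simp: rcolin_def hom_iff B_simps)
  have pa [simp]: "?pa (Suc n) \<in> Arr M" "Dom M (?pa (Suc n)) = BCar (P B (Suc n))" "Cod M (?pa (Suc n)) = BCar (P V (Suc n))" for n
    using rcolin_cotensor_pow_arr [OF _ _ f, of n] by (auto simp: rcolin_def hom_iff)
  note [simp del] = cotensor_iterated_comult.simps cotensor_pow_arr.simps
  show "\<phi> n \<cdot> k = ?pa n \<cdot> ?it n \<cdot> k" if "k \<in> hom M A (Car C)"
    using that by (cases n)
      (simp_all add: \<phi>_def hom_iff cotensor_iterated_comult.simps(1) cotensor_pow_arr.simps(1))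
  show "\<phi> n \<in> hom M (Car C) (BCar (P V n))"
    using 0 by (cases n) (auto simp: \<phi>_def hom_iff regular_bicomodule_def)
  have "inc (P V (Suc n)) V \<cdot> \<phi> (Suc (Suc n)) = (?pa (Suc n) \<boxtimes> f) \<cdot> inc (P B (Suc n)) B \<cdot> ?it (Suc (Suc n))"
    unfolding \<phi>_def using Comp_tail [OF inc_cotensor_pow_arr [OF _ _ f], of "?it (Suc (Suc n))" n] by (simp add: B_simps)
  then show "inc (P V (Suc n)) V \<cdot> \<phi> (Suc (Suc n)) = (\<phi> (Suc n) \<boxtimes> f) \<cdot> Comult C"
    unfolding inc_cotensor_iterated_comult by (simp add: \<phi>_def merge)
qed

end

end

section \<open>Finite coproducts as biproducts\<close>

context preadditive_category begin

text \<open>Both sides agree on every injection, since only one summand survives there. The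
  bijection \<open>e\<close> enumerates the index set for \<open>sum_upto\<close>, which always has
  at least one term; hence the index set is nonempty.\<close>

lemma Ide_sum_upto:
  assumes S: "is_coproduct M I X S" and X: "\<And>i. i \<in> I \<Longrightarrow> X i \<in> Obj M" and e: "bij_betw e {..n} I"
  shows "Ide M (fst S) = sum_upto M (\<lambda>a. snd S (e a) \<cdot> coproduct_proj M I X S (e a)) n"
proof (rule coproduct_ext [OF S])
  have eI: "e a \<in> I" if "a \<le> n" for a
    using e that by (auto simp: bij_betw_def)
  have O: "fst S \<in> Obj M"
    using S by (simp add: is_coproduct_def)
  then show "Ide M (fst S) \<in> hom M (fst S) (fst S)"
    by (rule Ide_in)
  have t: "snd S (e a) \<cdot> coproduct_proj M I X S (e a) \<in> hom M (fst S) (fst S)" if "a \<le> n" for a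
    using Comp_in [OF coproduct_proj_in [OF S X eI] is_coproduct_in [OF S eI]] that by blast
  then show "sum_upto M (\<lambda>a. snd S (e a) \<cdot> coproduct_proj M I X S (e a)) n \<in> hom M (fst S) (fst S)"
    by (rule sum_upto_in)
  fix i assume i: "i \<in> I"
  then obtain k where k: "k \<le> n" "e k = i"
    using e by (auto simp: bij_betw_def)
  note Si = is_coproduct_in [OF S i]
  have *: "(snd S (e a) \<cdot> coproduct_proj M I X S (e a)) \<cdot> snd S i =
      (if a = k then snd S i else Zero M (X i) (fst S))" if a: "a \<le> n" for a
  proof -
    have "e a = i \<longleftrightarrow> a = k"
      using e k a unfolding bij_betw_def inj_on_def by auto
    moreover have "(snd S (e a) \<cdot> coproduct_proj M I X S (e a)) \<cdot> snd S i =
      snd S (e a) \<cdot> coproduct_proj M I X S (e a) \<cdot> snd S i"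
      using coproduct_proj_in [OF S X eI [OF a]] is_coproduct_in [OF S eI [OF a]] Si by (simp add: hom_iff)
    moreover have "coproduct_proj M I X S (e a) \<cdot> snd S i = (if i = e a then Ide M (X (e a)) else Zero M (X i) (X (e a)))"
      by (rule coproduct_proj_Comp [OF S X eI [OF a] i])
    ultimately show ?thesis
      using is_coproduct_in [OF S eI [OF a]] Si X [OF i] by (cases "e a = i") (simp_all add: hom_iff)
  qed
  have "sum_upto M (\<lambda>a. snd S (e a) \<cdot> coproduct_proj M I X S (e a)) n \<cdot> snd S i =
    sum_upto M (\<lambda>a. (snd S (e a) \<cdot> coproduct_proj M I X S (e a)) \<cdot> snd S i) n"
    by (rule sum_upto_Comp [OF t Si])
  also have "\<dots> = sum_upto M (\<lambda>a. if a = k then snd S i else Zero M (X i) (fst S)) n"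
    by (rule sum_upto_cong) (rule *)
  also have "\<dots> = snd S i"
    using sum_upto_single [of "\<lambda>a. if a = k then snd S i else Zero M (X i) (fst S)" k "X i" "fst S" n] k Si by simp
  finally show "Ide M (fst S) \<cdot> snd S i =
      sum_upto M (\<lambda>a. snd S (e a) \<cdot> coproduct_proj M I X S (e a)) n \<cdot> snd S i"
    using Si by (simp add: hom_iff)
qed

end

section \<open>AB5 and joint monicity of projections\<close>

text \<open>The poset of natural numbers as a category whose objects and arrows are taken from an arbitrary
  infinite type, the arrow \<open>m \<rightarrow> n\<close> being the image of the code of \<open>(m, n)\<close> under \<open>h\<close>.\<close>

definition seq_index :: "(nat \<Rightarrow> 'u) \<Rightarrow> ('u, 'u) category" where
  "seq_index h =
    \<lparr>Obj = range h,
     Arr = (\<lambda>(m, n). h (prod_encode (m, n))) ` {(m, n). m \<le> n},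
     Dom = (\<lambda>x. h (fst (prod_decode (inv h x)))),
     Cod = (\<lambda>x. h (snd (prod_decode (inv h x)))),
     Ide = (\<lambda>x. h (prod_encode (inv h x, inv h x))),
     Comp = (\<lambda>y x. h (prod_encode (fst (prod_decode (inv h x)), snd (prod_decode (inv h y)))))\<rparr>"

definition seq_functor :: "(nat \<Rightarrow> 'u) \<Rightarrow> (nat \<Rightarrow> 'o) \<Rightarrow> (nat \<Rightarrow> nat \<Rightarrow> 'm) \<Rightarrow> ('u, 'u, 'o, 'm) cat_functor" where
  "seq_functor h X t =
    \<lparr>on_obj = (\<lambda>x. X (inv h x)),
     on_arr = (\<lambda>x. t (fst (prod_decode (inv h x))) (snd (prod_decode (inv h x))))\<rparr>"

lemma seq_index_hom:
  assumes "inj h"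
  shows "hom (seq_index h) (h m) (h n) = (if m \<le> n then {h (prod_encode (m, n))} else {})"
  using assms by (auto simp: hom_def seq_index_def inj_eq)

lemma seq_index_filtered:
  assumes h: "inj h"
  shows "filtered (seq_index h)"
proof -
  have "category (seq_index h)"
    by unfold_locales (use h in \<open>auto simp: hom_def seq_index_def inj_eq\<close>)
  moreover have "\<exists>c \<in> Obj (seq_index h). hom (seq_index h) a c \<noteq> {} \<and> hom (seq_index h) b c \<noteq> {}"
    if ab: "a \<in> Obj (seq_index h)" "b \<in> Obj (seq_index h)" for a b
  proof -
    obtain m n where "a = h m" "b = h n"
      using ab by (auto simp: seq_index_def)
    then have "h (max m n) \<in> Obj (seq_index h)" "hom (seq_index h) a (h (max m n)) \<noteq> {}"
      "hom (seq_index h) b (h (max m n)) \<noteq> {}"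
      by (simp_all add: seq_index_hom [OF h]) (simp add: seq_index_def)
    then show ?thesis
      by blast
  qed
  moreover have "\<exists>c. \<exists>w \<in> hom (seq_index h) b c. w \<cdot>\<^bsub>seq_index h\<^esub> u = w \<cdot>\<^bsub>seq_index h\<^esub> v"
    if uv: "u \<in> hom (seq_index h) a b" "v \<in> hom (seq_index h) a b" for a b u v
  proof -
    obtain m n where "a = h m" "b = h n"
      using uv by (auto simp: hom_def seq_index_def)
    then have "u = v" "h (prod_encode (n, n)) \<in> hom (seq_index h) b b"
      using uv by (simp_all add: seq_index_hom [OF h] split: if_splits)
    then show ?thesis
      by blast
  qed
  moreover have "Obj (seq_index h) \<noteq> {}"
    by (simp add: seq_index_def)
  ultimately show ?thesis
    unfolding filtered_def by blast
qed

section \<open>Colimits of sequences and small coproducts\<close>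

context category begin

definition seq :: "(nat \<Rightarrow> 'o) \<Rightarrow> (nat \<Rightarrow> nat \<Rightarrow> 'm) \<Rightarrow> bool" where
  "seq X t \<longleftrightarrow> (\<forall>n. X n \<in> Obj M \<and> t n n = Ide M (X n)) \<and> (\<forall>m n. m \<le> n \<longrightarrow> t m n \<in> hom M (X m) (X n)) \<and>
     (\<forall>m n k. m \<le> n \<longrightarrow> n \<le> k \<longrightarrow> t n k \<cdot> t m n = t m k)"

definition seq_cocone :: "(nat \<Rightarrow> 'o) \<Rightarrow> (nat \<Rightarrow> nat \<Rightarrow> 'm) \<Rightarrow> 'o \<Rightarrow> (nat \<Rightarrow> 'm) \<Rightarrow> bool" where
  "seq_cocone X t L a \<longleftrightarrow> L \<in> Obj M \<and> (\<forall>n. a n \<in> hom M (X n) L) \<and> (\<forall>m n. m \<le> n \<longrightarrow> a n \<cdot> t m n = a m)"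

definition seq_colimit :: "(nat \<Rightarrow> 'o) \<Rightarrow> (nat \<Rightarrow> nat \<Rightarrow> 'm) \<Rightarrow> 'o \<Rightarrow> (nat \<Rightarrow> 'm) \<Rightarrow> bool" where
  "seq_colimit X t L a \<longleftrightarrow> seq_cocone X t L a \<and>
     (\<forall>Y q. seq_cocone X t Y q \<longrightarrow> (\<exists>!f. f \<in> hom M L Y \<and> (\<forall>n. f \<cdot> a n = q n)))"

lemma seq_functor: "inj h \<Longrightarrow> seq X t \<Longrightarrow> is_functor (seq_index h) M (seq_functor h X t)"
  by (auto simp: is_functor_def seq_functor_def seq_index_def seq_def inj_eq)

text \<open>Dictionary between the encoded poset and sequences indexed by \<open>nat\<close>; it
  keeps the encoding out of all later arguments.\<close>

lemma seq_colimit_iff: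
  assumes h: "inj h"
  shows "is_colimit (seq_index h) M (seq_functor h X t) L (\<lambda>x. a (inv h x)) \<longleftrightarrow> seq_colimit X t L a"
proof -
  have *: "is_cocone (seq_index h) M (seq_functor h X t) Y q \<longleftrightarrow> seq_cocone X t Y (\<lambda>n. q (h n))" for Y q
    using h by (auto simp: is_cocone_def seq_functor_def seq_index_def seq_cocone_def)
  have "(\<forall>Y q. seq_cocone X t Y (\<lambda>n. q (h n)) \<longrightarrow>
      (\<exists>!f. f \<in> hom M L Y \<and> (\<forall>j \<in> range h. f \<cdot> a (inv h j) = q j))) \<longleftrightarrow>
    (\<forall>Y q. seq_cocone X t Y q \<longrightarrow> (\<exists>!f. f \<in> hom M L Y \<and> (\<forall>n. f \<cdot> a n = q n)))" (is "?l \<longleftrightarrow> ?r")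
  proof
    assume l: ?l
    show ?r
    proof (intro allI impI)
      fix Y q assume "seq_cocone X t Y q"
      then show "\<exists>!f. f \<in> hom M L Y \<and> (\<forall>n. f \<cdot> a n = q n)"
        using l [rule_format, of Y "\<lambda>x. q (inv h x)"] h by simp
    qed
  next
    assume ?r
    then show ?l
      using h by simp
  qed
  moreover have "Obj (seq_index h) = range h"
    by (simp add: seq_index_def)
  ultimately show ?thesis
    unfolding is_colimit_def seq_colimit_def using h by (simp add: *)
qed

text \<open>A coproduct is a colimit over a discrete category. The injection \<open>h\<close> copies
  the index set into the universe \<open>'u\<close>, where each element serves as an object and as
  its own identity.\<close>

lemma coproduct_exists:
  fixes h :: "'i \<Rightarrow> 'u"
  assumes "cocomplete TYPE('u) M" and h: "inj_on h I" and X: "\<And>i. i \<in> I \<Longrightarrow> X i \<in> Obj M"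
  shows "is_coproduct M I X (coproduct M I X)"
proof -
  define J :: "('u, 'u) category" where
    "J = \<lparr>Obj = h ` I, Arr = h ` I, Dom = (\<lambda>x. x), Cod = (\<lambda>x. x), Ide = (\<lambda>x. x), Comp = (\<lambda>y x. x)\<rparr>"
  define F :: "('u, 'u, 'o, 'm) cat_functor" where
    "F = \<lparr>on_obj = (\<lambda>x. X (inv_into I h x)), on_arr = (\<lambda>x. Ide M (X (inv_into I h x)))\<rparr>"
  have "category J"
    by unfold_locales (auto simp: hom_def J_def)
  moreover have "is_functor J M F"
    using h X by (auto simp: is_functor_def J_def F_def hom_iff)
  ultimately obtain L a where L: "is_colimit J M F L a"
    using assms(1) unfolding cocomplete_def by blast
  have *: "is_cocone J M F Y q \<longleftrightarrow> Y \<in> Obj M \<and> (\<forall>i \<in> I. q (h i) \<in> hom M (X i) Y)" for Y q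
    using h X by (auto simp: is_cocone_def J_def F_def hom_iff)
  have "is_coproduct M I X (L, \<lambda>i. a (h i))"
    unfolding is_coproduct_def fst_conv snd_conv
  proof (intro conjI ballI allI impI)
    fix Y f assume Y: "Y \<in> Obj M" "\<forall>i \<in> I. f i \<in> hom M (X i) Y"
    then have "is_cocone J M F Y (\<lambda>x. f (inv_into I h x))"
      unfolding * using h by simp
    then have "\<exists>!g. g \<in> hom M L Y \<and> (\<forall>j \<in> Obj J. g \<cdot> a j = f (inv_into I h j))"
      using L unfolding is_colimit_def by blast
    then show "\<exists>!g. g \<in> hom M L Y \<and> (\<forall>i \<in> I. g \<cdot> a (h i) = f i)"
      using h by (simp add: J_def)
  qed (use L in \<open>auto simp: is_colimit_def *\<close>)
  then show ?thesis
    unfolding coproduct_def by (rule someI [of "is_coproduct M I X"])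
qed

end

text \<open>The embedding \<open>h\<close> of \<open>nat\<close> into the index universe makes
  countable diagrams small.\<close>

locale AB5_category = abelian_category M
  for M :: "('o, 'm, 'z) preadditive_scheme" (structure) +
  fixes h :: "nat \<Rightarrow> 'u"
  assumes inj_h: "inj h" and cocomplete: "cocomplete TYPE('u) M" and AB5: "AB5 TYPE('u) M"
begin

lemma countable_coproduct:
  fixes g :: "'i \<Rightarrow> nat" and I :: "'i set"
  assumes "inj g" "\<And>i. i \<in> I \<Longrightarrow> X i \<in> Obj M"
  shows "is_coproduct M I X (coproduct M I X)"
proof (rule coproduct_exists [OF cocomplete])
  show "inj_on (h \<circ> g) I"
    using inj_compose [OF inj_h assms(1)] inj_on_subset by blast
qed (use assms in auto)

lemma seq_AB5:
  assumes "seq X t" "seq Y u" "seq Z v" "seq_colimit X t A a" "seq_colimit Y u B b" "seq_colimit Z v E e"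
    and "\<And>n. short_exact M (s n) (r n)"
    and "\<And>n. s n \<in> hom M (X n) (Y n)" "\<And>n. r n \<in> hom M (Y n) (Z n)"
    and "\<And>m n. m \<le> n \<Longrightarrow> u m n \<cdot> s m = s n \<cdot> t m n" "\<And>m n. m \<le> n \<Longrightarrow> v m n \<cdot> r m = r n \<cdot> u m n"
    and "f \<in> hom M A B" "\<And>n. f \<cdot> a n = b n \<cdot> s n" "g \<in> hom M B E" "\<And>n. g \<cdot> b n = e n \<cdot> r n"
  shows "short_exact M f g"
proof -
  let ?J = "seq_index h" and ?F = "seq_functor h"
  have "is_nat_trans ?J M (?F X t) (?F Y u) (\<lambda>x. s (inv h x))" "is_nat_trans ?J M (?F Y u) (?F Z v) (\<lambda>x. r (inv h x))"
    using assms inj_h by (auto simp: is_nat_trans_def seq_index_def seq_functor_def)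
  moreover note seq_functor [OF inj_h assms(1)] seq_functor [OF inj_h assms(2)] seq_functor [OF inj_h assms(3)]
    assms(4) [folded seq_colimit_iff [OF inj_h]] assms(5) [folded seq_colimit_iff [OF inj_h]]
    assms(6) [folded seq_colimit_iff [OF inj_h]] seq_index_filtered [OF inj_h]
  ultimately show ?thesis
    using AB5 [unfolded AB5_def, rule_format, of ?J "?F X t" "?F Y u" "?F Z v" "\<lambda>x. s (inv h x)" "\<lambda>x. r (inv h x)"
        A "\<lambda>x. a (inv h x)" B "\<lambda>x. b (inv h x)" E "\<lambda>x. e (inv h x)" f g] assms(7,12-15)
    by blast
qed

lemma seq_colimit_exists:
  assumes "seq X t"
  obtains L a where "seq_colimit X t L a"
proof -
  obtain L q where "is_colimit (seq_index h) M (seq_functor h X t) L q"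
    using cocomplete [unfolded cocomplete_def] seq_functor [OF inj_h assms] seq_index_filtered [OF inj_h]
    unfolding filtered_def by blast
  \<comment> \<open>Puts the cocone into the shape demanded by \<open>seq_colimit_iff\<close>; on
    the objects \<open>h n\<close> nothing changes.\<close>
  then have "is_colimit (seq_index h) M (seq_functor h X t) L (\<lambda>x. q (h (inv h x)))"
    using inj_h by (auto simp: is_colimit_def is_cocone_def seq_index_def)
  then show ?thesis
    using that seq_colimit_iff [OF inj_h, of X t L "\<lambda>n. q (h n)"] by simp
qed

end

section \<open>Projections of a graded object\<close>

context preadditive_category begin

context
  fixes G :: "('o, 'm, 'y) graded_object_scheme"
  assumes G: "is_graded_object M G"
begin

lemma Deg_Obj [simp]: "Deg G n \<in> Obj M"
  and graded_coproduct: "is_coproduct M UNIV (Deg G) (Tot G, Inj G)"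
  using G by (auto simp: is_graded_object_def)

lemma Tot_Obj [simp]: "Tot G \<in> Obj M"
  using graded_coproduct by (simp add: is_coproduct_def)

lemma Inj_simps [simp]: "Inj G n \<in> Arr M" "Dom M (Inj G n) = Deg G n" "Cod M (Inj G n) = Tot G"
  using is_coproduct_in [OF graded_coproduct, of n] by (auto simp: hom_iff)

lemma Proj_simps [simp]: "Proj M G n \<in> Arr M" "Dom M (Proj M G n) = Tot G" "Cod M (Proj M G n) = Deg G n"
  using coproduct_proj_in [OF graded_coproduct, of n] by (auto simp: hom_iff Proj_def)

lemma Proj_Inj: "Proj M G n \<cdot> Inj G m = (if m = n then Ide M (Deg G n) else Zero M (Deg G m) (Deg G n))"
  using coproduct_proj_Comp [OF graded_coproduct, of n m] by (simp add: Proj_def)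

lemma Proj_Inj_simps [simp]:
  "Proj M G n \<cdot> Inj G n = Ide M (Deg G n)"
  "m \<noteq> n \<Longrightarrow> Proj M G n \<cdot> Inj G m = Zero M (Deg G m) (Deg G n)"
  by (auto simp: Proj_Inj)

lemma Inj_monomorphism: "monomorphism M (Inj G n)"
  by (rule split_monomorphism [of "Proj M G n"]) auto

lemma graded_ext:
  assumes "f \<in> hom M (Tot G) Y" "g \<in> hom M (Tot G) Y" "\<And>n. f \<cdot> Inj G n = g \<cdot> Inj G n"
  shows "f = g"
  using coproduct_ext [OF graded_coproduct] assms by auto

end

lemma graded_partI:
  assumes "is_graded_object M G" "is_graded_object M H" "f \<in> hom M (Tot G) (Tot H)"
    and "g \<in> hom M (Deg G n) (Deg H n)" "f \<cdot> Inj G n = Inj H n \<cdot> g"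
  shows "graded_part M G H f n = g"
  unfolding graded_part_def
proof (rule the_equality)
  fix g' assume "g' \<in> hom M (Deg G n) (Deg H n) \<and> f \<cdot> Inj G n = Inj H n \<cdot> g'"
  then show "g' = g"
    using monomorphismD [OF Inj_monomorphism [OF assms(2)], of n g' g] assms by auto
qed (use assms in auto)

end

section \<open>Truncations of a graded object and joint monicity of its projections\<close>

context AB5_category begin

definition trunc :: "('o, 'm, 'y) graded_object_scheme \<Rightarrow> nat \<Rightarrow> 'o \<times> (nat \<Rightarrow> 'm)" where
  "trunc G n = coproduct M {..<n} (Deg G)"

text \<open>Retraction of \<sigma>_n onto the first \<open>n\<close> summands. Besides splitting
  \<sigma>_n it supplies the transition maps \<open>retr G n \<cdot> initial m\<close> between
  truncations.\<close>

definition retr :: "('o, 'm, 'y) graded_object_scheme \<Rightarrow> nat \<Rightarrow> 'm" where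
  "retr G n = cotuple M UNIV (Tot G, Inj G) (fst (trunc G n))
     (\<lambda>k. if k < n then snd (trunc G n) k else Zero M (Deg G k) (fst (trunc G n)))"

context
  fixes G :: "('o, 'm, 'y) graded_object_scheme"
  assumes G: "is_graded_object M G"
begin

declare Deg_Obj [OF G, simp] Tot_Obj [OF G, simp] Inj_simps [OF G, simp] Proj_simps [OF G, simp]
  Proj_Inj_simps [OF G, simp]

abbreviation initial where "initial n \<equiv> initial_inj M G n"

lemma trunc_coproduct: "is_coproduct M {..<n} (Deg G) (trunc G n)"
  unfolding trunc_def by (rule countable_coproduct [where g = "\<lambda>n. n"]) auto

lemma trunc_simps [simp]:
  "fst (trunc G n) \<in> Obj M" "k < n \<Longrightarrow> snd (trunc G n) k \<in> Arr M" "k < n \<Longrightarrow> Dom M (snd (trunc G n) k) = Deg G k"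
  "k < n \<Longrightarrow> Cod M (snd (trunc G n) k) = fst (trunc G n)"
  using trunc_coproduct [of n] by (auto simp: is_coproduct_def hom_iff)

lemma initial_in: "initial n \<in> hom M (fst (trunc G n)) (Tot G)"
  and initial_trunc [simp]: "k < n \<Longrightarrow> initial n \<cdot> snd (trunc G n) k = Inj G k"
  using cotuple [OF trunc_coproduct, of "Tot G" n "Inj G"]
  by (auto simp: initial_inj_def trunc_def [symmetric] hom_iff)

lemma initial_simps [simp]:
  "initial n \<in> Arr M" "Dom M (initial n) = fst (trunc G n)" "Cod M (initial n) = Tot G"
  using initial_in by (auto simp: hom_iff)

lemma retr_in: "retr G n \<in> hom M (Tot G) (fst (trunc G n))"
  and retr_Inj: "retr G n \<cdot> Inj G k = (if k < n then snd (trunc G n) k else Zero M (Deg G k) (fst (trunc G n)))"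
proof -
  have "\<And>k. (if k < n then snd (trunc G n) k else Zero M (Deg G k) (fst (trunc G n))) \<in> hom M (Deg G k) (fst (trunc G n))"
    by (auto simp: hom_iff)
  from cotuple [OF graded_coproduct [OF G] trunc_simps(1) this]
  show "retr G n \<in> hom M (Tot G) (fst (trunc G n))"
    "retr G n \<cdot> Inj G k = (if k < n then snd (trunc G n) k else Zero M (Deg G k) (fst (trunc G n)))"
    by (auto simp: retr_def)
qed

lemma retr_simps [simp]:
  "retr G n \<in> Arr M" "Dom M (retr G n) = Tot G" "Cod M (retr G n) = fst (trunc G n)"
  using retr_in by (auto simp: hom_iff)

lemma retr_initial: "retr G n \<cdot> initial n = Ide M (fst (trunc G n))"
  by (rule coproduct_ext [OF trunc_coproduct]) (auto simp: hom_iff retr_Inj)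

lemma initial_monomorphism: "monomorphism M (initial n)"
  by (rule split_monomorphism [of "retr G n"]) (auto simp: retr_initial)

lemma Proj_initial:
  "Proj M G m \<cdot> initial n \<cdot> retr G n = (if m < n then Proj M G m else Zero M (Tot G) (Deg G m))"
proof (rule graded_ext [OF G])
  fix k
  have "m < n \<Longrightarrow> k \<ge> n \<Longrightarrow> k \<noteq> m" "m \<ge> n \<Longrightarrow> k < n \<Longrightarrow> k \<noteq> m"
    by auto
  then show "(Proj M G m \<cdot> initial n \<cdot> retr G n) \<cdot> Inj G k =
      (if m < n then Proj M G m else Zero M (Tot G) (Deg G m)) \<cdot> Inj G k"
    by (simp add: retr_Inj)
qed (auto simp: hom_iff)

lemma initial_transition:
  assumes "m \<le> n"
  shows "initial n \<cdot> retr G n \<cdot> initial m = initial m"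
proof (rule coproduct_ext [OF trunc_coproduct])
  fix k assume "k \<in> {..<m}"
  then show "(initial n \<cdot> retr G n \<cdot> initial m) \<cdot> snd (trunc G m) k = initial m \<cdot> snd (trunc G m) k"
    using assms by (simp add: retr_Inj)
qed (auto simp: hom_iff)

lemma initial_seq: "seq (\<lambda>n. fst (trunc G n)) (\<lambda>m n. retr G n \<cdot> initial m)"
  unfolding seq_def by (simp add: retr_initial hom_iff initial_transition)

lemma initial_Inj: "k < n \<Longrightarrow> initial n \<cdot> retr G n \<cdot> Inj G k = Inj G k"
  by (simp add: retr_Inj)

text \<open>A cocone on the truncations and a family of arrows out of the summands carry the same
  information, so the universal property of the direct sum transfers.\<close>

lemma initial_colimit: "seq_colimit (\<lambda>n. fst (trunc G n)) (\<lambda>m n. retr G n \<cdot> initial m) (Tot G) initial"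
  unfolding seq_colimit_def
proof (intro conjI allI impI)
  show "seq_cocone (\<lambda>n. fst (trunc G n)) (\<lambda>m n. retr G n \<cdot> initial m) (Tot G) initial"
    by (simp add: seq_cocone_def hom_iff initial_transition)
  fix Y q assume "seq_cocone (\<lambda>n. fst (trunc G n)) (\<lambda>m n. retr G n \<cdot> initial m) Y q"
  then have Y: "Y \<in> Obj M" and q: "\<And>n. q n \<in> hom M (fst (trunc G n)) Y"
    and qt: "\<And>m n. m \<le> n \<Longrightarrow> q n \<cdot> retr G n \<cdot> initial m = q m"
    by (auto simp: seq_cocone_def)
  have q_simps [simp]: "\<And>n. q n \<in> Arr M" "\<And>n. Dom M (q n) = fst (trunc G n)" "\<And>n. Cod M (q n) = Y"
    using q by (auto simp: hom_iff)
  \<comment> \<open>Stage \<open>Suc k\<close> is the first that contains degree \<open>k\<close>;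
    by \<open>c_eq\<close> all later stages give the same arrow.\<close>
  define c where "c k = q (Suc k) \<cdot> retr G (Suc k) \<cdot> Inj G k" for k
  have c: "c k \<in> hom M (Deg G k) Y" for k
    by (auto simp: c_def hom_iff)
  have c_eq: "q n \<cdot> retr G n \<cdot> Inj G k = c k" if "k < n" for k n
  proof -
    have "q n \<cdot> retr G n \<cdot> Inj G k = q n \<cdot> retr G n \<cdot> initial (Suc k) \<cdot> retr G (Suc k) \<cdot> Inj G k"
      by (simp add: initial_Inj)
    also have "\<dots> = (q n \<cdot> retr G n \<cdot> initial (Suc k)) \<cdot> retr G (Suc k) \<cdot> Inj G k"
      by simp
    also have "\<dots> = c k"
      using that by (subst qt) (auto simp: c_def)
    finally show ?thesis .
  qed
  have c_trunc: "q n \<cdot> snd (trunc G n) k = c k" if "k < n" for k n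
    using c_eq [OF that] that by (simp add: retr_Inj)
  obtain f where f: "f \<in> hom M (Tot G) Y" "\<And>k. f \<cdot> Inj G k = c k"
    using cotuple [OF graded_coproduct [OF G] Y c] by auto
  have f_simps [simp]: "f \<in> Arr M" "Dom M f = Tot G" "Cod M f = Y"
    using f by (auto simp: hom_iff)
  show "\<exists>!f. f \<in> hom M (Tot G) Y \<and> (\<forall>n. f \<cdot> initial n = q n)"
  proof (rule ex1I [of _ f], intro conjI allI)
    fix n
    show "f \<cdot> initial n = q n"
      by (rule coproduct_ext [OF trunc_coproduct]) (auto simp: hom_iff f c_trunc)
  next
    fix g assume g: "g \<in> hom M (Tot G) Y \<and> (\<forall>n. g \<cdot> initial n = q n)"
    then have [simp]: "g \<in> Arr M" "Dom M g = Tot G" "Cod M g = Y" and gq: "\<And>n. g \<cdot> initial n = q n"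
      by (auto simp: hom_iff)
    have "g \<cdot> Inj G k = c k" for k
      using Comp_tail [OF gq [of "Suc k"], of "retr G (Suc k) \<cdot> Inj G k"] by (simp add: c_def initial_Inj)
    then show "g = f"
      using graded_ext [OF G] f g by metis
  qed (rule f)
qed

text \<open>A finite coproduct is a biproduct, so its projections detect zero. For
  \<open>n = 0\<close>, where \<open>sum_upto\<close> offers no empty sum, the truncation is a zero
  object.\<close>

lemma trunc_Zero:
  assumes g: "g \<in> hom M A (fst (trunc G n))" and "\<And>m. m < n \<Longrightarrow> Proj M G m \<cdot> initial n \<cdot> g = Zero M A (Deg G m)"
  shows "g = Zero M A (fst (trunc G n))"
proof -
  have [simp]: "A \<in> Obj M" "g \<in> Arr M" "Dom M g = A" "Cod M g = fst (trunc G n)"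
    using g hom_Obj by (auto simp: hom_iff)
  show ?thesis
  proof (cases n)
    case 0
    have "Ide M (fst (trunc G n)) = Zero M (fst (trunc G n)) (fst (trunc G n))"
      by (rule coproduct_ext [OF trunc_coproduct]) (auto simp: hom_iff 0)
    then have "Ide M (fst (trunc G n)) \<cdot> g = Zero M (fst (trunc G n)) (fst (trunc G n)) \<cdot> g"
      by simp
    then show ?thesis
      by simp
  next
    case (Suc k)
    have lt: "a < n" if "a \<le> k" for a
      using that by (simp add: Suc)
    have bij: "bij_betw (\<lambda>a. a) {..k} {..<n}"
      by (auto simp: bij_betw_def Suc)
    have [simp]: "coproduct_proj M {..<n} (Deg G) (trunc G n) m \<in> Arr M"
      "Dom M (coproduct_proj M {..<n} (Deg G) (trunc G n) m) = fst (trunc G n)"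
      "Cod M (coproduct_proj M {..<n} (Deg G) (trunc G n) m) = Deg G m" if "m < n" for m
      using coproduct_proj_in [OF trunc_coproduct, of n m] that by (auto simp: hom_iff)
    have pr: "coproduct_proj M {..<n} (Deg G) (trunc G n) m = Proj M G m \<cdot> initial n" if "m < n" for m
      by (rule coproduct_ext [OF trunc_coproduct])
        (use that coproduct_proj_Comp [OF trunc_coproduct, of n m] in \<open>auto simp: hom_iff Proj_Inj [OF G]\<close>)
    have "g = Ide M (fst (trunc G n)) \<cdot> g"
      by simp
    also have "\<dots> = sum_upto M (\<lambda>a. snd (trunc G n) a \<cdot> coproduct_proj M {..<n} (Deg G) (trunc G n) a) k \<cdot> g"
      using Ide_sum_upto [OF trunc_coproduct _ bij] by simp
    also have "\<dots> = sum_upto M (\<lambda>a. (snd (trunc G n) a \<cdot> coproduct_proj M {..<n} (Deg G) (trunc G n) a) \<cdot> g) k"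
      by (rule sum_upto_Comp [where B = "fst (trunc G n)" and C = "fst (trunc G n)"]) (auto simp: hom_iff lt)
    also have "\<dots> = Zero M A (fst (trunc G n))"
      by (rule sum_upto_Zero) (use assms(2) in \<open>auto simp: lt pr\<close>)
    finally show ?thesis .
  qed
qed

text \<open>Let \<open>q\<close> be the cokernel of \<open>f\<close>. Every projection kills
  \<open>f\<close>, hence factors through \<open>q\<close>; so anything in a truncation killed by
  \<open>q\<close> has zero projections, and \<open>q \<cdot> initial n\<close> is monic. AB5 passes
  this to the colimit: \<open>q\<close> is monic, and \<open>q \<cdot> f\<close> being zero forces
  \<open>f\<close> to be zero.\<close>

lemma Proj_jointly_monic_Zero:
  assumes f: "f \<in> hom M A (Tot G)" and Zero: "\<And>n. Proj M G n \<cdot> f = Zero M A (Deg G n)"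
  shows "f = Zero M A (Tot G)"
proof -
  have [simp]: "A \<in> Obj M" "f \<in> Arr M" "Dom M f = A" "Cod M f = Tot G"
    using f hom_Obj by (auto simp: hom_iff)
  obtain q where q: "is_cokernel M q f"
    using cokernel_exists [of f] by auto
  define Q where "Q = Cod M q"
  have [simp]: "q \<in> Arr M" "Dom M q = Tot G" "Cod M q = Q"
    using is_cokernel_Arr [OF q] by (auto simp: hom_iff Q_def)
  have [simp]: "Q \<in> Obj M"
    using Cod_in [of q] by simp
  define s where "s n = q \<cdot> initial n" for n
  have s [simp]: "s n \<in> Arr M" "Dom M (s n) = fst (trunc G n)" "Cod M (s n) = Q" for n
    by (auto simp: s_def)
  have mono: "monomorphism M (s n)" for n
  proof (rule monomorphism_ZeroI)
    show "s n \<in> hom M (fst (trunc G n)) Q"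
      by (simp add: hom_iff)
    fix X g assume g: "g \<in> hom M X (fst (trunc G n))" "s n \<cdot> g = Zero M X Q"
    show "g = Zero M X (fst (trunc G n))"
    proof (rule trunc_Zero [OF g(1)])
      fix m
      obtain r where r: "r \<in> hom M Q (Deg G m)" "r \<cdot> q = Proj M G m"
        using is_cokernel_factor [OF q, of "Proj M G m" "Deg G m"] Zero by (auto simp: hom_iff)
      have "Proj M G m \<cdot> initial n \<cdot> g = (r \<cdot> q) \<cdot> initial n \<cdot> g"
        by (simp add: r)
      also have "\<dots> = r \<cdot> s n \<cdot> g"
        using r(1) g(1) by (simp add: hom_iff s_def)
      also have "\<dots> = Zero M X (Deg G m)"
        using r g hom_Obj(1) [OF g(1)] by (simp add: hom_iff)
      finally show "Proj M G m \<cdot> initial n \<cdot> g = Zero M X (Deg G m)" .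
    qed
  qed
  have "\<exists>r. \<forall>n. is_cokernel M (r n) (s n)"
    using cokernel_exists s by (intro choice) blast
  then obtain r where r: "\<And>n. is_cokernel M (r n) (s n)"
    by blast
  define R where "R n = Cod M (r n)" for n
  have [simp]: "r n \<in> Arr M" "Dom M (r n) = Q" "Cod M (r n) = R n" for n
    using is_cokernel_Arr [OF r [of n]] by (auto simp: hom_iff R_def)
  have [simp]: "R n \<in> Obj M" for n
    using Cod_in [of "r n"] by simp
  have exact: "short_exact M (s n) (r n)" for n
    unfolding short_exact_def using monomorphism_cokernel [OF mono r] r by blast
  have s_trans: "s n \<cdot> retr G n \<cdot> initial m = s m" if "m \<le> n" for m n
    using initial_transition [OF that] by (simp add: s_def)
  \<comment> \<open>For \<open>m \<le> n\<close> the arrow \<open>s m\<close> factors through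
    \<open>s n\<close>, so \<open>r n\<close> kills it and factors through its cokernel
    \<open>r m\<close>.\<close>
  have "\<forall>m n. \<exists>u. m \<le> n \<longrightarrow> u \<in> hom M (R m) (R n) \<and> u \<cdot> r m = r n"
  proof (intro allI)
    fix m n
    show "\<exists>u. m \<le> n \<longrightarrow> u \<in> hom M (R m) (R n) \<and> u \<cdot> r m = r n"
    proof (cases "m \<le> n")
      case True
      have "r n \<cdot> s m = (r n \<cdot> s n) \<cdot> retr G n \<cdot> initial m"
        using s_trans [OF True] by (simp del: s_def)
      also have "\<dots> = Zero M (Dom M (s m)) (R n)"
        unfolding is_cokernel_Zero [OF r] by simp
      finally show ?thesis
        using is_cokernel_factor [OF r [of m], of "r n" "R n"] by (auto simp: hom_iff)
    qed auto
  qed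
  then obtain u where u: "\<And>m n. m \<le> n \<Longrightarrow> u m n \<in> hom M (R m) (R n)" "\<And>m n. m \<le> n \<Longrightarrow> u m n \<cdot> r m = r n"
    by metis
  have u_simps [simp]: "u m n \<in> Arr M" "Dom M (u m n) = R m" "Cod M (u m n) = R n" if "m \<le> n" for m n
    using u(1) [OF that] by (auto simp: hom_iff)
  have r_cancel: "v = w" if "v \<in> hom M (R n) Y" "w \<in> hom M (R n) Y" "v \<cdot> r n = w \<cdot> r n" for v w n Y
    using is_cokernel_cancel [OF r [of n]] that by auto
  have R_seq: "seq R u"
    unfolding seq_def
  proof (intro conjI allI impI)
    fix n
    show "u n n = Ide M (R n)"
      by (rule r_cancel [of _ n "R n"]) (auto simp: u hom_iff)
  next
    fix m n k :: nat assume *: "m \<le> n" "n \<le> k"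
    then have "m \<le> k"
      by simp
    show "u n k \<cdot> u m n = u m k"
      by (rule r_cancel [of _ m "R k"]) (use * \<open>m \<le> k\<close> in \<open>auto simp: u hom_iff\<close>)
  qed (auto simp: u)
  obtain E e where E: "seq_colimit R u E e"
    using seq_colimit_exists [OF R_seq] by blast
  then have e_in: "\<And>n. e n \<in> hom M (R n) E" and e_u: "\<And>m n. m \<le> n \<Longrightarrow> e n \<cdot> u m n = e m"
    by (auto simp: seq_colimit_def seq_cocone_def)
  then have [simp]: "e n \<in> Arr M" "Dom M (e n) = R n" "Cod M (e n) = E" for n
    by (auto simp: hom_iff)
  have e_r: "e 0 \<cdot> r 0 = e n \<cdot> r n" for n
  proof -
    have "e 0 \<cdot> r 0 = (e n \<cdot> u 0 n) \<cdot> r 0"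
      by (simp add: e_u)
    also have "\<dots> = e n \<cdot> r n"
      using u(2) [of 0 n] by simp
    finally show ?thesis .
  qed
  \<comment> \<open>AB5 for the exact sequences from \<open>trunc G n\<close> to the constant
    \<open>Q\<close> to \<open>R n\<close>. On colimits the \<open>s n\<close> induce
    \<open>q\<close>, and the \<open>r n\<close> induce the common value of
    \<open>e n \<cdot> r n\<close>.\<close>
  have "short_exact M q (e 0 \<cdot> r 0)"
  proof (rule seq_AB5 [OF initial_seq _ R_seq initial_colimit _ E exact])
    show "seq (\<lambda>n. Q) (\<lambda>m n. Ide M Q)"
      by (auto simp: seq_def hom_iff)
    show "seq_colimit (\<lambda>n. Q) (\<lambda>m n. Ide M Q) Q (\<lambda>n. Ide M Q)"
      unfolding seq_colimit_def
    proof (intro conjI allI impI)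
      fix Y c assume "seq_cocone (\<lambda>n. Q) (\<lambda>m n. Ide M Q) Y c"
      then have c: "\<And>n. c n \<in> hom M Q Y" "\<And>m n. m \<le> n \<Longrightarrow> c n \<cdot> Ide M Q = c m"
        by (auto simp: seq_cocone_def)
      have c_const: "c n = c 0" for n
        using c(2) [of 0 n] c(1) [of n] by (simp add: hom_iff)
      show "\<exists>!f. f \<in> hom M Q Y \<and> (\<forall>n. f \<cdot> Ide M Q = c n)"
      proof (rule ex1I [of _ "c 0"], intro conjI allI)
        show "c 0 \<cdot> Ide M Q = c n" for n
          using c(1) [of 0] c_const [of n] by (simp add: hom_iff)
        show "f = c 0" if "f \<in> hom M Q Y \<and> (\<forall>n. f \<cdot> Ide M Q = c n)" for f
          using conjunct2 [OF that, rule_format, of 0] that by (simp add: hom_iff)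
      qed (rule c)
    qed (auto simp: seq_cocone_def hom_iff)
    show "q \<cdot> initial n = Ide M Q \<cdot> s n" for n
      by (simp add: s_def)
    show "(e 0 \<cdot> r 0) \<cdot> Ide M Q = e n \<cdot> r n" for n
      using e_r [of n] by simp
    show "e 0 \<cdot> r 0 \<in> hom M Q E"
      by (simp add: hom_iff)
  qed (simp_all add: hom_iff s_trans u)
  then have "monomorphism M q"
    unfolding short_exact_def using is_kernel_monomorphism by blast
  then show ?thesis
    using monomorphism_ZeroD [of q f A] f is_cokernel_Zero [OF q] by simp
qed

lemma Proj_jointly_monic:
  assumes "f \<in> hom M A (Tot G)" "g \<in> hom M A (Tot G)" "\<And>n. Proj M G n \<cdot> f = Proj M G n \<cdot> g"
  shows "f = g"
proof -
  have P: "Proj M G n \<in> hom M (Tot G) (Deg G n)" for n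
    by (simp add: hom_iff)
  have "Sub f g = Zero M A (Tot G)"
    by (rule Proj_jointly_monic_Zero [OF Sub_in [OF assms(1,2)]])
      (use assms Comp_Sub [OF assms(1,2) P] Sub_Zero_iff [OF Comp_in [OF assms(1) P] Comp_in [OF assms(2) P]] in simp)
  then show ?thesis
    using Sub_Zero_iff assms by blast
qed

end

end

section \<open>Graded coalgebras\<close>

text \<open>Interpreted for the given coalgebra and for its cotensor coalgebra: in both, the
  comultiplication \<open>H\<close> is assembled from components \<open>d a b\<close>.\<close>

locale graded_comultiplication = coabelian_monoidal_category M
  for M :: "('o, 'm, 'z) monoidal_scheme" (structure) +
  fixes G :: "('o, 'm, 'y) graded_object_scheme" and H :: 'm and d :: "nat \<Rightarrow> nat \<Rightarrow> 'm"
  assumes G: "is_graded_object M G" and H_in: "H \<in> hom M (Tot G) (Tot G \<otimes> Tot G)"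
    and d_in: "\<And>a b. d a b \<in> hom M (Deg G (a + b)) (Deg G a \<otimes> Deg G b)"
    and H_Inj: "\<And>n. H \<cdot> Inj G n = sum_upto M (\<lambda>a. (Inj G a \<boxtimes> Inj G (n - a)) \<cdot> d a (n - a)) n"
begin

declare Deg_Obj [OF G, simp] Tot_Obj [OF G, simp] Inj_simps [OF G, simp] Proj_simps [OF G, simp]
  Proj_Inj_simps [OF G, simp]

lemma d_simps [simp]: "d a b \<in> Arr M" "Dom M (d a b) = Deg G (a + b)" "Cod M (d a b) = Deg G a \<otimes> Deg G b"
  using d_in by (auto simp: hom_iff)

lemma H_simps [simp]: "H \<in> Arr M" "Dom M H = Tot G" "Cod M H = Tot G \<otimes> Tot G"
  using H_in by (auto simp: hom_iff)

lemma tensor_comult_Inj: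
  assumes "f \<in> hom M (Tot G) Y" "g \<in> hom M (Tot G) Z"
  shows "(f \<boxtimes> g) \<cdot> H \<cdot> Inj G n = sum_upto M (\<lambda>a. ((f \<cdot> Inj G a) \<boxtimes> (g \<cdot> Inj G (n - a))) \<cdot> d a (n - a)) n"
proof -
  note [simp] = assms [unfolded hom_iff]
  have "(f \<boxtimes> g) \<cdot> H \<cdot> Inj G n = sum_upto M (\<lambda>a. (f \<boxtimes> g) \<cdot> (Inj G a \<boxtimes> Inj G (n - a)) \<cdot> d a (n - a)) n"
    unfolding H_Inj by (rule Comp_sum_upto [where A = "Deg G n" and B = "Tot G \<otimes> Tot G"]) (auto simp: hom_iff)
  also have "\<dots> = sum_upto M (\<lambda>a. ((f \<cdot> Inj G a) \<boxtimes> (g \<cdot> Inj G (n - a))) \<cdot> d a (n - a)) n"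
    by (rule sum_upto_cong) (simp add: merge)
  finally show ?thesis .
qed

text \<open>In every summand other than \<open>k\<close> one of the two maps kills its tensor
  factor.\<close>

lemma tensor_comult_Inj_single:
  assumes fg: "f \<in> hom M (Tot G) Y" "g \<in> hom M (Tot G) Z" and "k \<le> n"
    "\<And>a. a \<le> n \<Longrightarrow> a \<noteq> k \<Longrightarrow> f \<cdot> Inj G a = Zero M (Deg G a) Y \<or> g \<cdot> Inj G (n - a) = Zero M (Deg G (n - a)) Z"
  shows "(f \<boxtimes> g) \<cdot> H \<cdot> Inj G n = ((f \<cdot> Inj G k) \<boxtimes> (g \<cdot> Inj G (n - k))) \<cdot> d k (n - k)"
  unfolding tensor_comult_Inj [OF fg]
proof (rule sum_upto_single [where A = "Deg G n" and B = "Y \<otimes> Z"])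
  note [simp] = fg [unfolded hom_iff] hom_Obj(2) [OF fg(1)] hom_Obj(2) [OF fg(2)]
  show "((f \<cdot> Inj G k) \<boxtimes> (g \<cdot> Inj G (n - k))) \<cdot> d k (n - k) \<in> hom M (Deg G n) (Y \<otimes> Z)"
    using assms(3) by (simp add: hom_iff)
  show "((f \<cdot> Inj G a) \<boxtimes> (g \<cdot> Inj G (n - a))) \<cdot> d a (n - a) = Zero M (Deg G n) (Y \<otimes> Z)" if "a \<le> n" "a \<noteq> k" for a
    using assms(4) [OF that] that by auto
qed (rule assms)

lemma tensor_comult_Inj_Zero:
  assumes fg: "f \<in> hom M (Tot G) Y" "g \<in> hom M (Tot G) Z"
    and "\<And>a. a \<le> n \<Longrightarrow> f \<cdot> Inj G a = Zero M (Deg G a) Y \<or> g \<cdot> Inj G (n - a) = Zero M (Deg G (n - a)) Z"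
  shows "(f \<boxtimes> g) \<cdot> H \<cdot> Inj G n = Zero M (Deg G n) (Y \<otimes> Z)"
  unfolding tensor_comult_Inj [OF fg]
proof (rule sum_upto_Zero)
  note [simp] = fg [unfolded hom_iff] hom_Obj(2) [OF fg(1)] hom_Obj(2) [OF fg(2)]
  show "Y \<otimes> Z \<in> Obj M"
    by simp
  show "((f \<cdot> Inj G a) \<boxtimes> (g \<cdot> Inj G (n - a))) \<cdot> d a (n - a) = Zero M (Deg G n) (Y \<otimes> Z)" if "a \<le> n" for a
    using assms(3) [OF that] that by auto
qed simp

text \<open>Compared on each degree: in degree a + b a single summand survives, in the others none.
  Identities for \<open>H\<close> thereby become identities for its components.\<close>

lemma Proj_tensor_comult: "(Proj M G a \<boxtimes> Proj M G b) \<cdot> H = d a b \<cdot> Proj M G (a + b)"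
proof (rule graded_ext [OF G, where Y = "Deg G a \<otimes> Deg G b"])
  fix n
  have P: "Proj M G a \<in> hom M (Tot G) (Deg G a)" "Proj M G b \<in> hom M (Tot G) (Deg G b)"
    by (auto simp: hom_iff)
  show "((Proj M G a \<boxtimes> Proj M G b) \<cdot> H) \<cdot> Inj G n = (d a b \<cdot> Proj M G (a + b)) \<cdot> Inj G n"
  proof (cases "n = a + b")
    case True
    have "(Proj M G a \<boxtimes> Proj M G b) \<cdot> H \<cdot> Inj G n =
      ((Proj M G a \<cdot> Inj G a) \<boxtimes> (Proj M G b \<cdot> Inj G (n - a))) \<cdot> d a (n - a)"
      by (rule tensor_comult_Inj_single [OF P]) (auto simp: True)
    then show ?thesis
      by (simp add: True)
  next
    case False
    have "(Proj M G a \<boxtimes> Proj M G b) \<cdot> H \<cdot> Inj G n = Zero M (Deg G n) (Deg G a \<otimes> Deg G b)"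
      by (rule tensor_comult_Inj_Zero [OF P]) (use False in \<open>auto simp: Proj_Inj [OF G]\<close>)
    then show ?thesis
      using False by simp
  qed
qed (auto simp: hom_iff)

end

section \<open>A fixed graded coalgebra and the components of its comultiplication\<close>

locale graded_coalgebra_AB5 = coabelian_monoidal_category M + AB5_category M h
  for M :: "('o, 'm) monoidal" (structure) and h :: "nat \<Rightarrow> 'u" +
  fixes C :: "('o, 'm) graded_coalgebra"
  assumes graded_coalgebra: "is_graded_coalgebra M C"
begin

abbreviation CC where "CC \<equiv> Car C"
abbreviation \<Delta> where "\<Delta> \<equiv> Comult C"
abbreviation \<epsilon> where "\<epsilon> \<equiv> Counit C"
abbreviation Pc where "Pc \<equiv> Piece C"
abbreviation \<iota> where "\<iota> \<equiv> Incl C"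
abbreviation \<pi> where "\<pi> n \<equiv> proj M C n"
abbreviation \<delta> where "\<delta> a b \<equiv> comult_part M C a b"

lemma gobj_simps [simp]: "Tot (gobj C) = CC" "Deg (gobj C) = Pc" "Inj (gobj C) = \<iota>"
  by (simp_all add: gobj_def)

lemma coalgebra: "is_coalgebra M C"
  and graded: "is_graded_object M (gobj C)"
  using graded_coalgebra by (auto simp: is_graded_coalgebra_def)

sublocale C: coassociative_comultiplication M C
  by unfold_locales (use coalgebra in \<open>auto simp: is_coalgebra_def\<close>)

lemma Counit_simps [simp]: "\<epsilon> \<in> Arr M" "Dom M \<epsilon> = CC" "Cod M \<epsilon> = \<one>"
  using coalgebra by (auto simp: is_coalgebra_def hom_iff)

lemma Pc_Obj [simp]: "Pc n \<in> Obj M"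
  using Deg_Obj [OF graded] by simp

lemma \<iota>_simps [simp]: "\<iota> n \<in> Arr M" "Dom M (\<iota> n) = Pc n" "Cod M (\<iota> n) = CC"
  using Inj_simps [OF graded] by simp_all

lemma \<pi>_simps [simp]: "\<pi> n \<in> Arr M" "Dom M (\<pi> n) = CC" "Cod M (\<pi> n) = Pc n"
  using Proj_simps [OF graded] by simp_all

lemma \<pi>_\<iota>: "\<pi> n \<cdot> \<iota> m = (if m = n then Ide M (Pc n) else Zero M (Pc m) (Pc n))"
  using Proj_Inj [OF graded] by simp

lemma \<pi>_\<iota>_simps [simp]: "\<pi> n \<cdot> \<iota> n = Ide M (Pc n)" "m \<noteq> n \<Longrightarrow> \<pi> n \<cdot> \<iota> m = Zero M (Pc m) (Pc n)"
  by (auto simp: \<pi>_\<iota>)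

text \<open>\<open>graded_part\<close> is a description, so its value is known only once the
  inclusion \<open>J n\<close> of the degree n part of the tensor square is shown monic.\<close>

lemma comult_part_aux:
  shows comult_part_in: "\<delta> a b \<in> hom M (Pc (a + b)) (Pc a \<otimes> Pc b)"
    and Comult_\<iota>: "\<Delta> \<cdot> \<iota> n = sum_upto M (\<lambda>a. (\<iota> a \<boxtimes> \<iota> (n - a)) \<cdot> \<delta> a (n - a)) n"
proof -
  define T where "T = tensor_summands M (gobj C) (gobj C)"
  define I where "I n = {(a, b). a + b = (n :: nat)}" for n
  define S where "S n = coproduct M (I n) T" for n
  define J where "J n = cotuple M (I n) (S n) (CC \<otimes> CC) (\<lambda>(a, b). \<iota> a \<boxtimes> \<iota> b)" for n
  define pr where "pr n e = coproduct_proj M (I n) T (S n) e" for n e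
  note defs = T_def I_def S_def J_def pr_def
  have T [simp]: "T (a, b) = Pc a \<otimes> Pc b" for a b
    by (simp add: T_def tensor_summands_def)
  have T_Obj: "T e \<in> Obj M" for e
    by (cases e) simp
  have S: "is_coproduct M (I n) T (S n)" for n
    unfolding S_def by (rule countable_coproduct [OF inj_prod_encode]) (rule T_Obj)
  have I: "(a, b) \<in> I n \<longleftrightarrow> n = a + b" for a b n
    by (auto simp: I_def)
  have inj_in: "snd (S n) (a, b) \<in> hom M (Pc a \<otimes> Pc b) (fst (S n))" if "n = a + b" for a b n
    using is_coproduct_in [OF S, of "(a, b)" n] that I by simp
  have pr_in: "pr n (a, b) \<in> hom M (fst (S n)) (Pc a \<otimes> Pc b)" if "n = a + b" for a b n
    using coproduct_proj_in [OF S T_Obj, of "(a, b)" n] that I by (simp add: pr_def)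
  have SO [simp]: "fst (S n) \<in> Obj M" for n
    using S [of n] by (simp add: is_coproduct_def)
  have "J n \<in> hom M (fst (S n)) (CC \<otimes> CC) \<and> (\<forall>e \<in> I n. J n \<cdot> snd (S n) e = (\<lambda>(a, b). \<iota> a \<boxtimes> \<iota> b) e)" for n
    using cotuple [OF S, of "CC \<otimes> CC" n "\<lambda>(a, b). \<iota> a \<boxtimes> \<iota> b"] by (auto simp: J_def hom_iff split: prod.splits)
  then have J_in: "J n \<in> hom M (fst (S n)) (CC \<otimes> CC)"
    and J: "n = a + b \<Longrightarrow> J n \<cdot> snd (S n) (a, b) = \<iota> a \<boxtimes> \<iota> b" for n a b
    using I by auto
  have J_simps [simp]: "J n \<in> Arr M" "Dom M (J n) = fst (S n)" "Cod M (J n) = CC \<otimes> CC" for n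
    using J_in by (auto simp: hom_iff)
  have \<pi>_J: "(\<pi> a \<boxtimes> \<pi> b) \<cdot> J n = pr n (a, b)" if n: "n = a + b" for a b n
  proof (rule coproduct_ext [OF S])
    fix e assume "e \<in> I n"
    then obtain a' b' where e: "e = (a', b')" "n = a' + b'"
      by (cases e) (auto simp: I)
    have "((\<pi> a \<boxtimes> \<pi> b) \<cdot> J n) \<cdot> snd (S n) e = (\<pi> a \<cdot> \<iota> a') \<boxtimes> (\<pi> b \<cdot> \<iota> b')" (is "?l = _")
      using inj_in [OF e(2)] J [OF e(2)] e by (simp add: hom_iff merge)
    also have "\<dots> = (if e = (a, b) then Ide M (T (a, b)) else Zero M (T e) (T (a, b)))"
      using e n by (cases "a = a'") auto
    also have "\<dots> = pr n (a, b) \<cdot> snd (S n) e" (is "_ = ?r")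
      using coproduct_proj_Comp [OF S T_Obj, of "(a, b)" n e] e n I by (simp add: pr_def)
    finally show "?l = ?r" .
  qed (use pr_in [OF n] in \<open>auto simp: hom_iff\<close>)
  have bij: "bij_betw (\<lambda>a. (a, n - a)) {..n} (I n)" for n
    by (rule bij_betw_byWitness [where f' = fst]) (auto simp: I_def)
  have Ide_S: "Ide M (fst (S n)) = sum_upto M (\<lambda>a. snd (S n) (a, n - a) \<cdot> pr n (a, n - a)) n" for n
    using Ide_sum_upto [OF S T_Obj bij] by (simp add: pr_def)
  have summand_in: "snd (S n) (a, n - a) \<cdot> pr n (a, n - a) \<in> hom M (fst (S n)) (fst (S n))" if "a \<le> n" for a n
    using Comp_in [OF pr_in inj_in, of n a "n - a"] that by simp
  have mono: "monomorphism M (J n)" for n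
  proof -
    \<comment> \<open>A retraction of \<open>J n\<close>: by \<open>\<pi>_J\<close>, each tensor
      product of projections restricts along \<open>J n\<close> to a coproduct projection, and these
      sum to the identity as in \<open>Ide_S\<close>.\<close>
    let ?r = "sum_upto M (\<lambda>a. snd (S n) (a, n - a) \<cdot> (\<pi> a \<boxtimes> \<pi> (n - a))) n"
    have t: "snd (S n) (a, n - a) \<cdot> (\<pi> a \<boxtimes> \<pi> (n - a)) \<in> hom M (CC \<otimes> CC) (fst (S n))" if "a \<le> n" for a
      using inj_in [of n a "n - a"] that by (simp add: hom_iff)
    have "?r \<cdot> J n = sum_upto M (\<lambda>a. (snd (S n) (a, n - a) \<cdot> (\<pi> a \<boxtimes> \<pi> (n - a))) \<cdot> J n) n"
      by (rule sum_upto_Comp [OF t J_in])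
    also have "\<dots> = Ide M (fst (S n))"
      unfolding Ide_S
    proof (rule sum_upto_cong)
      fix a assume "a \<le> n"
      then show "(snd (S n) (a, n - a) \<cdot> (\<pi> a \<boxtimes> \<pi> (n - a))) \<cdot> J n = snd (S n) (a, n - a) \<cdot> pr n (a, n - a)"
        using inj_in [of n a "n - a"] \<pi>_J [of n a "n - a"] by (simp add: hom_iff)
    qed
    finally show ?thesis
      using sum_upto_in [of n "\<lambda>a. snd (S n) (a, n - a) \<cdot> (\<pi> a \<boxtimes> \<pi> (n - a))", OF t]
      by (intro split_monomorphism [of ?r]) (auto simp: hom_iff)
  qed
  obtain q where q: "\<And>n. q n \<in> hom M (Pc n) (fst (S n))" "\<And>n. \<Delta> \<cdot> \<iota> n = J n \<cdot> q n"
    using graded_coalgebra unfolding is_graded_coalgebra_def graded_morphism_def graded_tensor_def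
    by (auto simp: defs)
  have q_simps [simp]: "q n \<in> Arr M" "Dom M (q n) = Pc n" "Cod M (q n) = fst (S n)" for n
    using q(1) by (auto simp: hom_iff)
  have part: "graded_part M (gobj C) (graded_tensor M (gobj C) (gobj C)) \<Delta> n = q n" for n
  proof -
    have "graded_part M (gobj C) (graded_tensor M (gobj C) (gobj C)) \<Delta> n =
      (THE g. g \<in> hom M (Pc n) (fst (S n)) \<and> \<Delta> \<cdot> \<iota> n = J n \<cdot> g)"
      by (simp add: graded_part_def graded_tensor_def defs)
    also have "\<dots> = q n"
      by (rule the_equality) (use q monomorphismD [OF mono [of n], of _ "q n" "Pc n"] in \<open>auto simp: hom_iff\<close>)
    finally show ?thesis .
  qed
  have \<delta>: "\<delta> a b = pr (a + b) (a, b) \<cdot> q (a + b)" for a b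
    by (simp add: comult_part_def Let_def part defs)
  show "\<delta> a b \<in> hom M (Pc (a + b)) (Pc a \<otimes> Pc b)"
    unfolding \<delta> by (rule Comp_in [OF q(1) pr_in]) simp
  \<comment> \<open>The identity is inserted to be expanded by \<open>Ide_S\<close>, which splits
    \<open>q n\<close> into its components.\<close>
  have "\<Delta> \<cdot> \<iota> n = J n \<cdot> Ide M (fst (S n)) \<cdot> q n"
    by (simp add: q)
  also have "\<dots> = J n \<cdot> sum_upto M (\<lambda>a. (snd (S n) (a, n - a) \<cdot> pr n (a, n - a)) \<cdot> q n) n"
    unfolding Ide_S by (subst sum_upto_Comp [OF summand_in q(1)]) simp_all
  also have "\<dots> = sum_upto M (\<lambda>a. J n \<cdot> (snd (S n) (a, n - a) \<cdot> pr n (a, n - a)) \<cdot> q n) n"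
    by (rule Comp_sum_upto [OF Comp_in [OF q(1) summand_in] J_in])
  also have "\<dots> = sum_upto M (\<lambda>a. (\<iota> a \<boxtimes> \<iota> (n - a)) \<cdot> \<delta> a (n - a)) n"
  proof (rule sum_upto_cong)
    fix a assume a: "a \<le> n"
    have s: "snd (S n) (a, n - a) \<in> hom M (Pc a \<otimes> Pc (n - a)) (fst (S n))" "pr n (a, n - a) \<in> hom M (fst (S n)) (Pc a \<otimes> Pc (n - a))"
      using inj_in [of n a "n - a"] pr_in [of n a "n - a"] a by auto
    have "J n \<cdot> (snd (S n) (a, n - a) \<cdot> pr n (a, n - a)) \<cdot> q n = (J n \<cdot> snd (S n) (a, n - a)) \<cdot> pr n (a, n - a) \<cdot> q n"
      using s by (simp add: hom_iff)
    then show "J n \<cdot> (snd (S n) (a, n - a) \<cdot> pr n (a, n - a)) \<cdot> q n = (\<iota> a \<boxtimes> \<iota> (n - a)) \<cdot> \<delta> a (n - a)"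
      using J [of n a "n - a"] a by (simp add: \<delta>)
  qed
  finally show "\<Delta> \<cdot> \<iota> n = sum_upto M (\<lambda>a. (\<iota> a \<boxtimes> \<iota> (n - a)) \<cdot> \<delta> a (n - a)) n" .
qed

lemma \<delta>_simps [simp]: "\<delta> a b \<in> Arr M" "Dom M (\<delta> a b) = Pc (a + b)" "Cod M (\<delta> a b) = Pc a \<otimes> Pc b"
  using comult_part_in by (auto simp: hom_iff)

sublocale GC: graded_comultiplication M "gobj C" \<Delta> \<delta>
  by unfold_locales (use graded Comult_\<iota> in \<open>auto simp: hom_iff\<close>)

lemmas tensor_Comult_\<iota>_single = GC.tensor_comult_Inj_single [unfolded gobj_simps]
lemmas tensor_Comult_\<iota>_Zero = GC.tensor_comult_Inj_Zero [unfolded gobj_simps]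
lemmas \<pi>_tensor_Comult = GC.Proj_tensor_comult [unfolded gobj_simps]

text \<open>Coassociativity of \<Delta>, followed by the projections to degrees a, b and c and
  restricted to degree a + b + c.\<close>

lemma \<delta>_coassoc:
  "\<a> (Pc a) (Pc b) (Pc c) \<cdot> (\<delta> a b \<rhd> Pc c) \<cdot> \<delta> (a + b) c = (Pc a \<lhd> \<delta> b c) \<cdot> \<delta> a (b + c)"
proof -
  let ?n = "a + b + c"
  have "\<a> (Pc a) (Pc b) (Pc c) \<cdot> (\<delta> a b \<rhd> Pc c) \<cdot> \<delta> (a + b) c
    = \<a> (Pc a) (Pc b) (Pc c) \<cdot> (\<delta> a b \<rhd> Pc c) \<cdot> (\<delta> (a + b) c \<cdot> \<pi> (a + b + c)) \<cdot> \<iota> ?n"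
    by simp
  also have "\<dots> = (\<a> (Pc a) (Pc b) (Pc c) \<cdot> ((\<delta> a b \<cdot> \<pi> (a + b)) \<boxtimes> \<pi> c) \<cdot> \<Delta>) \<cdot> \<iota> ?n"
    unfolding \<pi>_tensor_Comult [symmetric, of "a + b" c] by (simp add: merge)
  also have "\<a> (Pc a) (Pc b) (Pc c) \<cdot> ((\<delta> a b \<cdot> \<pi> (a + b)) \<boxtimes> \<pi> c) \<cdot> \<Delta> = (\<pi> a \<boxtimes> (\<delta> b c \<cdot> \<pi> (b + c))) \<cdot> \<Delta>"
    unfolding \<pi>_tensor_Comult [symmetric] using C.coassoc_map [of "\<pi> a" "\<pi> b" "\<pi> c"] by simp
  also have "((\<pi> a \<boxtimes> (\<delta> b c \<cdot> \<pi> (b + c))) \<cdot> \<Delta>) \<cdot> \<iota> ?n = (Pc a \<lhd> \<delta> b c) \<cdot> ((\<pi> a \<boxtimes> \<pi> (b + c)) \<cdot> \<Delta>) \<cdot> \<iota> ?n"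
    by (simp add: merge)
  also have "\<dots> = (Pc a \<lhd> \<delta> b c) \<cdot> \<delta> a (b + c)"
    unfolding \<pi>_tensor_Comult by (simp add: add.assoc)
  finally show ?thesis .
qed

lemma Counit_laws:
  "LUnit M CC \<cdot> (\<epsilon> \<rhd> CC) \<cdot> \<Delta> = Ide M CC" "RUnit M CC \<cdot> (CC \<lhd> \<epsilon>) \<cdot> \<Delta> = Ide M CC"
  using coalgebra by (auto simp: is_coalgebra_def)

lemma LUnit_Comult: "f \<in> Arr M \<Longrightarrow> Dom M f = CC \<Longrightarrow> LUnit M (Cod M f) \<cdot> (\<epsilon> \<boxtimes> f) \<cdot> \<Delta> = f"
proof -
  assume [simp]: "f \<in> Arr M" "Dom M f = CC"
  have "LUnit M (Cod M f) \<cdot> (\<epsilon> \<boxtimes> f) \<cdot> \<Delta> = (LUnit M (Cod M f) \<cdot> (\<one> \<lhd> f)) \<cdot> (\<epsilon> \<rhd> CC) \<cdot> \<Delta>"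
    by (simp add: merge)
  also have "\<dots> = f \<cdot> LUnit M CC \<cdot> (\<epsilon> \<rhd> CC) \<cdot> \<Delta>"
    by (subst LUnit_natural [of f CC]) (auto simp: hom_iff)
  finally show ?thesis
    by (simp add: Counit_laws)
qed

lemma RUnit_Comult: "f \<in> Arr M \<Longrightarrow> Dom M f = CC \<Longrightarrow> RUnit M (Cod M f) \<cdot> (f \<boxtimes> \<epsilon>) \<cdot> \<Delta> = f"
proof -
  assume [simp]: "f \<in> Arr M" "Dom M f = CC"
  have "RUnit M (Cod M f) \<cdot> (f \<boxtimes> \<epsilon>) \<cdot> \<Delta> = (RUnit M (Cod M f) \<cdot> (f \<rhd> \<one>)) \<cdot> (CC \<lhd> \<epsilon>) \<cdot> \<Delta>"
    by (simp add: merge)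
  also have "\<dots> = f \<cdot> RUnit M CC \<cdot> (CC \<lhd> \<epsilon>) \<cdot> \<Delta>"
    by (subst RUnit_natural [of f CC]) (auto simp: hom_iff)
  finally show ?thesis
    by (simp add: Counit_laws)
qed

lemma LUnit_\<delta>: "LUnit M (Pc n) \<cdot> ((\<epsilon> \<cdot> \<iota> 0) \<rhd> Pc n) \<cdot> \<delta> 0 n = Ide M (Pc n)"
proof -
  have "(\<epsilon> \<boxtimes> \<pi> n) \<cdot> \<Delta> \<cdot> \<iota> n = ((\<epsilon> \<cdot> \<iota> 0) \<boxtimes> (\<pi> n \<cdot> \<iota> (n - 0))) \<cdot> \<delta> 0 (n - 0)"
    by (rule tensor_Comult_\<iota>_single) (auto simp: hom_iff)
  then show ?thesis
    using Comp_tail [OF LUnit_Comult [of "\<pi> n"], of "\<iota> n"] by simp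
qed

lemma RUnit_\<delta>: "RUnit M (Pc n) \<cdot> (Pc n \<lhd> (\<epsilon> \<cdot> \<iota> 0)) \<cdot> \<delta> n 0 = Ide M (Pc n)"
proof -
  have "(\<pi> n \<boxtimes> \<epsilon>) \<cdot> \<Delta> \<cdot> \<iota> n = ((\<pi> n \<cdot> \<iota> n) \<boxtimes> (\<epsilon> \<cdot> \<iota> (n - n))) \<cdot> \<delta> n (n - n)"
    by (rule tensor_Comult_\<iota>_single) (auto simp: hom_iff)
  then show ?thesis
    using Comp_tail [OF RUnit_Comult [of "\<pi> n"], of "\<iota> n"] by simp
qed

text \<open>The counit laws in degree n exhibit explicit retractions. These are the components that
  the comparison with the cotensor coalgebra does not reach.\<close>

lemma \<delta>_0_monomorphism: "monomorphism M (\<delta> 0 n)" "monomorphism M (\<delta> n 0)"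
  using split_monomorphism [of "LUnit M (Pc n) \<cdot> ((\<epsilon> \<cdot> \<iota> 0) \<rhd> Pc n)" "\<delta> 0 n"]
    split_monomorphism [of "RUnit M (Pc n) \<cdot> (Pc n \<lhd> (\<epsilon> \<cdot> \<iota> 0))" "\<delta> n 0"]
  by (simp_all add: LUnit_\<delta> RUnit_\<delta>)

text \<open>Applying the counit to the left factor of \<Delta> and \<pi> 0 to the right one gives
  \<pi> 0, which vanishes in degree \<open>n\<close>; so \<open>((\<epsilon> \<cdot> \<iota> n)
  \<rhd> Pc 0) \<cdot> \<delta> n 0\<close> is zero. Applying the counit to the remaining factor
  recovers \<open>\<epsilon> \<cdot> \<iota> n\<close>.\<close>

lemma Counit_\<iota>:
  assumes "n \<noteq> 0"
  shows "\<epsilon> \<cdot> \<iota> n = Zero M (Pc n) \<one>"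
proof -
  have "(\<epsilon> \<boxtimes> \<pi> 0) \<cdot> \<Delta> \<cdot> \<iota> n = ((\<epsilon> \<cdot> \<iota> n) \<boxtimes> (\<pi> 0 \<cdot> \<iota> (n - n))) \<cdot> \<delta> n (n - n)"
    by (rule tensor_Comult_\<iota>_single) (auto simp: hom_iff)
  moreover have "LUnit M (Pc 0) \<cdot> (\<epsilon> \<boxtimes> \<pi> 0) \<cdot> \<Delta> \<cdot> \<iota> n = Zero M (Pc n) (Pc 0)"
    using Comp_tail [OF LUnit_Comult [of "\<pi> 0"], of "\<iota> n"] assms by simp
  ultimately have "LUnit M (Pc 0) \<cdot> ((\<epsilon> \<cdot> \<iota> n) \<rhd> Pc 0) \<cdot> \<delta> n 0 = Zero M (Pc n) (Pc 0)"
    by simp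
  moreover have "monomorphism M (LUnit M (Pc 0))"
    using LUnit_in isomorphism_monomorphism by simp
  ultimately have Zero: "((\<epsilon> \<cdot> \<iota> n) \<rhd> Pc 0) \<cdot> \<delta> n 0 = Zero M (Pc n) (\<one> \<otimes> Pc 0)"
    using monomorphism_ZeroD [of "LUnit M (Pc 0)" "((\<epsilon> \<cdot> \<iota> n) \<rhd> Pc 0) \<cdot> \<delta> n 0" "Pc n"] by (simp add: hom_iff)
  have "\<epsilon> \<cdot> \<iota> n = (\<epsilon> \<cdot> \<iota> n) \<cdot> RUnit M (Pc n) \<cdot> (Pc n \<lhd> (\<epsilon> \<cdot> \<iota> 0)) \<cdot> \<delta> n 0"
    by (simp add: RUnit_\<delta>)
  also have "\<dots> = ((\<epsilon> \<cdot> \<iota> n) \<cdot> RUnit M (Pc n)) \<cdot> (Pc n \<lhd> (\<epsilon> \<cdot> \<iota> 0)) \<cdot> \<delta> n 0"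
    by simp
  also have "\<dots> = RUnit M \<one> \<cdot> (\<one> \<lhd> (\<epsilon> \<cdot> \<iota> 0)) \<cdot> ((\<epsilon> \<cdot> \<iota> n) \<rhd> Pc 0) \<cdot> \<delta> n 0"
    by (subst RUnit_natural [symmetric, of "\<epsilon> \<cdot> \<iota> n" "Pc n" \<one>]) (auto simp: hom_iff merge)
  also have "\<dots> = Zero M (Pc n) \<one>"
    unfolding Zero by simp
  finally show ?thesis .
qed

lemma Counit_\<pi>: "\<epsilon> \<cdot> \<iota> 0 \<cdot> \<pi> 0 = \<epsilon>"
proof (rule graded_ext [OF graded])
  fix n
  show "(\<epsilon> \<cdot> \<iota> 0 \<cdot> \<pi> 0) \<cdot> Inj (gobj C) n = \<epsilon> \<cdot> Inj (gobj C) n"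
    by (cases "n = 0") (auto simp: Counit_\<iota>)
qed (auto simp: hom_iff)

section \<open>The universal morphism\<close>

definition Z0 where "Z0 = zero_part M C"

definition V where "V = degree_part_bicomodule M C 1"

definition B where "B = induced_bicomodule M C (\<pi> 0)"

definition T where "T = Tc M C"

lemma Z0_simps: "Car Z0 = Pc 0" "Comult Z0 = \<delta> 0 0" "Counit Z0 = \<epsilon> \<cdot> \<iota> 0"
  by (simp_all add: Z0_def zero_part_def)

sublocale Z: comultiplicative_family M Z0 Pc \<delta> V
  by unfold_locales
    (use \<delta>_coassoc [of 0 0 0] \<delta>_coassoc in
      \<open>auto simp: Z0_simps V_def degree_part_bicomodule_def hom_iff\<close>)

abbreviation Tn where "Tn n \<equiv> cotensor_pow M Z0 V n"
abbreviation TO where "TO n \<equiv> BCar (Tn n)"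

text \<open>Taken on all of the coalgebra rather than on degree \<open>n\<close>, so that its
  recursion involves \<Delta> itself; \<open>\<psi>c\<close> restricts it.\<close>

definition \<phi> where
  "\<phi> n = cotensor_pow_arr M Z0 B V (\<pi> 1) n \<cdot> cotensor_iterated_comult M C Z0 (\<pi> 0) n"

lemma \<phi>:
  shows \<phi>_0: "\<phi> 0 = \<pi> 0" and \<phi>_1: "\<phi> (Suc 0) = \<pi> (Suc 0)" and \<phi>_in: "\<phi> n \<in> hom M CC (TO n)"
    and \<phi>_Suc: "Z.inc (Tn (Suc n)) V \<cdot> \<phi> (Suc (Suc n)) = (\<phi> (Suc n) \<boxtimes> \<pi> (Suc 0)) \<cdot> \<Delta>"
    and \<phi>_\<iota>: "\<phi> n \<cdot> \<iota> m = cotensor_pow_arr M Z0 B V (\<pi> 1) n \<cdot> cotensor_iterated_comult M C Z0 (\<pi> 0) n \<cdot> \<iota> m"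
proof -
  have p: "\<pi> 0 \<in> hom M CC (Car Z0)" "Comult Z0 \<cdot> \<pi> 0 = (\<pi> 0 \<boxtimes> \<pi> 0) \<cdot> \<Delta>"
    using \<pi>_tensor_Comult [of 0 0] by (auto simp: Z0_simps hom_iff)
  have "Z.rcolin B V (\<pi> 1)" "Z.lcolin B V (\<pi> 1)"
    using \<pi>_tensor_Comult [of 0 "Suc 0"] \<pi>_tensor_Comult [of "Suc 0" 0]
    by (simp_all add: Z.rcolin_def Z.lcolin_def B_def induced_bicomodule_def Z.V_simps Z0_simps hom_iff merge)
  note * = Z.cotensor_pow_arr_iterated_comult [OF C.coassociative_comultiplication_axioms p Z.bicomod_V
      this [unfolded B_def], folded B_def, folded \<phi>_def]
  show "\<phi> 0 = \<pi> 0" "\<phi> (Suc 0) = \<pi> (Suc 0)" "\<phi> n \<in> hom M CC (TO n)"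
    "Z.inc (Tn (Suc n)) V \<cdot> \<phi> (Suc (Suc n)) = (\<phi> (Suc n) \<boxtimes> \<pi> (Suc 0)) \<cdot> \<Delta>"
    using *(1-4) by simp_all
  show "\<phi> n \<cdot> \<iota> m = cotensor_pow_arr M Z0 B V (\<pi> 1) n \<cdot> cotensor_iterated_comult M C Z0 (\<pi> 0) n \<cdot> \<iota> m"
    by (rule *(5)) (simp add: hom_iff)
qed

lemma \<phi>_simps [simp]: "\<phi> n \<in> Arr M" "Dom M (\<phi> n) = CC" "Cod M (\<phi> n) = TO n"
  using \<phi>_in by (auto simp: hom_iff)

definition \<psi>c where "\<psi>c n = \<phi> n \<cdot> \<iota> n"

text \<open>The recursion for \<phi> restricted to degree n + 2: the projection to degree 1 leaves
  only the component of degrees (n + 1, 1).\<close>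

lemma \<psi>c_Suc: "Z.inc (Tn (Suc n)) V \<cdot> \<psi>c (Suc (Suc n)) = (\<psi>c (Suc n) \<rhd> Pc (Suc 0)) \<cdot> \<delta> (Suc n) (Suc 0)"
proof -
  have "Z.inc (Tn (Suc n)) V \<cdot> \<psi>c (Suc (Suc n)) = (\<phi> (Suc n) \<boxtimes> \<pi> (Suc 0)) \<cdot> \<Delta> \<cdot> \<iota> (Suc (Suc n))"
    unfolding \<psi>c_def using Comp_tail [OF \<phi>_Suc, of "\<iota> (Suc (Suc n))" n] by simp
  also have "\<dots> = ((\<phi> (Suc n) \<cdot> \<iota> (Suc n)) \<boxtimes> (\<pi> (Suc 0) \<cdot> \<iota> (Suc (Suc n) - Suc n))) \<cdot> \<delta> (Suc n) (Suc (Suc n) - Suc n)"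
    by (rule tensor_Comult_\<iota>_single [where Y = "TO (Suc n)" and Z = "Pc (Suc 0)"]) (auto simp: hom_iff \<pi>_\<iota>)
  finally show ?thesis
    by (simp add: \<psi>c_def)
qed

sublocale F: cotensor_family M Z0 Pc \<delta> V \<psi>c
  by unfold_locales (use \<psi>c_Suc in \<open>auto simp: \<psi>c_def \<phi>_0 \<phi>_1 hom_iff\<close>)

section \<open>The cotensor coalgebra and the homomorphism into it\<close>

abbreviation \<delta>T where "\<delta>T a b \<equiv> cotensor_comult_part M Z0 V a b"
abbreviation \<iota>T where "\<iota>T n \<equiv> Incl T n"
abbreviation \<pi>T where "\<pi>T n \<equiv> proj M T n"
abbreviation CT where "CT \<equiv> Car T"

lemma T_coproduct: "is_coproduct M UNIV (\<lambda>n. TO n) (CT, Incl T)"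
  and Piece_T: "Piece T = (\<lambda>n. TO n)"
  and Comult_T: "Comult T = cotuple M UNIV (CT, Incl T) (CT \<otimes> CT)
     (\<lambda>n. sum_upto M (\<lambda>a. (\<iota>T a \<boxtimes> \<iota>T (n - a)) \<cdot> \<delta>T a (n - a)) n)"
  and Counit_T: "Counit T = \<epsilon> \<cdot> \<iota> 0 \<cdot> \<pi>T 0"
proof -
  let ?S = "coproduct M (UNIV :: nat set) (\<lambda>n. TO n)"
  have "is_coproduct M UNIV (\<lambda>n. TO n) ?S"
    by (rule countable_coproduct [where g = "\<lambda>n. n"]) auto
  moreover have T: "CT = fst ?S" "Incl T = snd ?S"
    by (simp_all add: T_def Tc_def cotensor_coalgebra_def Let_def Z0_def V_def)
  ultimately show S: "is_coproduct M UNIV (\<lambda>n. TO n) (CT, Incl T)"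
    by simp
  show P: "Piece T = (\<lambda>n. TO n)"
    by (simp add: T_def Tc_def cotensor_coalgebra_def Let_def Z0_def V_def)
  show "Comult T = cotuple M UNIV (CT, Incl T) (CT \<otimes> CT)
     (\<lambda>n. sum_upto M (\<lambda>a. (\<iota>T a \<boxtimes> \<iota>T (n - a)) \<cdot> \<delta>T a (n - a)) n)"
    unfolding T by (simp add: T_def Tc_def cotensor_coalgebra_def Let_def Z0_def V_def)
  have "Counit T = Counit Z0 \<cdot> coproduct_proj M UNIV (\<lambda>n. TO n) ?S 0"
    by (simp add: T_def Tc_def cotensor_coalgebra_def Let_def Z0_def V_def)
  also have "coproduct_proj M UNIV (\<lambda>n. TO n) ?S 0 = \<pi>T 0"
    by (simp add: Proj_def gobj_def P T)
  finally show "Counit T = \<epsilon> \<cdot> \<iota> 0 \<cdot> \<pi>T 0"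
    using coproduct_proj_in [OF S, of 0]
    by (simp add: Z0_simps Proj_def gobj_def P hom_iff regular_bicomodule_def)
qed

lemma gobj_T_simps [simp]: "Tot (gobj T) = CT" "Deg (gobj T) = (\<lambda>n. TO n)" "Inj (gobj T) = Incl T"
  by (simp_all add: gobj_def Piece_T)

lemma graded_T: "is_graded_object M (gobj T)"
  using T_coproduct by (simp add: is_graded_object_def)

lemma T_simps [simp]: "CT \<in> Obj M" "\<iota>T n \<in> Arr M" "Dom M (\<iota>T n) = TO n" "Cod M (\<iota>T n) = CT"
    "\<pi>T n \<in> Arr M" "Dom M (\<pi>T n) = CT" "Cod M (\<pi>T n) = TO n"
  using Tot_Obj [OF graded_T] Inj_simps [OF graded_T, of n] Proj_simps [OF graded_T, of n] by simp_all

lemma \<pi>T_\<iota>T: "\<pi>T n \<cdot> \<iota>T m = (if m = n then Ide M (TO n) else Zero M (TO m) (TO n))"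
  using Proj_Inj [OF graded_T] by simp

lemma Comult_T_aux:
  shows Comult_T_in: "Comult T \<in> hom M CT (CT \<otimes> CT)"
    and Comult_T_\<iota>T: "Comult T \<cdot> \<iota>T n = sum_upto M (\<lambda>a. (\<iota>T a \<boxtimes> \<iota>T (n - a)) \<cdot> \<delta>T a (n - a)) n"
proof -
  have t: "sum_upto M (\<lambda>a. (\<iota>T a \<boxtimes> \<iota>T (n - a)) \<cdot> \<delta>T a (n - a)) n \<in> hom M (TO n) (CT \<otimes> CT)" for n
    by (rule sum_upto_in) (auto simp: hom_iff)
  show "Comult T \<in> hom M CT (CT \<otimes> CT)"
    "Comult T \<cdot> \<iota>T n = sum_upto M (\<lambda>a. (\<iota>T a \<boxtimes> \<iota>T (n - a)) \<cdot> \<delta>T a (n - a)) n"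
    unfolding Comult_T using cotuple [OF T_coproduct _ t] by auto
qed

sublocale GT: graded_comultiplication M "gobj T" "Comult T" \<delta>T
  by unfold_locales (use graded_T Comult_T_in Comult_T_\<iota>T in \<open>auto simp: hom_iff\<close>)

definition \<Psi> where "\<Psi> = cotuple M UNIV (CC, \<iota>) CT (\<lambda>n. \<iota>T n \<cdot> \<psi>c n)"

lemma \<Psi>_in: "\<Psi> \<in> hom M CC CT" and \<Psi>_\<iota>: "\<Psi> \<cdot> \<iota> n = \<iota>T n \<cdot> \<psi>c n"
  using cotuple [OF graded_coproduct [OF graded], of CT "\<lambda>n. \<iota>T n \<cdot> \<psi>c n"] by (auto simp: \<Psi>_def hom_iff)

lemma \<Psi>_simps [simp]: "\<Psi> \<in> Arr M" "Dom M \<Psi> = CC" "Cod M \<Psi> = CT"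
  using \<Psi>_in by (auto simp: hom_iff)

lemma \<pi>T_\<Psi>: "\<pi>T n \<cdot> \<Psi> = \<psi>c n \<cdot> \<pi> n"
proof (rule graded_ext [OF graded, where Y = "TO n"])
  fix m
  have "(\<pi>T n \<cdot> \<Psi>) \<cdot> \<iota> m = (\<pi>T n \<cdot> \<iota>T m) \<cdot> \<psi>c m"
    by (simp add: \<Psi>_\<iota>)
  also have "\<dots> = (\<psi>c n \<cdot> \<pi> n) \<cdot> \<iota> m"
    by (cases "m = n") (simp_all add: \<pi>T_\<iota>T del: Comp_Comp, simp_all)
  finally show "(\<pi>T n \<cdot> \<Psi>) \<cdot> Inj (gobj C) m = (\<psi>c n \<cdot> \<pi> n) \<cdot> Inj (gobj C) m"
    by simp
qed (auto simp: hom_iff)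

definition is_\<psi> where
  "is_\<psi> f \<longleftrightarrow> coalgebra_hom M C T f \<and> \<pi>T 0 \<cdot> f = \<pi> 0 \<and> \<pi>T 1 \<cdot> f = \<pi> 1"

text \<open>On each degree both sides of the comultiplication condition are sums that agree term by
  term, by \<open>F.comult_part_\<psi>\<close>. Both counits factor through degree 0, where
  \<open>\<psi>c\<close> is the identity.\<close>

lemma is_\<psi>_\<Psi>: "is_\<psi> \<Psi>"
proof -
  have "Comult T \<cdot> \<Psi> = (\<Psi> \<boxtimes> \<Psi>) \<cdot> \<Delta>"
  proof (rule graded_ext [OF graded, where Y = "CT \<otimes> CT"])
    fix n
    have "(Comult T \<cdot> \<Psi>) \<cdot> \<iota> n = (Comult T \<cdot> \<iota>T n) \<cdot> \<psi>c n"
      using GT.H_simps by (simp add: \<Psi>_\<iota>)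
    also have "\<dots> = sum_upto M (\<lambda>a. ((\<iota>T a \<boxtimes> \<iota>T (n - a)) \<cdot> \<delta>T a (n - a)) \<cdot> \<psi>c n) n"
      unfolding Comult_T_\<iota>T
      by (rule sum_upto_Comp [where A = "Pc n" and B = "TO n" and C = "CT \<otimes> CT"]) (auto simp: hom_iff)
    also have "\<dots> = sum_upto M (\<lambda>a. ((\<Psi> \<cdot> \<iota> a) \<boxtimes> (\<Psi> \<cdot> \<iota> (n - a))) \<cdot> \<delta> a (n - a)) n"
    proof (rule sum_upto_cong)
      fix a assume "a \<le> n"
      then have "\<delta>T a (n - a) \<cdot> \<psi>c n = (\<psi>c a \<boxtimes> \<psi>c (n - a)) \<cdot> \<delta> a (n - a)"
        using F.comult_part_\<psi> [of a "n - a"] by simp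
      then show "((\<iota>T a \<boxtimes> \<iota>T (n - a)) \<cdot> \<delta>T a (n - a)) \<cdot> \<psi>c n =
          ((\<Psi> \<cdot> \<iota> a) \<boxtimes> (\<Psi> \<cdot> \<iota> (n - a))) \<cdot> \<delta> a (n - a)"
        using \<open>a \<le> n\<close> by (simp add: merge \<Psi>_\<iota>)
    qed
    also have "\<dots> = (\<Psi> \<boxtimes> \<Psi>) \<cdot> \<Delta> \<cdot> \<iota> n"
      using GC.tensor_comult_Inj [of \<Psi> CT \<Psi> CT n] \<Psi>_in by simp
    finally show "(Comult T \<cdot> \<Psi>) \<cdot> Inj (gobj C) n = ((\<Psi> \<boxtimes> \<Psi>) \<cdot> \<Delta>) \<cdot> Inj (gobj C) n"
      by simp
  qed (use GT.H_simps in \<open>auto simp: hom_iff\<close>)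
  moreover have "Counit T \<cdot> \<Psi> = \<epsilon>"
    unfolding Counit_T using \<pi>T_\<Psi> [of 0] Counit_\<pi> F.\<psi>_0
    by (simp add: regular_bicomodule_def Z0_simps)
  moreover have "\<pi>T 0 \<cdot> \<Psi> = \<pi> 0" "\<pi>T 1 \<cdot> \<Psi> = \<pi> 1"
    by (simp_all add: \<pi>T_\<Psi> F.\<psi>_0 F.\<psi>_1)
  ultimately show ?thesis
    by (simp add: is_\<psi>_def coalgebra_hom_def \<Psi>_in)
qed

lemma is_\<psi>_unique:
  assumes f: "is_\<psi> f" and g: "is_\<psi> g"
  shows "f = g"
proof -
  have step: "Z.inc (Tn (Suc n)) V \<cdot> \<pi>T (Suc (Suc n)) \<cdot> f = ((\<pi>T (Suc n) \<cdot> f) \<boxtimes> \<pi> (Suc 0)) \<cdot> \<Delta>"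
    if f: "is_\<psi> f" for f n
  proof -
    have [simp]: "f \<in> Arr M" "Dom M f = CC" "Cod M f = CT" and f_Comult: "Comult T \<cdot> f = (f \<boxtimes> f) \<cdot> \<Delta>"
      and f_1: "\<pi>T (Suc 0) \<cdot> f = \<pi> (Suc 0)"
      using f by (auto simp: is_\<psi>_def coalgebra_hom_def hom_iff)
    \<comment> \<open>The component of \<open>Comult T\<close> in degrees (n + 1, 1) is the
      inclusion itself; this is what ties degree n + 2 of \<open>f\<close> to degrees n + 1 and
      1.\<close>
    have "Z.inc (Tn (Suc n)) V \<cdot> \<pi>T (Suc (Suc n)) \<cdot> f = (\<pi>T (Suc n) \<boxtimes> \<pi>T (Suc 0)) \<cdot> Comult T \<cdot> f"
      using Comp_tail [OF GT.Proj_tensor_comult [of "Suc n" "Suc 0"], of f] GT.H_simps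
        Z.cotensor_comult_part_Suc_1 [OF Z.bicomod_V, of n]
      by (simp add: Z.V_simps)
    then show ?thesis
      by (simp add: f_Comult f_1 merge)
  qed
  have f_in: "f \<in> hom M CC CT" "g \<in> hom M CC CT"
    using f g by (auto simp: is_\<psi>_def coalgebra_hom_def)
  have Suc: "\<pi>T (Suc n) \<cdot> f = \<pi>T (Suc n) \<cdot> g" for n
  proof (induction n)
    case 0
    then show ?case
      using f g by (simp add: is_\<psi>_def)
  next
    case (Suc n)
    show ?case
      by (rule Z.inc_cancel [OF Z.bicomod_pow Z.bicomod_V, of V "Suc n" _ _ CC])
        (use f_in step [OF f] step [OF g] Suc in \<open>auto simp: hom_iff\<close>)
  qed
  have "\<pi>T n \<cdot> f = \<pi>T n \<cdot> g" for n
    using f g Suc by (cases n) (auto simp: is_\<psi>_def)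
  then show ?thesis
    using Proj_jointly_monic [OF graded_T, of f CC g] f_in by simp
qed

end

context abelian_category begin

lemma zero_object: "is_zero_object M (zero_object M)"
  unfolding zero_object_def using zero_object_exists by (rule someI_ex)

lemma zero_object_Obj [simp]: "zero_object M \<in> Obj M"
  using zero_object by (simp add: is_zero_object_def)

lemma zero_object_unique:
  "f \<in> hom M (zero_object M) A \<Longrightarrow> g \<in> hom M (zero_object M) A \<Longrightarrow> f = g"
  "f \<in> hom M A (zero_object M) \<Longrightarrow> g \<in> hom M A (zero_object M) \<Longrightarrow> f = g"
  using zero_object hom_Obj [of f] unfolding is_zero_object_def by blast+

end

section \<open>Monicity of the homomorphism and of its components\<close>

context graded_coalgebra_AB5 begin

lemma graded_part_\<Psi>: "graded_part M (gobj C) (gobj T) \<Psi> n = \<psi>c n"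
  by (rule graded_partI [OF graded graded_T]) (auto simp: hom_iff \<Psi>_\<iota>)

lemma graded_coalgebra_hom_\<Psi>: "graded_coalgebra_hom M C T \<Psi>"
proof -
  have "\<forall>n. \<psi>c n \<in> hom M (Pc n) (TO n) \<and> \<Psi> \<cdot> \<iota> n = \<iota>T n \<cdot> \<psi>c n"
    by (simp add: hom_iff \<Psi>_\<iota>)
  then have "graded_morphism M (gobj C) (gobj T) \<Psi>"
    using \<Psi>_in by (auto simp: graded_morphism_def)
  then show ?thesis
    using is_\<psi>_\<Psi> by (simp add: graded_coalgebra_hom_def is_\<psi>_def)
qed

lemma \<psi>c_monomorphism:
  assumes "\<And>a. monomorphism M (\<delta> a 1)"
  shows "monomorphism M (\<psi>c n)"
proof -
  have Suc: "monomorphism M (\<psi>c (Suc n))" for n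
  proof (induction n)
    case 0
    then show ?case
      by (simp add: F.\<psi>_1 monomorphism_Ide)
  next
    case (Suc n)
    have "monomorphism M ((\<psi>c (Suc n) \<rhd> Pc (Suc 0)) \<cdot> \<delta> (Suc n) (Suc 0))"
      using assms [of "Suc n"] by (intro monomorphism_Comp monomorphism_TensorA_Ide Suc) auto
    then show ?case
      unfolding \<psi>c_Suc [symmetric]
      by (rule monomorphism_cancel) (auto simp: Z.V_simps)
  qed
  then show ?thesis
    by (cases n) (auto simp: F.\<psi>_0 monomorphism_Ide)
qed

text \<open>For positive degrees the monomorphism
  \<open>\<delta>T a b \<cdot> \<psi>c (a + b)\<close> has \<open>\<delta> a b\<close> as right
  factor; the other degrees are covered by the counit.\<close>

lemma strongly_graded_if_\<psi>c:
  assumes "\<And>n. monomorphism M (\<psi>c n)"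
  shows "strongly_graded M C"
  unfolding strongly_graded_def
proof (intro allI)
  fix a b
  show "monomorphism M (\<delta> a b)"
  proof (cases "a = 0 \<or> b = 0")
    case True
    then show ?thesis
      using \<delta>_0_monomorphism by auto
  next
    case False
    then obtain m n where ab: "a = Suc m" "b = Suc n"
      by (meson not0_implies_Suc)
    have "monomorphism M (\<delta>T a b \<cdot> \<psi>c (a + b))"
      using Z.cotensor_comult_part_monomorphism [OF Z.bicomod_V, of m n] assms
      by (intro monomorphism_Comp) (auto simp: ab)
    then show ?thesis
      unfolding F.comult_part_\<psi> by (rule monomorphism_cancel) auto
  qed
qed

text \<open>One direction restricts to a degree. The other needs AB5: an arrow killed by \<Psi> has
  zero projections, and these detect zero.\<close>

lemma \<Psi>_monomorphism_iff: "monomorphism M \<Psi> \<longleftrightarrow> (\<forall>n. monomorphism M (\<psi>c n))"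
proof (intro iffI allI)
  fix n assume "monomorphism M \<Psi>"
  then have "monomorphism M (\<iota>T n \<cdot> \<psi>c n)"
    unfolding \<Psi>_\<iota> [symmetric]
    using Inj_monomorphism [OF graded, of n] by (intro monomorphism_Comp) auto
  then show "monomorphism M (\<psi>c n)"
    by (rule monomorphism_cancel) auto
next
  assume mono: "\<forall>n. monomorphism M (\<psi>c n)"
  show "monomorphism M \<Psi>"
  proof (rule monomorphism_ZeroI [OF \<Psi>_in])
    fix X g assume g: "g \<in> hom M X CC" "\<Psi> \<cdot> g = Zero M X CT"
    then have [simp]: "g \<in> Arr M" "Dom M g = X" "Cod M g = CC" "X \<in> Obj M"
      using hom_Obj by (auto simp: hom_iff)
    show "g = Zero M X CC"
    proof (rule Proj_jointly_monic_Zero [OF graded, unfolded gobj_simps, OF g(1)])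
      fix n
      have "\<psi>c n \<cdot> \<pi> n \<cdot> g = \<pi>T n \<cdot> \<Psi> \<cdot> g"
        using Comp_tail [OF \<pi>T_\<Psi>, of g n] by simp
      also have "\<dots> = Zero M X (TO n)"
        by (simp add: g)
      finally show "\<pi> n \<cdot> g = Zero M X (Pc n)"
        using monomorphism_ZeroD [OF mono [rule_format, of n], of "\<pi> n \<cdot> g" X] by (simp add: hom_iff)
    qed
  qed
qed

section \<open>Wedge powers\<close>

text \<open>Literally the choice made inside \<open>wedge\<close>, so that the two agree by
  unfolding.\<close>

definition pL where "pL = (SOME p. is_cokernel M p (\<iota> 0))"

lemma pL_cokernel: "is_cokernel M pL (\<iota> 0)"
  unfolding pL_def by (rule someI_ex) (simp add: cokernel_exists)

lemma pL_simps [simp]: "pL \<in> Arr M" "Dom M pL = CC" "pL \<cdot> \<iota> 0 = Zero M (Pc 0) (Cod M pL)"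
  using is_cokernel_Arr [OF pL_cokernel] is_cokernel_Zero [OF pL_cokernel] by (auto simp: hom_iff)

lemma pL_retract:
  assumes "n \<noteq> 0"
  obtains r where "r \<in> hom M (Cod M pL) (Pc n)" "r \<cdot> pL = \<pi> n"
  using is_cokernel_factor [OF pL_cokernel, of "\<pi> n" "Pc n"] assms by (auto simp: hom_iff)

text \<open>\<open>w n\<close> is \<open>p\<^bsup>\<otimes>(n+1)\<^esup> \<circ> \<Delta>\<^bsup>n\<^esup>\<close>, whose kernel is the wedge power of exponent \<open>n + 1\<close>.\<close>

fun w :: "nat \<Rightarrow> 'm" where
  "w 0 = pL"
| "w (Suc n) = (w n \<boxtimes> pL) \<cdot> \<Delta>"

lemma w_simps [simp]: "w n \<in> Arr M" "Dom M (w n) = CC"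
  by (induction n) auto

text \<open>Tensor powers and iterated comultiplication are both built on the left, so fusing gives
  the recursion of \<open>w\<close>. The typing facts join the induction because fusing requires
  them.\<close>

lemma w_eq: "tensor_pow_arr M pL (Suc n) \<cdot> iterated_comult M C n = w n"
proof -
  have "tensor_pow_arr M pL (Suc n) \<in> Arr M \<and> iterated_comult M C n \<in> Arr M \<and>
    Dom M (iterated_comult M C n) = CC \<and>
    Dom M (tensor_pow_arr M pL (Suc n)) = Cod M (iterated_comult M C n) \<and>
    tensor_pow_arr M pL (Suc n) \<cdot> iterated_comult M C n = w n"
  proof (induction n)
    case (Suc n)
    then show ?case
      by (simp add: merge)
  qed simp
  then show ?thesis
    by simp
qed

lemma wedge_kernel: "is_kernel M (wedge M C (\<iota> 0) (Suc n)) (w n)"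
proof -
  have "is_kernel M (SOME k. is_kernel M k (w n)) (w n)"
    by (rule someI_ex) (simp add: kernel_exists)
  moreover have "wedge M C (\<iota> 0) (Suc n) = (SOME k. is_kernel M k (w n))"
    using w_eq [of n] by (simp add: wedge_def Let_def pL_def)
  ultimately show ?thesis
    by simp
qed

text \<open>A degree of at most n + 1 splits as a + (m - a) with \<open>a \<le> n\<close>, killed by
  \<open>w n\<close>, or with m - a = 0, killed by \<open>pL\<close>.\<close>

lemma w_\<iota>: "m \<le> n \<Longrightarrow> w n \<cdot> \<iota> m = Zero M (Pc m) (Cod M (w n))"
proof (induction n arbitrary: m)
  case 0
  then show ?case
    by simp
next
  case (Suc n)
  have "(w n \<boxtimes> pL) \<cdot> \<Delta> \<cdot> \<iota> m = Zero M (Pc m) (Cod M (w n) \<otimes> Cod M pL)"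
  proof (rule tensor_Comult_\<iota>_Zero)
    fix a assume "a \<le> m"
    then consider "a \<le> n" | "m - a = 0"
      using Suc.prems by linarith
    then show "w n \<cdot> \<iota> a = Zero M (Pc a) (Cod M (w n)) \<or> pL \<cdot> \<iota> (m - a) = Zero M (Pc (m - a)) (Cod M pL)"
      by cases (use Suc.IH in auto)
  qed (auto simp: hom_iff)
  then show ?case
    by simp
qed

text \<open>\<open>r\<close> tensors factorizations through \<open>pL\<close> of \<pi> k and of
  \<open>n\<close> copies of \<pi> 1; this is why \<open>k\<close> must be nonzero. \<open>e\<close>
  collects the components splitting off degree 1, one at a time.\<close>

lemma w_\<pi>:
  assumes mono: "\<And>a. monomorphism M (\<delta> a 1)" and "k \<noteq> 0"
  obtains r e where "monomorphism M e" "Dom M e = Pc (k + n)" "r \<in> hom M (Cod M (w n)) (Cod M e)"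
    "r \<cdot> w n = e \<cdot> \<pi> (k + n)"
proof -
  have "\<exists>r e. monomorphism M e \<and> Dom M e = Pc (k + n) \<and> r \<in> hom M (Cod M (w n)) (Cod M e) \<and>
    r \<cdot> w n = e \<cdot> \<pi> (k + n)"
  proof (induction n)
    case 0
    obtain r where "r \<in> hom M (Cod M pL) (Pc k)" "r \<cdot> pL = \<pi> k"
      using pL_retract [OF \<open>k \<noteq> 0\<close>] .
    then show ?case
      by (intro exI [of _ r] exI [of _ "Ide M (Pc k)"]) (auto simp: monomorphism_Ide)
  next
    case (Suc n)
    then obtain r e where e: "monomorphism M e" "Dom M e = Pc (k + n)" "r \<in> hom M (Cod M (w n)) (Cod M e)"
      "r \<cdot> w n = e \<cdot> \<pi> (k + n)"
      by blast
    obtain s where s: "s \<in> hom M (Cod M pL) (Pc (Suc 0))" "s \<cdot> pL = \<pi> (Suc 0)"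
      using pL_retract [of "Suc 0"] by auto
    have [simp]: "e \<in> Arr M" "Dom M e = Pc (k + n)" "r \<in> Arr M" "Dom M r = Cod M (w n)" "Cod M r = Cod M e"
      "s \<in> Arr M" "Dom M s = Cod M pL" "Cod M s = Pc (Suc 0)"
      using e s monomorphism_Arr by (auto simp: hom_iff)
    have "(r \<boxtimes> s) \<cdot> w (Suc n) = ((e \<cdot> \<pi> (k + n)) \<boxtimes> \<pi> (Suc 0)) \<cdot> \<Delta>" (is "?l = _")
      using e(4) s(2) by (simp add: merge)
    also have "\<dots> = (e \<rhd> Pc (Suc 0)) \<cdot> (\<pi> (k + n) \<boxtimes> \<pi> (Suc 0)) \<cdot> \<Delta>"
      by (simp add: merge)
    also have "\<dots> = ((e \<rhd> Pc (Suc 0)) \<cdot> \<delta> (k + n) (Suc 0)) \<cdot> \<pi> (k + Suc n)" (is "_ = ?r")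
      unfolding \<pi>_tensor_Comult by simp
    finally have "?l = ?r" .
    moreover have "monomorphism M ((e \<rhd> Pc (Suc 0)) \<cdot> \<delta> (k + n) (Suc 0))"
      using mono [of "k + n"] by (intro monomorphism_Comp monomorphism_TensorA_Ide e) auto
    ultimately show ?case
      by (intro exI [of _ "r \<boxtimes> s"] exI [of _ "(e \<rhd> Pc (Suc 0)) \<cdot> \<delta> (k + n) (Suc 0)"]) (auto simp: hom_iff)
  qed
  then show ?thesis
    using that by blast
qed

abbreviation \<sigma> where "\<sigma> n \<equiv> initial_inj M (gobj C) n"

lemmas \<sigma>_simps [simp] = initial_simps [OF graded, unfolded gobj_simps]
lemmas \<rho>_simps [simp] = retr_simps [OF graded, unfolded gobj_simps]
lemmas trunc_C = trunc_coproduct [OF graded, unfolded gobj_simps]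

text \<open>By \<open>w_\<pi>\<close> an arrow killed by \<open>w n\<close> has no component in
  degrees above \<open>n\<close>. Joint monicity then identifies it with its truncation.\<close>

lemma \<sigma>_kernel:
  assumes mono: "\<And>a. monomorphism M (\<delta> a 1)"
  shows "is_kernel M (\<sigma> (Suc n)) (w n)"
proof (rule is_kernelI)
  show "monomorphism M (\<sigma> (Suc n))"
    by (rule initial_monomorphism [OF graded])
  show "w n \<cdot> \<sigma> (Suc n) = Zero M (Dom M (\<sigma> (Suc n))) (Cod M (w n))"
  proof (rule coproduct_ext [OF trunc_C, where Y = "Cod M (w n)"])
    fix k assume k: "k \<in> {..<Suc n}"
    then have \<tau>: "snd (trunc (gobj C) (Suc n)) k \<in> hom M (Pc k) (fst (trunc (gobj C) (Suc n)))"
      "\<sigma> (Suc n) \<cdot> snd (trunc (gobj C) (Suc n)) k = \<iota> k"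
      using is_coproduct_in [OF trunc_C] initial_trunc [OF graded] by auto
    then show "(w n \<cdot> \<sigma> (Suc n)) \<cdot> snd (trunc (gobj C) (Suc n)) k
      = Zero M (Dom M (\<sigma> (Suc n))) (Cod M (w n)) \<cdot> snd (trunc (gobj C) (Suc n)) k"
      using w_\<iota> [of k n] k by (simp add: hom_iff)
  qed (auto simp: hom_iff trunc_simps [OF graded])
  fix X g assume g: "g \<in> hom M X (Dom M (w n))" "w n \<cdot> g = Zero M X (Cod M (w n))"
  then have [simp]: "g \<in> Arr M" "Dom M g = X" "Cod M g = CC" "X \<in> Obj M"
    using hom_Obj by (auto simp: hom_iff)
  let ?\<rho> = "retr (gobj C) (Suc n)"
  have "\<sigma> (Suc n) \<cdot> ?\<rho> \<cdot> g = g"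
  proof (rule Proj_jointly_monic [OF graded, unfolded gobj_simps])
    fix m
    have *: "\<pi> m \<cdot> \<sigma> (Suc n) \<cdot> ?\<rho> = (if m < Suc n then \<pi> m else Zero M CC (Pc m))"
      using Proj_initial [OF graded, of m "Suc n"] by simp
    have "\<pi> m \<cdot> \<sigma> (Suc n) \<cdot> ?\<rho> \<cdot> g = (\<pi> m \<cdot> \<sigma> (Suc n) \<cdot> ?\<rho>) \<cdot> g"
      by simp
    also have "\<dots> = \<pi> m \<cdot> g"
    proof (cases "m < Suc n")
      case False
      \<comment> \<open>The \<open>n\<close> factors \<pi> 1 in \<open>w_\<pi>\<close> account for
        degree \<open>n\<close>; since m \<ge> n + 1, a positive degree \<open>k\<close> is left for
        the first factor.\<close>
      then obtain k where k: "m = k + n" "k \<noteq> 0"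
        using le_Suc_ex [of n m] by (auto simp: add.commute)
      obtain r e where e: "monomorphism M e" "Dom M e = Pc (k + n)" "r \<in> hom M (Cod M (w n)) (Cod M e)"
        "r \<cdot> w n = e \<cdot> \<pi> (k + n)"
        using w_\<pi> [OF mono k(2), of n] .
      have [simp]: "e \<in> Arr M" "r \<in> Arr M" "Dom M r = Cod M (w n)" "Cod M r = Cod M e"
        using e monomorphism_Arr by (auto simp: hom_iff)
      have "e \<cdot> \<pi> m \<cdot> g = r \<cdot> w n \<cdot> g"
        using Comp_tail [OF e(4), of g] e(2) by (simp add: k)
      then have "e \<cdot> \<pi> m \<cdot> g = Zero M X (Cod M e)"
        by (simp add: g)
      then have "\<pi> m \<cdot> g = Zero M X (Pc m)"
        using monomorphism_ZeroD [OF e(1), of "\<pi> m \<cdot> g" X] e(2) by (simp add: hom_iff k)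
      then show ?thesis
        unfolding * using False by simp
    qed (simp add: *)
    finally show "\<pi> m \<cdot> \<sigma> (Suc n) \<cdot> ?\<rho> \<cdot> g = \<pi> m \<cdot> g" .
  qed (auto simp: hom_iff)
  then show "\<exists>u \<in> hom M X (Dom M (\<sigma> (Suc n))). \<sigma> (Suc n) \<cdot> u = g"
    by (intro bexI [of _ "?\<rho> \<cdot> g"]) (auto simp: hom_iff)
qed auto

text \<open>The empty coproduct and the chosen zero object are both zero objects, isomorphic through
  zero arrows.\<close>

lemma \<sigma>_0_wedge: "same_subobject M (\<sigma> 0) (wedge M C (\<iota> 0) 0)"
proof -
  let ?Z = "zero_object M" and ?E = "fst (trunc (gobj C) 0)"
  have [simp]: "?E \<in> Obj M"
    using trunc_simps(1) [OF graded] by simp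
  have E: "f = g" if "f \<in> hom M ?E Y" "g \<in> hom M ?E Y" for f g Y
    by (rule coproduct_ext [OF trunc_C that]) simp
  have w: "wedge M C (\<iota> 0) 0 = Zero M ?Z CC"
    by (simp add: wedge_def)
  have "monomorphism M (Zero M ?Z CC)"
    by (rule monomorphismI [where A = ?Z and B = CC]) (auto simp: hom_iff intro: zero_object_unique)
  moreover have "Zero M ?E ?E = Ide M ?E"
    by (rule E [of _ ?E]) (auto simp: hom_iff)
  moreover have "Zero M ?Z ?Z = Ide M ?Z"
    by (rule zero_object_unique(1) [of _ ?Z]) (auto simp: hom_iff)
  ultimately have "monomorphism M (Zero M ?Z CC)" "isomorphism M (Zero M ?E ?Z)"
    unfolding isomorphism_def by (auto intro!: bexI [OF _ Zero_in [of ?Z ?E]])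
  moreover have "Zero M ?Z CC \<cdot> Zero M ?E ?Z = \<sigma> 0"
    by (rule E [of _ CC]) (auto simp: hom_iff)
  ultimately show ?thesis
    unfolding same_subobject_def w using initial_monomorphism [OF graded, of 0]
    by (auto simp: hom_iff intro!: bexI [of _ "Zero M ?E ?Z"])
qed

lemma \<sigma>_wedge:
  assumes "\<And>a. monomorphism M (\<delta> a 1)"
  shows "same_subobject M (\<sigma> n) (wedge M C (\<iota> 0) n)"
  using \<sigma>_0_wedge is_kernel_same_subobject [OF \<sigma>_kernel [OF assms] wedge_kernel] by (cases n) auto

text \<open>The form in which the hypothesis on the second wedge power is used: \<open>w 1\<close>
  has kernel C(2), so \<open>g\<close> factors through C(2), on which the projections to degrees 2
  and above vanish.\<close>

lemma w_1_\<iota>: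
  assumes wedge: "same_subobject M (\<sigma> 2) (wedge M C (\<iota> 0) 2)"
    and g: "g \<in> hom M X CC" "w 1 \<cdot> g = Zero M X (Cod M (w 1))" and "m \<ge> 2"
  shows "\<pi> m \<cdot> g = Zero M X (Pc m)"
proof -
  have [simp]: "g \<in> Arr M" "Dom M g = X" "Cod M g = CC" "X \<in> Obj M"
    using g hom_Obj by (auto simp: hom_iff)
  let ?k = "wedge M C (\<iota> 0) 2"
  have k: "is_kernel M ?k (w 1)"
    using wedge_kernel [of 1] by (simp add: numeral_2_eq_2)
  obtain v where v: "v \<in> hom M X (Dom M ?k)" "?k \<cdot> v = g"
    using is_kernel_factor [OF k, of g X] g by auto
  obtain u where u: "u \<in> hom M (Dom M (\<sigma> 2)) (Dom M ?k)" "isomorphism M u" "?k \<cdot> u = \<sigma> 2"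
    using wedge by (auto simp: same_subobject_def)
  obtain u' where u': "u' \<in> hom M (Dom M ?k) (Dom M (\<sigma> 2))" "u \<cdot> u' = Ide M (Dom M ?k)"
    using isomorphismE [OF u(2)] u(1) by (metis hom_iff)
  have [simp]: "?k \<in> Arr M" "Cod M ?k = CC" "u \<in> Arr M" "Dom M u = fst (trunc (gobj C) 2)" "Cod M u = Dom M ?k"
    "u' \<in> Arr M" "Dom M u' = Dom M ?k" "Cod M u' = fst (trunc (gobj C) 2)" "v \<in> Arr M" "Dom M v = X" "Cod M v = Dom M ?k"
    using is_kernel_Arr(1) [OF k] u u' v by (auto simp: hom_iff)
  have g_eq: "g = \<sigma> 2 \<cdot> u' \<cdot> v"
    unfolding u(3) [symmetric] using Comp_tail [OF u'(2), of v] v by simp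
  have "\<pi> m \<cdot> \<sigma> 2 = \<pi> m \<cdot> (\<sigma> 2 \<cdot> retr (gobj C) 2) \<cdot> \<sigma> 2"
    using initial_transition [OF graded, of 2 2] by simp
  also have "\<dots> = (\<pi> m \<cdot> \<sigma> 2 \<cdot> retr (gobj C) 2) \<cdot> \<sigma> 2"
    by simp
  also have "\<dots> = Zero M (fst (trunc (gobj C) 2)) (Pc m)"
    using Proj_initial [OF graded, of m 2] \<open>m \<ge> 2\<close> by simp
  finally have "\<pi> m \<cdot> \<sigma> 2 = Zero M (fst (trunc (gobj C) 2)) (Pc m)" .
  from Comp_tail [OF this, of "u' \<cdot> v"] show ?thesis
    unfolding g_eq by simp
qed

lemma \<delta>_monomorphism_if_wedge:
  assumes wedge: "same_subobject M (\<sigma> 2) (wedge M C (\<iota> 0) 2)"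
  shows "monomorphism M (\<delta> a 1)"
proof (induction a rule: less_induct)
  case (less a)
  show ?case
  proof (cases "a = 0")
    case True
    then show ?thesis
      using \<delta>_0_monomorphism by simp
  next
    case a: False
    have "monomorphism M (\<delta> a (Suc 0))"
    proof (rule monomorphism_ZeroI [where A = "Pc (Suc a)" and B = "Pc a \<otimes> Pc (Suc 0)"])
      fix X g assume g: "g \<in> hom M X (Pc (Suc a))" "\<delta> a (Suc 0) \<cdot> g = Zero M X (Pc a \<otimes> Pc (Suc 0))"
      then have [simp]: "g \<in> Arr M" "Dom M g = X" "Cod M g = Pc (Suc a)" "X \<in> Obj M"
        using hom_Obj by (auto simp: hom_iff)
      \<comment> \<open>Coassociativity writes \<open>(Pc i \<lhd> \<delta> j (Suc 0)) \<cdot>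
        \<delta> i (Suc j) \<cdot> g\<close> as an arrow after
        \<open>\<delta> a (Suc 0) \<cdot> g\<close>, hence as zero; as \<open>j < a\<close>, the
        induction hypothesis makes the first factor monic.\<close>
      have \<delta>_g: "\<delta> i (Suc j) \<cdot> g = Zero M X (Pc i \<otimes> Pc (Suc j))" if ij: "i \<noteq> 0" "i + j = a" for i j
      proof -
        have "monomorphism M (Pc i \<lhd> \<delta> j (Suc 0))"
          using less [of j] ij by (intro monomorphism_Ide_TensorA) auto
        moreover have "(Pc i \<lhd> \<delta> j (Suc 0)) \<cdot> \<delta> i (Suc j) \<cdot> g =
          ((Pc i \<lhd> \<delta> j (Suc 0)) \<cdot> \<delta> i (j + Suc 0)) \<cdot> g"
          using ij by simp
        moreover have "\<dots> = \<a> (Pc i) (Pc j) (Pc (Suc 0)) \<cdot> (\<delta> i j \<rhd> Pc (Suc 0)) \<cdot> \<delta> a (Suc 0) \<cdot> g"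
          unfolding \<delta>_coassoc [symmetric] using ij by simp
        moreover have "\<dots> = Zero M X (Pc i \<otimes> (Pc j \<otimes> Pc (Suc 0)))"
          unfolding g(2) using ij by simp
        ultimately show ?thesis
          using monomorphism_ZeroD [of "(Pc i) \<lhd> \<delta> j (Suc 0)" "\<delta> i (Suc j) \<cdot> g" X] ij
          by (simp add: hom_iff)
      qed
      have pL_hom: "pL \<in> hom M CC (Cod M pL)"
        by (simp add: hom_iff)
      have "w 1 \<cdot> \<iota> (Suc a) \<cdot> g = ((pL \<boxtimes> pL) \<cdot> \<Delta> \<cdot> \<iota> (Suc a)) \<cdot> g"
        by simp
      also have "\<dots> = sum_upto M (\<lambda>c. ((pL \<cdot> \<iota> c) \<boxtimes> (pL \<cdot> \<iota> (Suc a - c))) \<cdot> \<delta> c (Suc a - c)) (Suc a) \<cdot> g"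
        using GC.tensor_comult_Inj [of pL "Cod M pL" pL "Cod M pL" "Suc a"] pL_hom
        by (simp del: sum_upto.simps)
      also have "\<dots> = sum_upto M (\<lambda>c. (((pL \<cdot> \<iota> c) \<boxtimes> (pL \<cdot> \<iota> (Suc a - c))) \<cdot> \<delta> c (Suc a - c)) \<cdot> g) (Suc a)"
        by (rule sum_upto_Comp [where A = X and B = "Pc (Suc a)" and C = "Cod M pL \<otimes> Cod M pL"]) (auto simp: hom_iff)
      also have "\<dots> = Zero M X (Cod M pL \<otimes> Cod M pL)"
      proof (rule sum_upto_Zero)
        fix c assume c: "c \<le> Suc a"
        \<comment> \<open>The two outer terms contain \<open>pL \<cdot> \<iota> 0\<close>, which is
          zero; the inner ones have both degrees positive and fall to
          \<open>\<delta>_g\<close>.\<close>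
        consider "c = 0" | "c = Suc a" | "c \<noteq> 0" "c \<le> a"
          using c by linarith
        then show "(((pL \<cdot> \<iota> c) \<boxtimes> (pL \<cdot> \<iota> (Suc a - c))) \<cdot> \<delta> c (Suc a - c)) \<cdot> g = Zero M X (Cod M pL \<otimes> Cod M pL)"
        proof cases
          case 3
          then show ?thesis
            using \<delta>_g [of c "a - c"] by (simp add: Suc_diff_le)
        qed simp_all
      qed auto
      finally have "w 1 \<cdot> \<iota> (Suc a) \<cdot> g = Zero M X (Cod M (w 1))"
        by simp
      \<comment> \<open>As \<open>a \<noteq> 0\<close>, the degree \<open>Suc a\<close> is at least
        2 and thus lies outside C(2).\<close>
      then have "\<pi> (Suc a) \<cdot> \<iota> (Suc a) \<cdot> g = Zero M X (Pc (Suc a))"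
        using a by (intro w_1_\<iota> [OF wedge]) (auto simp: hom_iff)
      then show "g = Zero M X (Pc (Suc a))"
        using Comp_tail [OF \<pi>_\<iota>_simps(1) [of "Suc a"], of g] by simp
    qed (auto simp: hom_iff)
    then show ?thesis
      by simp
  qed
qed

text \<open>Everything has been shown for the explicit \<Psi>; uniqueness transfers it to an
  arbitrary homomorphism with the two prescribed projections.\<close>

lemma cotensor_coalgebra_characterization:
  shows "\<exists>!\<psi>. is_\<psi> \<psi>"
    and "is_\<psi> \<psi> \<Longrightarrow> graded_coalgebra_hom M C T \<psi>"
    and "is_\<psi> \<psi> \<Longrightarrow> graded_part M (gobj C) (gobj T) \<psi> m =
      cotensor_pow_arr M Z0 B V (\<pi> 1) m \<cdot> cotensor_iterated_comult M C Z0 (\<pi> 0) m \<cdot> \<iota> m"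
    and "strongly_graded M C \<longleftrightarrow> (\<forall>a. monomorphism M (\<delta> a 1))"
    and "is_\<psi> \<psi> \<Longrightarrow> strongly_graded M C \<longleftrightarrow> (\<forall>n. monomorphism M (graded_part M (gobj C) (gobj T) \<psi> n))"
    and "is_\<psi> \<psi> \<Longrightarrow> strongly_graded M C \<longleftrightarrow> monomorphism M \<psi>"
    and "strongly_graded M C \<longleftrightarrow> (\<forall>n. same_subobject M (\<sigma> n) (wedge M C (\<iota> 0) n))"
    and "strongly_graded M C \<longleftrightarrow> same_subobject M (\<sigma> 2) (wedge M C (\<iota> 0) 2)"
proof -
  show "\<exists>!\<psi>. is_\<psi> \<psi>"
    using is_\<psi>_\<Psi> is_\<psi>_unique by blast
  have \<psi>: "is_\<psi> \<psi> \<Longrightarrow> \<psi> = \<Psi>" for \<psi>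
    using is_\<psi>_\<Psi> is_\<psi>_unique by blast
  show "is_\<psi> \<psi> \<Longrightarrow> graded_coalgebra_hom M C T \<psi>"
    using \<psi> graded_coalgebra_hom_\<Psi> by blast
  have "cotensor_pow_arr M Z0 B V (\<pi> 1) m \<cdot> cotensor_iterated_comult M C Z0 (\<pi> 0) m \<cdot> \<iota> m = \<psi>c m"
    by (simp only: \<psi>c_def \<phi>_\<iota>)
  then show "is_\<psi> \<psi> \<Longrightarrow> graded_part M (gobj C) (gobj T) \<psi> m =
      cotensor_pow_arr M Z0 B V (\<pi> 1) m \<cdot> cotensor_iterated_comult M C Z0 (\<pi> 0) m \<cdot> \<iota> m"
    using \<psi> graded_part_\<Psi> by metis
  show a': "strongly_graded M C \<longleftrightarrow> (\<forall>a. monomorphism M (\<delta> a 1))"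
    using \<psi>c_monomorphism strongly_graded_if_\<psi>c by (meson strongly_graded_def)
  then have b: "strongly_graded M C \<longleftrightarrow> (\<forall>n. monomorphism M (\<psi>c n))"
    using \<psi>c_monomorphism strongly_graded_if_\<psi>c by metis
  then show "is_\<psi> \<psi> \<Longrightarrow> strongly_graded M C \<longleftrightarrow> (\<forall>n. monomorphism M (graded_part M (gobj C) (gobj T) \<psi> n))"
    using \<psi> graded_part_\<Psi> by metis
  show "is_\<psi> \<psi> \<Longrightarrow> strongly_graded M C \<longleftrightarrow> monomorphism M \<psi>"
    using \<psi> b \<Psi>_monomorphism_iff by metis
  show "strongly_graded M C \<longleftrightarrow> (\<forall>n. same_subobject M (\<sigma> n) (wedge M C (\<iota> 0) n))"
    "strongly_graded M C \<longleftrightarrow> same_subobject M (\<sigma> 2) (wedge M C (\<iota> 0) 2)"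
    using a' \<sigma>_wedge \<delta>_monomorphism_if_wedge by metis+
qed

end

theorem theorem2p22:
  fixes M :: "('o, 'm) monoidal" (structure)
    and C :: "('o, 'm) graded_coalgebra"
  assumes "infinite (UNIV :: 'u set)"
    and "coabelian_monoidal_category M"
    and "complete TYPE('u) M"
    and "cocomplete TYPE('u) M"
    and "AB5 TYPE('u) M"
    and "tensor_commutes_with_sums TYPE('u) M"
    and "is_graded_coalgebra M C"
  shows "(\<exists>!\<psi>. coalgebra_hom M C (Tc M C) \<psi> \<and>
            proj M (Tc M C) 0 \<cdot> \<psi> = proj M C 0 \<and> proj M (Tc M C) 1 \<cdot> \<psi> = proj M C 1) \<and>
    (\<forall>\<psi>. coalgebra_hom M C (Tc M C) \<psi> \<and>
         proj M (Tc M C) 0 \<cdot> \<psi> = proj M C 0 \<and> proj M (Tc M C) 1 \<cdot> \<psi> = proj M C 1 \<longrightarrow>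
       graded_coalgebra_hom M C (Tc M C) \<psi> \<and>
       (\<forall>m. graded_part M (gobj C) (gobj (Tc M C)) \<psi> m =
          cotensor_pow_arr M (zero_part M C)
            (induced_bicomodule M C (proj M C 0)) (degree_part_bicomodule M C 1) (proj M C 1) m
          \<cdot> cotensor_iterated_comult M C (zero_part M C) (proj M C 0) m \<cdot> Incl C m) \<and>
       (strongly_graded M C \<longleftrightarrow> (\<forall>a. monomorphism M (comult_part M C a 1))) \<and>
       (strongly_graded M C \<longleftrightarrow>
          (\<forall>n. monomorphism M (graded_part M (gobj C) (gobj (Tc M C)) \<psi> n))) \<and>
       (strongly_graded M C \<longleftrightarrow> monomorphism M \<psi>) \<and>
       (strongly_graded M C \<longleftrightarrow>
          (\<forall>n. same_subobject M (initial_inj M (gobj C) n) (wedge M C (Incl C 0) n))) \<and>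
       (strongly_graded M C \<longleftrightarrow>
          same_subobject M (initial_inj M (gobj C) 2) (wedge M C (Incl C 0) 2)))"
proof -
  \<comment> \<open>An infinite universe contains a copy of \<open>nat\<close>, which makes the
    countable coproducts and sequential colimits above small.\<close>
  obtain h :: "nat \<Rightarrow> 'u" where "inj h"
    using infinite_countable_subset [OF assms(1)] by blast
  interpret coabelian_monoidal_category M
    by (rule assms)
  interpret graded_coalgebra_AB5 M h C
    by unfold_locales (use assms \<open>inj h\<close> in auto)
  note * = cotensor_coalgebra_characterization [unfolded is_\<psi>_def T_def Z0_def V_def B_def]
  show ?thesis
    using * by blast
qed

end
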